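(* Let $\{(G_t,Y_t)\}_{t\ge 0}$ be a DED process with period $K$, parameter set $\Theta\subseteq\mathbb R^d$, event probabilities $p_t(\theta)=1-\exp(-\lambda_t(\theta))$ with $\lambda_t=\lambda_{t\bmod K}$, and limiting gating frequencies $\gamma(\theta)$. Let $\theta_0\in\operatorname{int}(\Theta)$, and assume: (1) there are constants $0<\lambda_{\min}\le\lambda_{\max}<\infty$ with $\lambda_{\min}\le\lambda_r(\theta)\le\lambda_{\max}$ for all $r=0,\dots,K-1$ and $\theta\in\Theta$; (2) for each $r=0,\dots,K-1$, $\lambda_r:\Theta\to\mathbb R$ extends to a $C^3$ map on an open set containing $\Theta$; (3) if $\theta\in\Theta$ satisfies $\lambda_r(\theta)=\lambda_r(\theta_0)$ for all $r$ with $\gamma_r(\theta_0)>0$, then $\theta=\theta_0$; (4) $\Theta$ is compact; (5) the matrix $\mathcal I_0=\mathcal I(\theta_0;\gamma(\theta_0))$ is positive definite. Let $(\hat\theta_T)_{T\ge0}$ be a sequence of estimators ($\hat\theta_T$ a function of $X_{0:T-1}$) that is regular at $\theta_0$ with limit law $\mathcal L_{\theta_0}$. Then there exists a probability measure $\nu_{\theta_0}$ on $\mathbb R^d$ such that $$\mathcal L_{\theta_0}=\mathcal N\bigl(0,\mathcal I_0^{-1}\bigr)*\nu_{\theta_0},$$ where $*$ denotes convolution.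
   Context: $\mathbb N=\{0,1,2,\dots\}$. Fix an integer $K\ge 1$ (period), an integer $D\in\mathbb N$ (dead time), and a parameter set $\Theta\subseteq\mathbb R^d$. For each $\theta\in\Theta$ let $p_t(\theta)\in[0,1]$, $t\in\mathbb N$, with $p_{t+K}(\theta)=p_t(\theta)$, written $p_t(\theta)=1-\exp(-\lambda_t(\theta))$. A DED (dead-time event detection) process is a stochastic process $\{(G_t,Y_t)\}_{t\ge0}$ with $G_t,Y_t\in\{0,1\}$, whose law under parameter $\theta$ is denoted $P_\theta$, such that: (i) (observation) under $P_\theta$ there are independent $Z_t\sim\mathrm{Ber}(p_t(\theta))$, $t\in\mathbb N$, with $Y_t=G_tZ_t$; (ii) (dead time) almost surely, $Y_t=1$ implies $G_s=0$ for all $s\in\{t+1,\dots,t+D\}$; (iii) (causality) for every $t$ there are $U_t\sim\mathrm{Unif}([0,1])$, jointly independent of the event sequence $\{Z_s\}_{s\ge0}$ and the past observations $\{(G_s,Y_s)\}_{s=0}^{t-1}$, and a measurable map $\Phi_t:\{0,1\}^{2t}\times[0,1]\to\{0,1\}$, not depending on $\theta$, such that $G_t=\Phi_t(G_0,Y_0,\dots,G_{t-1},Y_{t-1},U_t)$ a.s.; (iv) (gating-frequency convergence) for every $\theta\in\Theta$ there is $\gamma(\theta)\in[0,1]^K$ such that for each $r=0,\dots,K-1$, $\frac1L\sum_{\ell=0}^{L-1}G_{r+\ell K}\to\gamma_r(\theta)$ in $P_\theta$-probability as $L\to\infty$. $P_{\theta,T}$ denotes the law of $X_{0:T-1}=((G_0,Y_0),\dots,(G_{T-1},Y_{T-1}))$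 under $\theta$. Fisher information: for $r=0,\dots,K-1$, $\mathcal I_r(\theta)=\frac{1-p_r(\theta)}{p_r(\theta)}\nabla\lambda_r(\theta)\nabla\lambda_r(\theta)^\top$; for $\alpha\in[0,1]^K$, $\mathcal I(\theta;\alpha)=\frac1K\sum_{r=0}^{K-1}\alpha_r\mathcal I_r(\theta)$. Regular estimator: $(\hat\theta_T)_{T\ge0}$ is regular at $\theta_0$ with limit law $\mathcal L_{\theta_0}$ (a probability measure on $\mathbb R^d$) if for every fixed sufficiently small $h\in\mathbb R^d$, $\sqrt T\bigl(\hat\theta_T-\theta_0-h/\sqrt T\bigr)\Rightarrow\mathcal L_{\theta_0}$ under $P_{\theta_0+h/\sqrt T,\,T}$ as $T\to\infty$ (the limit law being the same for all such $h$). *)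

theory Defs
  imports "HOL-Probability.Probability"
begin

section \<open>Calculus and linear algebra\<close>

text \<open>On an open set \<open>S\<close> this is the usual class \<open>C\<^sup>k\<close>: all iterated directional derivatives up to
  order \<open>k\<close> exist and are continuous.\<close>

primrec Ck_on :: "nat \<Rightarrow> 'a::euclidean_space set \<Rightarrow> ('a \<Rightarrow> real) \<Rightarrow> bool" where
  "Ck_on 0 S f \<longleftrightarrow> continuous_on S f"
| "Ck_on (Suc k) S f \<longleftrightarrow>
     (\<forall>x\<in>S. f differentiable (at x)) \<and> (\<forall>v. Ck_on k S (\<lambda>x. frechet_derivative f (at x) v))"

definition extends_Ck :: "nat \<Rightarrow> 'a::euclidean_space set \<Rightarrow> ('a \<Rightarrow> real) \<Rightarrow> bool" where
  "extends_Ck k S f \<longleftrightarrow> (\<exists>V F. open V \<and> S \<subseteq> V \<and> Ck_on k V F \<and> (\<forall>x\<in>S. F x = f x))"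

definition gradient :: "('a::real_inner \<Rightarrow> real) \<Rightarrow> 'a \<Rightarrow> 'a" where
  "gradient f x = (THE D. GDERIV f x :> D)"

definition outer_product :: "real ^ 'n \<Rightarrow> real ^ 'm \<Rightarrow> real ^ 'm ^ 'n" where
  "outer_product u v = (\<chi> i j. u $ i * v $ j)"

definition positive_definite :: "real ^ 'n ^ 'n \<Rightarrow> bool" where
  "positive_definite A \<longleftrightarrow> transpose A = A \<and> (\<forall>x. x \<noteq> 0 \<longrightarrow> x \<bullet> (A *v x) > 0)"


section \<open>Probability on Euclidean space\<close>

text \<open>Weak convergence tested on bounded continuous functions; the library's \<^const>\<open>weak_conv_m\<close> is
  restricted to the real line.\<close>

definition weakly_converges :: "(nat \<Rightarrow> 'a::euclidean_space measure) \<Rightarrow> 'a measure \<Rightarrow> bool" where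
  "weakly_converges \<mu> L \<longleftrightarrow>
     (\<forall>f :: 'a \<Rightarrow> real. continuous_on UNIV f \<longrightarrow> bounded (range f) \<longrightarrow>
        (\<lambda>n. integral\<^sup>L (\<mu> n) f) \<longlonglongrightarrow> integral\<^sup>L L f)"

definition converges_in_probability :: "'w measure \<Rightarrow> (nat \<Rightarrow> 'w \<Rightarrow> real) \<Rightarrow> real \<Rightarrow> bool" where
  "converges_in_probability M W c \<longleftrightarrow>
     (\<forall>\<epsilon>>0. (\<lambda>n. measure M {\<omega> \<in> space M. \<bar>W n \<omega> - c\<bar> > \<epsilon>}) \<longlonglongrightarrow> 0)"

text \<open>The normal law \<open>N(m, S)\<close> given by its Lebesgue density. It is meant for a positive definite
  covariance matrix \<open>S\<close> only; degenerate normal laws are not covered.\<close>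

definition mv_normal :: "real ^ 'n \<Rightarrow> real ^ 'n ^ 'n \<Rightarrow> (real ^ 'n) measure" where
  "mv_normal m S = density lborel (\<lambda>x. ennreal
     (exp (- ((x - m) \<bullet> (matrix_inv S *v (x - m))) / 2) / sqrt ((2 * pi) ^ CARD('n) * det S)))"


section \<open>Dead-time event detection processes\<close>

text \<open>Values in \<open>{0, 1}\<close> are encoded as booleans. The statistical model is a family \<open>M \<theta>\<close> of
  probability measures on a sample space that carries the observed process \<open>(G, Y)\<close> and is rich
  enough for the latent variables \<open>Z\<close> and \<open>U\<close>, which may be different variables under different
  parameters. The observation \<open>((G 0, Y 0), \<dots>, (G (T-1), Y (T-1)))\<close> is a list of length \<open>T\<close>.\<close>

definition observations ::
    "(nat \<Rightarrow> 'w \<Rightarrow> bool) \<Rightarrow> (nat \<Rightarrow> 'w \<Rightarrow> bool) \<Rightarrow> nat \<Rightarrow> 'w \<Rightarrow> (bool \<times> bool) list" where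
  "observations G Y T \<omega> = map (\<lambda>t. (G t \<omega>, Y t \<omega>)) [0..<T]"

definition observation_law ::
    "('p \<Rightarrow> 'w measure) \<Rightarrow> (nat \<Rightarrow> 'w \<Rightarrow> bool) \<Rightarrow> (nat \<Rightarrow> 'w \<Rightarrow> bool) \<Rightarrow> 'p \<Rightarrow> nat
      \<Rightarrow> (bool \<times> bool) list measure" where
  "observation_law M G Y \<theta> T = distr (M \<theta>) (count_space UNIV) (observations G Y T)"

definition observation_condition ::
    "'w measure \<Rightarrow> (nat \<Rightarrow> real) \<Rightarrow> (nat \<Rightarrow> 'w \<Rightarrow> bool) \<Rightarrow> (nat \<Rightarrow> 'w \<Rightarrow> bool)
      \<Rightarrow> (nat \<Rightarrow> 'w \<Rightarrow> bool) \<Rightarrow> bool" where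
  "observation_condition M q G Y Z \<longleftrightarrow>
     prob_space.indep_vars M (\<lambda>_. count_space UNIV) Z UNIV \<and>
     (\<forall>t. distr M (count_space UNIV) (Z t) = measure_pmf (bernoulli_pmf (q t))) \<and>
     (\<forall>t. AE \<omega> in M. Y t \<omega> \<longleftrightarrow> G t \<omega> \<and> Z t \<omega>)"

definition dead_time_condition ::
    "'w measure \<Rightarrow> nat \<Rightarrow> (nat \<Rightarrow> 'w \<Rightarrow> bool) \<Rightarrow> (nat \<Rightarrow> 'w \<Rightarrow> bool) \<Rightarrow> bool" where
  "dead_time_condition M D G Y \<longleftrightarrow>
     (AE \<omega> in M. \<forall>t. Y t \<omega> \<longrightarrow> (\<forall>s\<in>{t + 1..t + D}. \<not> G s \<omega>))"

text \<open>\<open>U\<close> is independent of the pair formed by the whole sequence \<open>Z\<close> and the past observations.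
  The two components of that pair are not required to be independent of each other. The generated
  sigma-algebras are used because \<^const>\<open>prob_space.indep_var\<close> needs variables of one type.\<close>

definition causality_condition ::
    "'w measure \<Rightarrow> (nat \<Rightarrow> (bool \<times> bool) list \<Rightarrow> real \<Rightarrow> bool) \<Rightarrow> (nat \<Rightarrow> 'w \<Rightarrow> bool)
      \<Rightarrow> (nat \<Rightarrow> 'w \<Rightarrow> bool) \<Rightarrow> (nat \<Rightarrow> 'w \<Rightarrow> bool) \<Rightarrow> bool" where
  "causality_condition M \<Phi> G Y Z \<longleftrightarrow>
     (\<forall>t. \<exists>U :: 'w \<Rightarrow> real.
        distr M lborel U = uniform_measure lborel {0..1} \<and>
        prob_space.indep_set M
          (sets (vimage_algebra (space M) U borel))
          (sets (vimage_algebra (space M) (\<lambda>\<omega>. (\<lambda>s. Z s \<omega>, observations G Y t \<omega>))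
            ((\<Pi>\<^sub>M s\<in>UNIV. count_space UNIV) \<Otimes>\<^sub>M count_space UNIV))) \<and>
        (AE \<omega> in M. G t \<omega> = \<Phi> t (observations G Y t \<omega>) (U \<omega>)))"

definition gating_frequency_condition ::
    "'w measure \<Rightarrow> nat \<Rightarrow> (nat \<Rightarrow> 'w \<Rightarrow> bool) \<Rightarrow> (nat \<Rightarrow> real) \<Rightarrow> bool" where
  "gating_frequency_condition M K G g \<longleftrightarrow>
     (\<forall>r<K. g r \<in> {0..1} \<and>
        converges_in_probability M
          (\<lambda>L \<omega>. (\<Sum>l<L. of_bool (G (r + l * K) \<omega>)) / real L) (g r))"

definition DED_process ::
    "nat \<Rightarrow> nat \<Rightarrow> 'p set \<Rightarrow> (nat \<Rightarrow> 'p \<Rightarrow> real) \<Rightarrow> ('p \<Rightarrow> nat \<Rightarrow> real)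
      \<Rightarrow> ('p \<Rightarrow> 'w measure) \<Rightarrow> (nat \<Rightarrow> 'w \<Rightarrow> bool) \<Rightarrow> (nat \<Rightarrow> 'w \<Rightarrow> bool) \<Rightarrow> bool" where
  "DED_process K D \<Theta> p \<gamma> M G Y \<longleftrightarrow>
     (\<forall>\<theta>\<in>\<Theta>. \<forall>t. p t \<theta> \<in> {0..1} \<and> p (t + K) \<theta> = p t \<theta>) \<and>
     (\<forall>\<theta>\<in>\<Theta>. prob_space (M \<theta>) \<and>
        (\<forall>t. G t \<in> measurable (M \<theta>) (count_space UNIV) \<and>
             Y t \<in> measurable (M \<theta>) (count_space UNIV))) \<and>
     (\<forall>\<theta>\<in>\<Theta>. dead_time_condition (M \<theta>) D G Y) \<and>
     (\<exists>\<Phi>. (\<forall>t. case_prod (\<Phi> t) \<in> measurable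
              (count_space {xs. length xs = t} \<Otimes>\<^sub>M restrict_space borel {0..1}) (count_space UNIV)) \<and>
        (\<forall>\<theta>\<in>\<Theta>. \<exists>Z. observation_condition (M \<theta>) (\<lambda>t. p t \<theta>) G Y Z \<and>
                   causality_condition (M \<theta>) \<Phi> G Y Z)) \<and>
     (\<forall>\<theta>\<in>\<Theta>. gating_frequency_condition (M \<theta>) K G (\<gamma> \<theta>))"


section \<open>Fisher information and regular estimators\<close>

definition phase_information ::
    "(nat \<Rightarrow> real ^ 'd \<Rightarrow> real) \<Rightarrow> (nat \<Rightarrow> real ^ 'd \<Rightarrow> real) \<Rightarrow> nat \<Rightarrow> real ^ 'd \<Rightarrow> real ^ 'd ^ 'd" where
  "phase_information p lam r \<theta> =
     ((1 - p r \<theta>) / p r \<theta>) *\<^sub>R outer_product (gradient (lam r) \<theta>) (gradient (lam r) \<theta>)"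

definition fisher_information ::
    "nat \<Rightarrow> (nat \<Rightarrow> real ^ 'd \<Rightarrow> real) \<Rightarrow> (nat \<Rightarrow> real ^ 'd \<Rightarrow> real) \<Rightarrow> real ^ 'd \<Rightarrow> (nat \<Rightarrow> real)
      \<Rightarrow> real ^ 'd ^ 'd" where
  "fisher_information K p lam \<theta> \<alpha> =
     (1 / real K) *\<^sub>R (\<Sum>r<K. \<alpha> r *\<^sub>R phase_information p lam r \<theta>)"

text \<open>\<open>P \<theta> T\<close> is the law of the first \<open>T\<close> observations. For \<open>\<theta>0\<close> in the interior of the parameter
  set, \<open>\<theta>0 + h / \<surd>T\<close> is a parameter for all large \<open>T\<close>; the other terms do not affect the limit.\<close>

definition regular_estimator ::
    "(real ^ 'd \<Rightarrow> nat \<Rightarrow> 'x measure) \<Rightarrow> (nat \<Rightarrow> 'x \<Rightarrow> real ^ 'd) \<Rightarrow> real ^ 'd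
      \<Rightarrow> (real ^ 'd) measure \<Rightarrow> bool" where
  "regular_estimator P est \<theta>0 L \<longleftrightarrow>
     prob_space L \<and> sets L = sets borel \<and>
     (\<exists>\<epsilon>>0. \<forall>h. norm h < \<epsilon> \<longrightarrow>
        weakly_converges
          (\<lambda>T. distr (P (\<theta>0 + h /\<^sub>R sqrt (real T)) T) borel
                 (\<lambda>x. sqrt (real T) *\<^sub>R (est T x - \<theta>0 - h /\<^sub>R sqrt (real T))))
          L)"

end

theory Submission
  imports Defs "HOL-Complex_Analysis.Complex_Analysis" "HOL-Real_Asymp.Real_Asymp"
begin

text \<open>
  The gating mechanism does not depend on the parameter, so the likelihood ratio of \<open>\<theta>0 + h / \<surd>T\<close>
  against \<open>\<theta>0\<close> is a product of Bernoulli ratios over the times at which the gate is open. Each factor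
  is affine in the change of the event probability, and an \<open>L\<^sup>2\<close> recursion over time compares the
  product with \<open>exp (h \<bullet> \<Delta>\<^sub>T - V\<^sub>T / 2)\<close>, where \<open>\<Delta>\<^sub>T\<close> is the normalised score; convergence of the
  gating frequencies replaces \<open>V\<^sub>T\<close> by \<open>h \<bullet> (I h)\<close>.

  Let \<open>S\<^sub>T = \<surd>T (est - \<theta>0)\<close>, fix \<open>u\<close> and put \<open>v = I\<^sup>-\<^sup>1 u\<close>. Regularity along \<open>h = s v\<close> gives the limit of
  \<open>F\<^sub>T(s) = E exp (\<i> u \<bullet> S\<^sub>T + s v \<bullet> \<Delta>\<^sub>T)\<close> for small real \<open>s\<close>. These functions are entire and locally
  uniformly bounded, so by Vitali's theorem they converge at \<open>s = - \<i>\<close> too. This is the characteristic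
  function of \<open>S\<^sub>T - I\<^sup>-\<^sup>1 \<Delta>\<^sub>T\<close> at \<open>u\<close>; it converges to \<open>exp (u \<bullet> v / 2)\<close> times that of the limit
  law, and a subsequential weak limit of this tight sequence is the factor \<open>\<nu>\<close>. Neither a central limit
  theorem nor a joint limit of \<open>S\<^sub>T\<close> and \<open>\<Delta>\<^sub>T\<close> is needed.
\<close>


section \<open>Linear changes of variables\<close>

text \<open>A gate may depend on the whole past, so the steps of the likelihood are neither
  independent nor identically distributed. Every step estimate is therefore made conditionally on
  the past, given an open gate, and uniformly in the gate probability; the limiting gating
  frequencies enter only through the information sum. Before that, the law of the observations is
  identified with the finitely supported \<open>traj\<close>, in which the parameter occurs only in
  the event probabilities; expectations become finite sums, which is why they are entire in s. The
  direction v = J^-1 u, with J the information matrix, has two effects: h = s v makes h . J h and u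
  . h multiples of the same number c = u . v, and s = - i turns exp (s v . Delta) into the pure
  phase exp (- i u . J^-1 Delta). The uniform bound for complex s rests on exponential moments of
  the score, available because each step is bounded and conditionally centred. Weak compactness in
  R^d is reduced to the real line by coding points along a space-filling curve that reaches each
  ball within a bounded time.\<close>

lemma nn_integral_lborel_split_coordinate:
  fixes f :: "'a::euclidean_space \<Rightarrow> ennreal"
  assumes b: "b \<in> Basis" and [measurable]: "f \<in> borel_measurable borel"
  shows "(\<integral>\<^sup>+x. f x \<partial>lborel) =
    (\<integral>\<^sup>+x. \<integral>\<^sup>+y. f (y *\<^sub>R b + (\<Sum>i\<in>Basis - {b}. x i *\<^sub>R i)) \<partial>lborel \<partial>(\<Pi>\<^sub>M i\<in>Basis - {b}. lborel))"
proof -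
  interpret product_sigma_finite "\<lambda>i::'a. lborel :: real measure" ..
  have ins: "insert b (Basis - {b}) = (Basis :: 'a set)" using b by auto
  have m: "(\<lambda>x. f (\<Sum>i\<in>Basis. x i *\<^sub>R i)) \<in> borel_measurable (Pi\<^sub>M (insert b (Basis - {b})) (\<lambda>i. lborel))"
    unfolding ins by measurable
  have split: "(\<Sum>i\<in>Basis. (x(b := y)) i *\<^sub>R i) = y *\<^sub>R b + (\<Sum>i\<in>Basis - {b}. x i *\<^sub>R i)"
    for x :: "'a \<Rightarrow> real" and y
    by (subst sum.remove[OF finite_Basis b]) (auto intro!: sum.cong)
  have "(\<integral>\<^sup>+x. f x \<partial>lborel) = (\<integral>\<^sup>+x. f (\<Sum>i\<in>Basis. x i *\<^sub>R i) \<partial>(\<Pi>\<^sub>M i\<in>insert b (Basis - {b}). lborel))"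
    unfolding ins by (subst lborel_eq) (subst nn_integral_distr, measurable)
  also have "\<dots> = (\<integral>\<^sup>+x. \<integral>\<^sup>+y. f (\<Sum>i\<in>Basis. (x(b := y)) i *\<^sub>R i) \<partial>lborel \<partial>(\<Pi>\<^sub>M i\<in>Basis - {b}. lborel))"
    using product_nn_integral_insert[OF _ _ m] by simp
  finally show ?thesis by (simp only: split)
qed

text \<open>With the other coordinates fixed, the shear translates the coordinate along
  \<open>b\<close> by a constant, so translation invariance on the line is applied in the inner
  integral.\<close>

lemma nn_integral_lborel_shear:
  fixes f :: "'a::euclidean_space \<Rightarrow> ennreal"
  assumes b: "b \<in> Basis" "c \<in> Basis" "b \<noteq> c" and [measurable]: "f \<in> borel_measurable borel"
  shows "(\<integral>\<^sup>+x. f (x + (x \<bullet> c) *\<^sub>R b) \<partial>lborel) = (\<integral>\<^sup>+x. f x \<partial>lborel)"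
proof -
  let ?z = "\<lambda>x y. y *\<^sub>R b + (\<Sum>i\<in>Basis - {b}. x i *\<^sub>R i) :: 'a"
  have c: "?z x y \<bullet> c = x c" for x y
    using b by (simp add: inner_add_left inner_sum_left inner_Basis if_distrib sum.delta cong: if_cong)
  have "(\<integral>\<^sup>+x. f (x + (x \<bullet> c) *\<^sub>R b) \<partial>lborel) =
      (\<integral>\<^sup>+x. \<integral>\<^sup>+y. f (?z x y + (?z x y \<bullet> c) *\<^sub>R b) \<partial>lborel \<partial>(\<Pi>\<^sub>M i\<in>Basis - {b}. lborel))"
    by (intro nn_integral_lborel_split_coordinate b) measurable
  also have "\<dots> = (\<integral>\<^sup>+x. \<integral>\<^sup>+y. f (?z x (x c + 1 * y)) \<partial>lborel \<partial>(\<Pi>\<^sub>M i\<in>Basis - {b}. lborel))"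
    unfolding c by (simp add: algebra_simps)
  also have "\<dots> = (\<integral>\<^sup>+x. \<integral>\<^sup>+y. f (?z x y) \<partial>lborel \<partial>(\<Pi>\<^sub>M i\<in>Basis - {b}. lborel))"
  proof (rule nn_integral_cong)
    fix x :: "'a \<Rightarrow> real"
    show "(\<integral>\<^sup>+y. f (?z x (x c + 1 * y)) \<partial>lborel) = (\<integral>\<^sup>+y. f (?z x y) \<partial>lborel)"
      by (subst nn_integral_real_affine[where c=1 and t="x c" and f="\<lambda>y. f (?z x y)"]) auto
  qed
  also have "\<dots> = (\<integral>\<^sup>+x. f x \<partial>lborel)"
    by (intro nn_integral_lborel_split_coordinate[symmetric] b) measurable
  finally show ?thesis .
qed

text \<open>The claim is stable under composition, so elementary maps suffice: those that kill a
  coordinate (excluded by the determinant), diagonal maps, transpositions and shears. It is used to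
  recognise the density in \<open>mv_normal\<close> as that of a linear image of a standard
  Gaussian.\<close>

lemma nn_integral_lborel_linear:
  fixes h :: "real^'n \<Rightarrow> real^'n"
  assumes "linear h" "det (matrix h) \<noteq> 0" and "f \<in> borel_measurable borel"
  shows "\<bar>det (matrix h)\<bar> * (\<integral>\<^sup>+x. f (h x) \<partial>lborel) = (\<integral>\<^sup>+x. f x \<partial>lborel)"
proof -
  have "det (matrix h) \<noteq> 0 \<longrightarrow> (\<forall>f\<in>borel_measurable borel.
      \<bar>det (matrix h)\<bar> * (\<integral>\<^sup>+x. f (h x) \<partial>lborel) = (\<integral>\<^sup>+x. f x \<partial>lborel))" (is "?P h")
  proof (rule induct_linear_elementary[OF assms(1)])
    fix g h :: "real^'n \<Rightarrow> real^'n" assume lin: "linear g" "linear h" and P: "?P g" "?P h"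
    have [measurable]: "g \<in> borel_measurable borel" "h \<in> borel_measurable borel"
      using lin by (auto intro!: borel_measurable_continuous_onI linear_continuous_on simp: linear_conv_bounded_linear)
    show "?P (g \<circ> h)"
    proof (intro impI ballI)
      fix f :: "real^'n \<Rightarrow> ennreal" assume nz: "det (matrix (g \<circ> h)) \<noteq> 0" and [measurable]: "f \<in> borel_measurable borel"
      have d: "det (matrix (g \<circ> h)) = det (matrix g) * det (matrix h)"
        using lin by (simp add: matrix_compose det_mul)
      with nz have "det (matrix g) \<noteq> 0" "det (matrix h) \<noteq> 0" by auto
      moreover have "\<bar>det (matrix h)\<bar> * (\<integral>\<^sup>+x. f (g (h x)) \<partial>lborel) = (\<integral>\<^sup>+x. f (g x) \<partial>lborel)"
        using P(2) calculation by (auto dest!: bspec[of _ _ "\<lambda>x. f (g x)"])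
      ultimately show "\<bar>det (matrix (g \<circ> h))\<bar> * (\<integral>\<^sup>+x. f ((g \<circ> h) x) \<partial>lborel) = (\<integral>\<^sup>+x. f x \<partial>lborel)"
        using P(1) by (simp add: d abs_mult ennreal_mult mult.assoc)
    qed
  next
    fix g :: "real^'n \<Rightarrow> real^'n" and i assume lin: "linear g" and z: "\<And>x. g x $ i = 0"
    have "\<not> surj g" using z by (metis one_neq_zero surjE vec_component)
    then have "\<not> inj g" using lin linear_injective_imp_surjective by blast
    then show "?P g" using det_nz_iff_inj[OF lin] by blast
  next
    fix c :: "'n \<Rightarrow> real"
    let ?h = "\<lambda>x::real^'n. \<chi> i. c i * x $ i"
    have det: "det (matrix ?h) = (\<Prod>i\<in>UNIV. c i)"
      by (simp add: matrix_def det_diagonal axis_def)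
    show "?P ?h"
    proof (intro impI ballI)
      fix f :: "real^'n \<Rightarrow> ennreal" assume nz: "det (matrix ?h) \<noteq> 0" and [measurable]: "f \<in> borel_measurable borel"
      \<comment> \<open>On the basis vector \<open>axis i 1\<close> this equals \<open>c i\<close>;
        it re-indexes the diagonal entries by \<open>Basis\<close>, as the affine rule for
        \<open>lborel\<close> expects.\<close>
      define d where "d b = (\<Sum>i\<in>UNIV. c i * b $ i)" for b :: "real^'n"
      have dax: "d (axis i 1) = c i" for i
        by (simp add: d_def axis_def if_distrib cong: if_cong)
      have T: "0 + (\<Sum>j\<in>Basis. (d j * (x \<bullet> j)) *\<^sub>R j) = ?h x" for x
      proof -
        have "(\<Sum>j\<in>Basis. (d j * (x \<bullet> j)) *\<^sub>R j) = (\<Sum>i\<in>UNIV. (c i * x $ i) *\<^sub>R axis i 1)"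
          by (subst Basis_vec_def) (auto simp: sum.UNION_disjoint dax inner_axis axis_eq_axis intro!: sum.reindex_cong[where l="\<lambda>i. axis i 1"] injI)
        then show ?thesis
          by (simp add: vec_eq_iff axis_def if_distrib cong: if_cong)
      qed
      have [measurable]: "?h \<in> borel_measurable borel"
        by (auto intro!: borel_measurable_continuous_onI continuous_intros)
      have d0: "\<And>j. j \<in> Basis \<Longrightarrow> d j \<noteq> 0" using nz unfolding det by (auto simp: Basis_vec_def dax)
      have p: "(\<Prod>j\<in>Basis. \<bar>d j\<bar>) = \<bar>\<Prod>i\<in>UNIV. c i\<bar>"
        unfolding abs_prod by (auto simp: Basis_vec_def dax axis_eq_axis intro!: prod.reindex_cong[where l="\<lambda>i. axis i 1"] injI)
      have "(\<integral>\<^sup>+x. f x \<partial>lborel) = (\<integral>\<^sup>+x. f x \<partial>density (distr lborel borel ?h) (\<lambda>_. (\<Prod>j\<in>Basis. \<bar>d j\<bar>)))"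
        using lborel_affine_euclidean[of d 0, OF d0] unfolding T by simp
      also have "\<dots> = \<bar>det (matrix ?h)\<bar> * (\<integral>\<^sup>+x. f (?h x) \<partial>lborel)"
        by (simp add: nn_integral_density nn_integral_distr nn_integral_cmult det p)
      finally show "\<bar>det (matrix ?h)\<bar> * (\<integral>\<^sup>+x. f (?h x) \<partial>lborel) = (\<integral>\<^sup>+x. f x \<partial>lborel)" by simp
    qed
  next
    fix m n :: 'n assume mn: "m \<noteq> n"
    let ?t = "Transposition.transpose m n"
    let ?h = "\<lambda>x::real^'n. \<chi> i. x $ ?t i"
    have "matrix ?h = (\<chi> i. mat 1 $ ?t i)"
      by (auto simp: matrix_def mat_def axis_def vec_eq_iff)
    then have det: "\<bar>det (matrix ?h)\<bar> = 1"
      using det_permute_rows[OF permutes_swap_id[of m UNIV n], of "mat 1 :: real^'n^'n"]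
      by (simp add: sign_swap_id mn)
    have meas: "?h \<in> borel_measurable borel"
      by (auto intro!: borel_measurable_continuous_onI continuous_intros)
    \<comment> \<open>Boxes determine \<open>lborel\<close>, and a transposition maps boxes to boxes
      with permuted side lengths.\<close>
    have "lborel = distr lborel borel ?h"
    proof (rule lborel_eqI)
      fix l u :: "real^'n" assume lu: "\<And>b. b \<in> Basis \<Longrightarrow> l \<bullet> b \<le> u \<bullet> b"
      have "(l \<bullet> axis i 1) \<le> (u \<bullet> axis i 1)" for i by (rule lu) auto
      then have le: "l $ i \<le> u $ i" for i by (simp add: inner_axis)
      have pre: "?h -` box l u = box (?h l) (?h u)"
        by (auto simp: mem_box_cart) (metis transpose_involutory)+
      have P: "(\<Prod>b\<in>Basis. x \<bullet> b) = (\<Prod>i\<in>UNIV. x $ i)" for x :: "real^'n"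
        by (auto simp: Basis_vec_def inner_axis axis_eq_axis intro!: prod.reindex_cong[where l="\<lambda>i. axis i 1"] injI)
      have "emeasure (distr lborel borel ?h) (box l u) = emeasure lborel (box (?h l) (?h u))"
        using meas by (simp add: emeasure_distr pre)
      also have "\<dots> = (\<Prod>i\<in>UNIV. (?h u - ?h l) $ i)"
        by (subst emeasure_lborel_box) (use P[of "?h u - ?h l"] in \<open>auto simp: Basis_vec_def inner_axis le\<close>)
      also have "(\<Prod>i\<in>UNIV. (?h u - ?h l) $ i) = (\<Prod>i\<in>UNIV. (u - l) $ i)"
        using prod.permute[OF permutes_swap_id[of m UNIV n], of "\<lambda>i. (u - l) $ i"] by (simp add: o_def)
      finally show "emeasure (distr lborel borel ?h) (box l u) = (\<Prod>b\<in>Basis. (u - l) \<bullet> b)"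
        by (simp add: P)
    qed simp
    then have "(\<integral>\<^sup>+x. f (?h x) \<partial>lborel) = (\<integral>\<^sup>+x. f x \<partial>lborel)"
      if "f \<in> borel_measurable borel" for f :: "real^'n \<Rightarrow> ennreal"
      using nn_integral_distr[of ?h lborel borel f] meas that by simp
    then show "?P ?h" by (simp add: det)
  next
    fix m n :: 'n assume mn: "m \<noteq> n"
    let ?h = "\<lambda>x::real^'n. \<chi> i. if i = m then x $ m + x $ n else x $ i"
    have h: "?h x = x + (x \<bullet> axis n 1) *\<^sub>R axis m 1" for x
      unfolding inner_axis using mn by (auto simp: vec_eq_iff axis_def)
    have "matrix ?h = (\<chi> k. if k = m then row m (mat 1) + 1 *s row n (mat 1) else row k (mat 1))"
      by (auto simp: matrix_def mat_def row_def axis_def vec_eq_iff)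
    then have det: "det (matrix ?h) = 1"
      using det_row_operation[OF mn, of "mat 1 :: real^'n^'n" 1] by simp
    have "(\<integral>\<^sup>+x. f (?h x) \<partial>lborel) = (\<integral>\<^sup>+x. f x \<partial>lborel)"
      if [measurable]: "f \<in> borel_measurable borel" for f :: "real^'n \<Rightarrow> ennreal"
      unfolding h by (rule nn_integral_lborel_shear) (use mn in \<open>auto simp: axis_eq_axis\<close>)
    then show "?P ?h" by (simp add: det)
  qed
  with assms show ?thesis by simp
qed

section \<open>Characteristic functions and Gaussian laws on Euclidean space\<close>

definition vchar :: "'a::euclidean_space measure \<Rightarrow> 'a \<Rightarrow> complex" where
  "vchar \<mu> u = (\<integral>x. iexp (u \<bullet> x) \<partial>\<mu>)"

definition std_gauss :: "'a::euclidean_space measure" where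
  "std_gauss = density lborel (\<lambda>x. ennreal (\<Prod>b\<in>Basis. std_normal_density (x \<bullet> b)))"

lemma sets_std_gauss [simp, measurable_cong]: "sets std_gauss = sets borel"
  by (simp add: std_gauss_def)

lemma space_std_gauss [simp]: "space std_gauss = UNIV"
  by (simp add: std_gauss_def)

lemma std_gauss_density_eq:
  "(\<Prod>b\<in>Basis. std_normal_density (x \<bullet> b)) = exp (- (norm x)\<^sup>2 / 2) / sqrt ((2 * pi) ^ DIM('a))"
  for x :: "'a::euclidean_space"
proof -
  have "(\<Prod>b\<in>Basis. std_normal_density (x \<bullet> b))
      = (1 / sqrt (2 * pi)) ^ DIM('a) * exp (\<Sum>b\<in>Basis. - (x \<bullet> b)\<^sup>2 / 2)"
    by (simp add: std_normal_density_def prod.distrib exp_sum power_one_over prod_dividef)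
  moreover have "(\<Sum>b\<in>Basis. - (x \<bullet> b)\<^sup>2 / 2) = - (norm x)\<^sup>2 / 2"
    unfolding sum_divide_distrib[symmetric] sum_negf
    using euclidean_inner[of x x] by (simp add: dot_square_norm power2_eq_square)
  moreover have "sqrt ((2 * pi) ^ DIM('a)) = sqrt (2 * pi) ^ DIM('a)" by (rule real_sqrt_power)
  ultimately show ?thesis
    by (simp only: power_one_over) simp
qed

lemma prob_space_std_gauss: "prob_space (std_gauss :: 'a::euclidean_space measure)"
proof
  have "emeasure (std_gauss :: 'a measure) (space std_gauss) =
      (\<integral>\<^sup>+x. (\<Prod>b\<in>Basis. ennreal (std_normal_density (x \<bullet> b))) \<partial>(lborel :: 'a measure))"
    by (simp add: std_gauss_def emeasure_density prod_ennreal)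
  also have "\<dots> = (\<Prod>b\<in>(Basis::'a set). (\<integral>\<^sup>+x. ennreal (std_normal_density x) \<partial>lborel))"
    by (rule nn_integral_lborel_prod) auto
  also have "(\<integral>\<^sup>+x. ennreal (std_normal_density x) \<partial>lborel) = 1"
    using prob_space.emeasure_space_1[OF prob_space_normal_density[of 1 0]]
    by (simp add: emeasure_density)
  finally show "emeasure (std_gauss :: 'a measure) (space std_gauss) = 1" by simp
qed

text \<open>Density and exponential are both products over the coordinates, so Fubini reduces the
  integral to the one-dimensional characteristic function.\<close>

lemma vchar_std_gauss: "vchar (std_gauss :: 'a::euclidean_space measure) u = exp (- (norm u)\<^sup>2 / 2)"
proof -
  interpret product_sigma_finite "\<lambda>i::'a. lborel :: real measure" ..
  let ?g = "\<lambda>b y. std_normal_density y *\<^sub>R iexp ((u \<bullet> b) * y)"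
  have 1: "integrable lborel (?g b)" and 2: "(\<integral>y. ?g b y \<partial>lborel) = exp (- (u \<bullet> b)\<^sup>2 / 2)" for b
  proof -
    have "integrable lborel std_normal_density" by (rule integrable_normal_density) simp
    then show "integrable lborel (?g b)"
      by (rule Bochner_Integration.integrable_bound) (auto simp: normal_density_nonneg)
    have "(\<integral>y. ?g b y \<partial>lborel) = char std_normal_distribution (u \<bullet> b)"
      unfolding char_def by (subst integral_density) (auto simp: normal_density_nonneg)
    then show "(\<integral>y. ?g b y \<partial>lborel) = exp (- (u \<bullet> b)\<^sup>2 / 2)"
      by (simp add: char_std_normal_distribution)
  qed
  have eq: "(\<Prod>b\<in>Basis. std_normal_density (x \<bullet> b)) *\<^sub>R iexp (u \<bullet> x) = (\<Prod>b\<in>Basis. ?g b (x \<bullet> b))" for x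
  proof -
    have "u \<bullet> x = (\<Sum>b\<in>Basis. (u \<bullet> b) * (x \<bullet> b))" by (rule euclidean_inner)
    then have "iexp (u \<bullet> x) = (\<Prod>b\<in>Basis. iexp ((u \<bullet> b) * (x \<bullet> b)))"
      by (simp add: exp_sum[symmetric] sum_distrib_left)
    then show ?thesis
      by (simp add: scaleR_conv_of_real prod.distrib)
  qed
  have "vchar (std_gauss :: 'a measure) u = (\<integral>x. (\<Prod>b\<in>Basis. ?g b (x \<bullet> b)) \<partial>lborel)"
    unfolding vchar_def std_gauss_def eq[symmetric]
    by (subst integral_density) (auto intro!: prod_nonneg simp: normal_density_nonneg)
  also have "\<dots> = (\<integral>f. (\<Prod>b\<in>Basis. ?g b ((\<Sum>b\<in>Basis. f b *\<^sub>R b) \<bullet> b)) \<partial>(\<Pi>\<^sub>M b\<in>Basis. lborel))"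
    by (subst lborel_eq, rule integral_distr) measurable
  also have "\<dots> = (\<integral>f. (\<Prod>b\<in>Basis. ?g b (f b)) \<partial>(\<Pi>\<^sub>M b\<in>Basis. lborel))"
    by (intro Bochner_Integration.integral_cong refl prod.cong)
       (auto simp: inner_sum_left inner_Basis if_distrib cong: if_cong)
  also have "\<dots> = (\<Prod>b\<in>Basis. (\<integral>y. ?g b y \<partial>lborel))"
    by (rule product_integral_prod) (use 1 in auto)
  also have "\<dots> = (\<Prod>b\<in>Basis. of_real (exp (- (u \<bullet> b)\<^sup>2 / 2)))"
    by (simp only: 2)
  also have "\<dots> = of_real (exp (\<Sum>b\<in>Basis. - (u \<bullet> b)\<^sup>2 / 2))"
    by (simp add: exp_sum)
  also have "(\<Sum>b\<in>Basis. - (u \<bullet> b)\<^sup>2 / 2) = - (norm u)\<^sup>2 / 2"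
    unfolding sum_divide_distrib[symmetric] sum_negf
    using euclidean_inner[of u u] by (simp add: dot_square_norm power2_eq_square)
  finally show ?thesis .
qed

section \<open>Uniqueness of characteristic functions in several dimensions\<close>

lemma (in prob_space) integrable_bounded:
  fixes f :: "'a \<Rightarrow> 'b::{banach, second_countable_topology}"
  assumes "f \<in> borel_measurable M" "\<And>x. norm (f x) \<le> B"
  shows "integrable M f"
  using assms by (intro integrable_const_bound[where B=B]) auto

text \<open>The indicator of a closed set is the limit of the functions max 0 (1 - n dist), and
  closed sets form an intersection-stable generator. The empty set is treated apart because
  \<open>infdist\<close> to it is 0.\<close>

lemma measure_eqI_continuous_bounded:
  fixes \<mu> \<nu> :: "'a::metric_space measure"
  assumes "prob_space \<mu>" "prob_space \<nu>" and s: "sets \<mu> = sets borel" "sets \<nu> = sets borel"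
    and eq: "\<And>f::'a \<Rightarrow> real. continuous_on UNIV f \<Longrightarrow> (\<And>x. \<bar>f x\<bar> \<le> 1) \<Longrightarrow> integral\<^sup>L \<mu> f = integral\<^sup>L \<nu> f"
  shows "\<mu> = \<nu>"
proof -
  interpret M: prob_space \<mu> by fact
  interpret N: prob_space \<nu> by fact
  have closed: "measure \<mu> A = measure \<nu> A" if A: "closed A" for A
  proof (cases "A = {}")
    case False
    define f where "f n x = max 0 (1 - real n * infdist x A)" for n x
    have b: "\<bar>f n x\<bar> \<le> 1" for n x by (auto simp: f_def infdist_nonneg)
    have c: "continuous_on UNIV (f n)" for n
      unfolding f_def by (intro continuous_intros)
    have l: "(\<lambda>n. f n x) \<longlonglongrightarrow> indicat_real A x" for x
    proof (cases "x \<in> A")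
      case True then show ?thesis by (simp add: f_def)
    next
      case n: False
      then have p: "infdist x A > 0" using A False
        by (metis in_closed_iff_infdist_zero infdist_nonneg less_eq_real_def)
      have "\<forall>\<^sub>F n in sequentially. f n x = 0"
      proof -
        obtain N where N: "real N > 1 / infdist x A" using reals_Archimedean2 by blast
        show ?thesis
          using eventually_ge_at_top[of N]
        proof eventually_elim
          case (elim n)
          then have "real n > 1 / infdist x A" using N by linarith
          then show ?case using p by (simp add: f_def field_simps)
        qed
      qed
      then show ?thesis using n by (simp add: tendsto_eventually)
    qed
    have m: "f n \<in> borel_measurable borel" for n
      using c by (rule borel_measurable_continuous_onI)
    have Am: "A \<in> sets borel" using A by (rule borel_closed)
    have "(\<lambda>n. integral\<^sup>L \<mu> (f n)) \<longlonglongrightarrow> integral\<^sup>L \<mu> (indicat_real A)"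
      by (rule integral_dominated_convergence[where w="\<lambda>_. 1"])
         (use b l m Am s in \<open>auto cong: measurable_cong_sets\<close>)
    moreover have "(\<lambda>n. integral\<^sup>L \<nu> (f n)) \<longlonglongrightarrow> integral\<^sup>L \<nu> (indicat_real A)"
      by (rule integral_dominated_convergence[where w="\<lambda>_. 1"])
         (use b l m Am s in \<open>auto cong: measurable_cong_sets\<close>)
    ultimately have "integral\<^sup>L \<mu> (indicat_real A) = integral\<^sup>L \<nu> (indicat_real A)"
      using LIMSEQ_unique eq[OF c b] by simp
    then show ?thesis using Am s by simp
  qed simp
  show ?thesis
  proof (rule measure_eqI_generator_eq[where E="Collect closed" and A="\<lambda>_. UNIV" and \<Omega>=UNIV])
    show "Int_stable (Collect closed :: 'a set set)" by (auto simp: Int_stable_def)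
    show "sets \<mu> = sigma_sets UNIV (Collect closed)" "sets \<nu> = sigma_sets UNIV (Collect closed)"
      unfolding s by (simp_all add: borel_eq_closed)
    show "emeasure \<mu> X = emeasure \<nu> X" if "X \<in> Collect closed" for X
      using closed that by (simp add: M.emeasure_eq_measure N.emeasure_eq_measure)
  qed auto
qed

text \<open>Gaussian smoothing: after adding noise of scale \<sigma>, the mean of \<open>f\<close>
  depends on the law only through its characteristic function, by \<open>conv\<close> and
  \<open>smooth\<close>; \<sigma> -> 0 then recovers the mean of \<open>f\<close>.\<close>

lemma vchar_unique:
  fixes \<mu> \<nu> :: "'a::euclidean_space measure"
  assumes P: "prob_space \<mu>" "prob_space \<nu>" and s[measurable_cong]: "sets \<mu> = sets borel" "sets \<nu> = sets borel"
    and eq: "\<And>u. vchar \<mu> u = vchar \<nu> u"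
  shows "\<mu> = \<nu>"
proof (rule measure_eqI_continuous_bounded[OF P s])
  fix f :: "'a \<Rightarrow> real" assume cf: "continuous_on UNIV f" and bf: "\<And>x. \<bar>f x\<bar> \<le> 1"
  have [measurable]: "f \<in> borel_measurable borel" using cf by (rule borel_measurable_continuous_onI)
  interpret G: prob_space "std_gauss :: 'a measure" by (rule prob_space_std_gauss)
  define \<phi> where "\<phi> x = (\<Prod>b\<in>Basis. std_normal_density (x \<bullet> b))" for x :: 'a
  have [measurable]: "\<phi> \<in> borel_measurable borel" unfolding \<phi>_def by measurable
  have \<phi>0: "\<phi> x \<ge> 0" for x by (auto simp: \<phi>_def intro!: prod_nonneg normal_density_nonneg)
  define Z where "Z = sqrt ((2 * pi) ^ DIM('a))"
  have \<phi>e: "\<phi> x = exp (- (norm x)\<^sup>2 / 2) / Z" for x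
    unfolding \<phi>_def Z_def by (rule std_gauss_density_eq)
  have \<phi>int: "integrable lborel \<phi>" "(\<integral>x. \<phi> x \<partial>lborel) = 1"
  proof -
    have e: "(\<integral>\<^sup>+x. ennreal (\<phi> x) \<partial>lborel) = 1"
      using G.emeasure_space_1 by (simp add: std_gauss_def \<phi>_def emeasure_density)
    show "integrable lborel \<phi>" by (rule integrableI_nn_integral_finite[of _ _ 1]) (use e \<phi>0 in auto)
    show "(\<integral>x. \<phi> x \<partial>lborel) = 1" using e \<phi>0 by (subst integral_eq_nn_integral) auto
  qed
  \<comment> \<open>The Gaussian density is its own characteristic function, so averaging it over a law only
    involves the characteristic function of that law.\<close>
  have smooth: "(\<integral>y. \<phi> ((x - y) /\<^sub>R \<sigma>) \<partial>m) = Re (\<integral>n. iexp (n \<bullet> x / \<sigma>) * vchar m (- n /\<^sub>R \<sigma>) \<partial>std_gauss) / Z"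
    if m: "prob_space m" and sm[measurable_cong]: "sets m = sets borel" for x \<sigma> and m :: "'a measure"
  proof -
    interpret m: prob_space m by fact
    interpret pair_prob_space "std_gauss :: 'a measure" m ..
    let ?e = "\<lambda>n y. iexp (n \<bullet> x / \<sigma>) * iexp ((- n /\<^sub>R \<sigma>) \<bullet> y)"
    have "of_real (\<phi> ((x - y) /\<^sub>R \<sigma>)) = (\<integral>n. ?e n y \<partial>std_gauss) / Z" for y
    proof -
      have "of_real (\<phi> ((x - y) /\<^sub>R \<sigma>)) = vchar std_gauss ((x - y) /\<^sub>R \<sigma>) / Z"
        by (simp add: \<phi>e vchar_std_gauss)
      also have "vchar std_gauss ((x - y) /\<^sub>R \<sigma>) = (\<integral>n. ?e n y \<partial>std_gauss)"
        unfolding vchar_def exp_add[symmetric]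
        by (intro Bochner_Integration.integral_cong refl arg_cong[of _ _ exp])
           (simp add: inner_diff_right inner_commute algebra_simps divide_inverse)
      finally show ?thesis .
    qed
    then have "complex_of_real (\<integral>y. \<phi> ((x - y) /\<^sub>R \<sigma>) \<partial>m) =
        (\<integral>y. (\<integral>n. ?e n y \<partial>std_gauss) / Z \<partial>m)"
      by (simp flip: integral_complex_of_real)
    also have "\<dots> = (\<integral>y. (\<integral>n. ?e n y \<partial>std_gauss) \<partial>m) / Z"
      by simp
    also have "(\<integral>y. (\<integral>n. ?e n y \<partial>std_gauss) \<partial>m) =
        (\<integral>n. (\<integral>y. ?e n y \<partial>m) \<partial>std_gauss)"
      proof (rule Fubini_integral, rule integrable_bounded[where B=1])
      fix p :: "'a \<times> 'a"
      have "norm (iexp (fst p \<bullet> x / \<sigma>) * iexp ((- fst p /\<^sub>R \<sigma>) \<bullet> snd p)) \<le> 1"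
        unfolding norm_mult norm_exp_i_times by simp
      then show "norm (case p of (n, y) \<Rightarrow> ?e n y) \<le> 1"
        by (simp only: case_prod_beta)
    qed measurable
    also have "\<dots> = (\<integral>n. iexp (n \<bullet> x / \<sigma>) * vchar m (- n /\<^sub>R \<sigma>) \<partial>std_gauss)"
      unfolding vchar_def by simp
    finally show ?thesis by (simp add: complex_eq_iff)
  qed
  \<comment> \<open>The substitution x = y + \<sigma> z moves the noise from the argument of
    \<open>f\<close> into the Gaussian density; Fubini then isolates the averaged density that
    \<open>smooth\<close> evaluates.\<close>
  have conv: "(\<integral>y. (\<integral>z. f (y + \<sigma> *\<^sub>R z) \<partial>std_gauss) \<partial>m) =
      (1 / \<sigma> ^ DIM('a)) * (\<integral>x. f x * (\<integral>y. \<phi> ((x - y) /\<^sub>R \<sigma>) \<partial>m) \<partial>lborel)"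
    if \<sigma>: "\<sigma> > 0" and m: "prob_space m" and sm[measurable_cong]: "sets m = sets borel" for \<sigma> and m :: "'a measure"
  proof -
    interpret m: prob_space m by fact
    interpret pair_sigma_finite "lborel :: 'a measure" m ..
    let ?\<phi> = "\<lambda>x y. \<phi> ((x - y) /\<^sub>R \<sigma>)"
    have scale: "lborel = density (distr lborel borel (\<lambda>x. y + \<sigma> *\<^sub>R x)) (\<lambda>_. ennreal (\<sigma> ^ DIM('a)))" for y :: 'a
      using lborel_affine[of \<sigma> y] \<sigma> by (simp add: density_cong)
    have sub: "(\<integral>x. g x \<partial>lborel) = \<sigma> ^ DIM('a) * (\<integral>z. g (y + \<sigma> *\<^sub>R z) \<partial>lborel)"
      if [measurable]: "g \<in> borel_measurable borel" for y and g :: "'a \<Rightarrow> real"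
      using \<sigma> by (subst scale[of y], subst integral_density) (auto simp: integral_distr)
    have subn: "(\<integral>\<^sup>+x. g x \<partial>lborel) = ennreal (\<sigma> ^ DIM('a)) * (\<integral>\<^sup>+z. g (y + \<sigma> *\<^sub>R z) \<partial>lborel)"
      if [measurable]: "g \<in> borel_measurable borel" for y and g :: "'a \<Rightarrow> ennreal"
      using \<sigma> by (subst scale[of y], subst nn_integral_density) (auto simp: nn_integral_distr nn_integral_cmult)
    have inn: "(\<integral>z. f (y + \<sigma> *\<^sub>R z) \<partial>std_gauss) = (1 / \<sigma> ^ DIM('a)) * (\<integral>x. f x * ?\<phi> x y \<partial>lborel)" for y
    proof -
      have "(\<integral>z. f (y + \<sigma> *\<^sub>R z) \<partial>std_gauss) = (\<integral>z. \<phi> z * f (y + \<sigma> *\<^sub>R z) \<partial>lborel)"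
        unfolding std_gauss_def \<phi>_def[symmetric] by (subst integral_density) (use \<phi>0 in auto)
      moreover have "(\<integral>x. f x * ?\<phi> x y \<partial>lborel) =
          \<sigma> ^ DIM('a) * (\<integral>z. f (y + \<sigma> *\<^sub>R z) * \<phi> ((y + \<sigma> *\<^sub>R z - y) /\<^sub>R \<sigma>) \<partial>lborel)"
        by (rule sub) measurable
      ultimately show ?thesis using \<sigma> by (simp add: mult.commute)
    qed
    have "(\<integral>y. (\<integral>z. f (y + \<sigma> *\<^sub>R z) \<partial>std_gauss) \<partial>m) =
        (1 / \<sigma> ^ DIM('a)) * (\<integral>y. (\<integral>x. f x * ?\<phi> x y \<partial>lborel) \<partial>m)"
      unfolding inn by simp
    also have "(\<integral>y. (\<integral>x. f x * ?\<phi> x y \<partial>lborel) \<partial>m) =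
        (\<integral>x. (\<integral>y. f x * ?\<phi> x y \<partial>m) \<partial>lborel)"
    proof (rule Fubini_integral)
      show "integrable (lborel \<Otimes>\<^sub>M m) (\<lambda>(x, y). f x * ?\<phi> x y)"
      proof (rule integrableI_bounded)
        have "(\<integral>\<^sup>+p. ennreal (norm (case p of (x, y) \<Rightarrow> f x * ?\<phi> x y)) \<partial>(lborel \<Otimes>\<^sub>M m)) \<le>
            (\<integral>\<^sup>+p. ennreal (case p of (x, y) \<Rightarrow> ?\<phi> x y) \<partial>(lborel \<Otimes>\<^sub>M m))"
          using \<phi>0 bf by (intro nn_integral_mono) (auto simp: abs_mult intro!: ennreal_leI mult_left_le_one_le)
        also have "\<dots> = (\<integral>\<^sup>+y. \<integral>\<^sup>+x. ennreal (?\<phi> x y) \<partial>lborel \<partial>m)"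
          by (subst nn_integral_snd[symmetric]) auto
        also have "\<dots> = (\<integral>\<^sup>+y. ennreal (\<sigma> ^ DIM('a)) \<partial>m)"
        proof (rule nn_integral_cong)
          fix y
          have "(\<integral>\<^sup>+x. ennreal (?\<phi> x y) \<partial>lborel) =
            ennreal (\<sigma> ^ DIM('a)) * (\<integral>\<^sup>+z. ennreal (\<phi> ((y + \<sigma> *\<^sub>R z - y) /\<^sub>R \<sigma>)) \<partial>lborel)"
            by (rule subn) measurable
          also have "(\<integral>\<^sup>+z. ennreal (\<phi> ((y + \<sigma> *\<^sub>R z - y) /\<^sub>R \<sigma>)) \<partial>lborel) = 1"
            using \<sigma> G.emeasure_space_1 by (simp add: std_gauss_def \<phi>_def emeasure_density)
          finally show "(\<integral>\<^sup>+x. ennreal (?\<phi> x y) \<partial>lborel) = ennreal (\<sigma> ^ DIM('a))" by simp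
        qed
        also have "\<dots> < \<infinity>" by (simp add: m.emeasure_space_1)
        finally show "(\<integral>\<^sup>+p. ennreal (norm (case p of (x, y) \<Rightarrow> f x * ?\<phi> x y)) \<partial>(lborel \<Otimes>\<^sub>M m)) < \<infinity>" .
      qed measurable
    qed
    finally show ?thesis by simp
  qed
  have same: "(\<integral>y. (\<integral>z. f (y + \<sigma> *\<^sub>R z) \<partial>std_gauss) \<partial>\<mu>) = (\<integral>y. (\<integral>z. f (y + \<sigma> *\<^sub>R z) \<partial>std_gauss) \<partial>\<nu>)"
    if "\<sigma> > 0" for \<sigma>
    using that P s by (simp add: conv smooth eq)
  have lim: "(\<lambda>n. \<integral>y. (\<integral>z. f (y + inverse (real (Suc n)) *\<^sub>R z) \<partial>std_gauss) \<partial>m) \<longlonglongrightarrow> integral\<^sup>L m f"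
    if m: "prob_space m" and sm[measurable_cong]: "sets m = sets borel" for m :: "'a measure"
  proof -
    interpret m: prob_space m by fact
    have bd: "norm (\<integral>z. f (y + \<sigma> *\<^sub>R z) \<partial>std_gauss) \<le> 1" for y \<sigma>
    proof -
      have "norm (\<integral>z. f (y + \<sigma> *\<^sub>R z) \<partial>std_gauss) \<le> (\<integral>z. \<bar>f (y + \<sigma> *\<^sub>R z)\<bar> \<partial>std_gauss)"
        using integral_norm_bound[of std_gauss "\<lambda>z. f (y + \<sigma> *\<^sub>R z)"] by simp
      also have "\<dots> \<le> (\<integral>z. 1 \<partial>(std_gauss :: 'a measure))"
        using bf by (intro integral_mono G.integrable_bounded[where B=1]) auto
      finally show ?thesis using G.prob_space by simp
    qed
    have "(\<lambda>n. \<integral>z. f (y + inverse (real (Suc n)) *\<^sub>R z) \<partial>std_gauss) \<longlonglongrightarrow> (\<integral>z. f y \<partial>(std_gauss :: 'a measure))" for y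
    proof (rule integral_dominated_convergence[where w="\<lambda>_. 1"])
      show "AE z in std_gauss. (\<lambda>n. f (y + inverse (real (Suc n)) *\<^sub>R z)) \<longlonglongrightarrow> f y"
      proof (rule AE_I2)
        fix z :: 'a
        have "(\<lambda>n. y + inverse (real (Suc n)) *\<^sub>R z) \<longlonglongrightarrow> y + 0 *\<^sub>R z"
          by (intro tendsto_intros LIMSEQ_inverse_real_of_nat)
        then show "(\<lambda>n. f (y + inverse (real (Suc n)) *\<^sub>R z)) \<longlonglongrightarrow> f y"
          using cf by (intro isCont_tendsto_compose[of _ f]) (auto simp: continuous_on_eq_continuous_at)
      qed
    qed (use bf in auto)
    then show ?thesis
      using G.prob_space
      by (intro integral_dominated_convergence[where w="\<lambda>_. 1"]) (use bd in auto)
  qed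
  show "integral\<^sup>L \<mu> f = integral\<^sup>L \<nu> f"
    by (rule LIMSEQ_unique[OF lim[OF P(1) s(1)]])
       (use lim[OF P(2) s(2)] same in simp)
qed

lemma vchar_convolution:
  fixes \<mu> \<nu> :: "'a::ordered_euclidean_space measure"
  assumes P: "prob_space \<mu>" "prob_space \<nu>" and s[measurable_cong]: "sets \<mu> = sets borel" "sets \<nu> = sets borel"
  shows "vchar (\<mu> \<star> \<nu>) u = vchar \<mu> u * vchar \<nu> u"
proof -
  interpret M: prob_space \<mu> by fact
  interpret N: prob_space \<nu> by fact
  interpret pair_prob_space \<mu> \<nu> ..
  have "vchar (\<mu> \<star> \<nu>) u = (\<integral>p. iexp (u \<bullet> fst p) * iexp (u \<bullet> snd p) \<partial>(\<mu> \<Otimes>\<^sub>M \<nu>))"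
    unfolding vchar_def convolution_def
    by (subst integral_distr) (auto simp: case_prod_beta inner_add_right exp_add distrib_left)
  also have "\<dots> = (\<integral>x. (\<integral>y. iexp (u \<bullet> x) * iexp (u \<bullet> y) \<partial>\<nu>) \<partial>\<mu>)"
    by (subst integral_fst'[symmetric], rule integrable_bounded[where B=1]) (auto simp: norm_mult)
  also have "\<dots> = vchar \<mu> u * vchar \<nu> u"
    unfolding vchar_def by simp
  finally show ?thesis .
qed

lemma prob_space_convolution:
  fixes \<mu> \<nu> :: "'a::ordered_euclidean_space measure"
  assumes P: "prob_space \<mu>" "prob_space \<nu>" and s[measurable_cong]: "sets \<mu> = sets borel" "sets \<nu> = sets borel"
  shows "prob_space (\<mu> \<star> \<nu>)"
proof -
  interpret M: prob_space \<mu> by fact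
  interpret N: prob_space \<nu> by fact
  interpret pair_prob_space \<mu> \<nu> ..
  show ?thesis unfolding convolution_def by (rule prob_space_distr) measurable
qed

section \<open>Positive definite matrices and the multivariate normal law\<close>

lemma symmetric_matrix_inner:
  fixes S :: "real^'n^'n"
  assumes "transpose S = S"
  shows "(S *v x) \<bullet> y = x \<bullet> (S *v y)"
  by (metis assms dot_lmul_matrix transpose_matrix_vector)

lemma positive_definite_invertible:
  fixes S :: "real^'n^'n"
  assumes "positive_definite S"
  shows "invertible S"
proof -
  have "x = 0" if "S *v x = 0" for x
    using assms that by (metis inner_zero_right less_irrefl positive_definite_def)
  then show ?thesis
    using matrix_left_invertible_ker[of S] invertible_left_inverse[of S] by blast
qed

lemma matrix_inv_cancel:
  fixes S :: "real^'n^'n"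
  assumes "invertible S"
  shows "matrix_inv S ** S = mat 1" "S ** matrix_inv S = mat 1"
proof -
  from assms have "\<exists>B. S ** B = mat 1 \<and> B ** S = mat 1" by (simp add: invertible_def)
  from someI_ex[OF this] show "matrix_inv S ** S = mat 1" "S ** matrix_inv S = mat 1"
    by (auto simp: matrix_inv_def)
qed

lemma matrix_inv_unique:
  fixes S :: "real^'n^'n"
  assumes "S ** B = mat 1"
  shows "matrix_inv S = B"
proof -
  have "invertible S" using assms invertible_right_inverse by blast
  then have "matrix_inv S ** (S ** B) = B"
    by (simp add: matrix_mul_assoc matrix_inv_cancel)
  then show ?thesis using assms by simp
qed

lemma positive_definite_matrix_inv:
  fixes S :: "real^'n^'n"
  assumes S: "positive_definite S"
  shows "positive_definite (matrix_inv S)" "matrix_inv (matrix_inv S) = S"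
proof -
  note inv = matrix_inv_cancel[OF positive_definite_invertible[OF S]]
  show "matrix_inv (matrix_inv S) = S" by (rule matrix_inv_unique) (rule inv)
  have "S ** transpose (matrix_inv S) = transpose (matrix_inv S ** S)"
    using S by (simp add: matrix_transpose_mul positive_definite_def)
  then have sym: "transpose (matrix_inv S) = matrix_inv S"
    using matrix_inv_unique[of S "transpose (matrix_inv S)"] inv by (simp add: transpose_mat)
  moreover have "x \<bullet> (matrix_inv S *v x) > 0" if "x \<noteq> 0" for x
  proof -
    let ?y = "matrix_inv S *v x"
    have x: "x = S *v ?y" by (simp add: matrix_vector_mul_assoc inv)
    then have "?y \<noteq> 0" using that by (metis matrix_vector_mult_0_right)
    then have "?y \<bullet> (S *v ?y) > 0" using S by (simp add: positive_definite_def)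
    then show ?thesis using x by (simp add: inner_commute)
  qed
  ultimately show "positive_definite (matrix_inv S)" by (simp add: positive_definite_def)
qed

text \<open>Gram--Schmidt for the inner product given by \<open>S\<close>; the columns of \<open>P\<close> are the basis.\<close>

lemma positive_definite_orthonormal:
  fixes S :: "real^'n^'n"
  assumes S: "positive_definite S"
  shows "\<exists>P :: real^'n^'n. transpose P ** S ** P = mat 1"
proof -
  have sym: "transpose S = S" and pos: "\<And>x. x \<noteq> 0 \<Longrightarrow> x \<bullet> (S *v x) > 0"
    using S by (auto simp: positive_definite_def)
  have "\<exists>b :: 'n \<Rightarrow> real^'n. \<forall>i\<in>I. \<forall>j\<in>I. b i \<bullet> (S *v b j) = (if i = j then 1 else 0)" for I :: "'n set"
    using finite[of I]
  proof (induction I rule: finite_induct)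
    case empty then show ?case by simp
  next
    case (insert k I)
    then obtain b :: "'n \<Rightarrow> real^'n"
      where b: "\<And>i j. i \<in> I \<Longrightarrow> j \<in> I \<Longrightarrow> b i \<bullet> (S *v b j) = (if i = j then 1 else 0)" by blast
    let ?V = "(\<lambda>i. S *v b i) ` I"
    have "dim ?V \<le> card I"
      using dim_le_card'[of ?V] card_image_le[of I "\<lambda>i. S *v b i"] by simp
    also have "\<dots> < DIM(real^'n)"
      using insert by (simp, intro psubset_card_mono) auto
    finally obtain x where x: "x \<noteq> 0" "\<And>i. i \<in> I \<Longrightarrow> x \<bullet> (S *v b i) = 0"
      using lowdim_subset_hyperplane[of ?V] span_base[of _ ?V] by (smt (verit) imageI mem_Collect_eq subset_iff)
    define y where "y = x /\<^sub>R sqrt (x \<bullet> (S *v x))"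
    have yy: "y \<bullet> (S *v y) = 1"
      using pos[OF x(1)] real_sqrt_mult_self[of "x \<bullet> (S *v x)"]
      by (simp add: y_def matrix_vector_mult_scaleR field_simps)
    have yi: "y \<bullet> (S *v b i) = 0" "b i \<bullet> (S *v y) = 0" if "i \<in> I" for i
      using x(2)[OF that] symmetric_matrix_inner[OF sym, of "b i" y] by (auto simp: y_def inner_commute)
    show ?case
      using insert(1,2) b yy yi by (intro exI[of _ "b(k := y)"]) auto
  qed
  then obtain b :: "'n \<Rightarrow> real^'n" where b: "\<And>i j. b i \<bullet> (S *v b j) = (if i = j then 1 else 0)"
    by (metis UNIV_I)
  let ?P = "\<chi> i j. b j $ i"
  have col: "column j ?P = b j" for j by (simp add: column_def vec_eq_iff)
  have "(transpose ?P ** S ** ?P) $ i $ j = (mat 1 :: real^'n^'n) $ i $ j" for i j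
  proof -
    have "(transpose ?P ** (S ** ?P)) $ i $ j = row i (transpose ?P) \<bullet> column j (S ** ?P)"
      by (simp add: matrix_matrix_mult_def inner_vec_def row_def column_def)
    also have "column j (S ** ?P) = S *v b j"
      by (simp add: column_def matrix_matrix_mult_def matrix_vector_mult_def vec_eq_iff)
    also have "row i (transpose ?P) = b i" by (simp add: row_transpose col)
    finally show ?thesis by (simp add: b mat_def matrix_mul_assoc)
  qed
  then show ?thesis by (intro exI[of _ ?P]) (simp add: vec_eq_iff)
qed

text \<open>If P^T S P = 1, then the inverse transpose \<open>Q\<close> of P satisfies S = Q Q^T,
  while the inverse of S is P P^T; the substitution x = Q y thus turns the exponent of the normal
  density into the standard one.\<close>

lemma positive_definite_factor:
  fixes S :: "real^'n^'n"
  assumes S: "positive_definite S"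
  obtains Q where "S = Q ** transpose Q" "det Q \<noteq> 0" "(det Q)\<^sup>2 = det S"
    "\<And>y. (Q *v y) \<bullet> (matrix_inv S *v (Q *v y)) = y \<bullet> y"
proof -
  obtain P :: "real^'n^'n" where P: "transpose P ** S ** P = mat 1"
    using positive_definite_orthonormal[OF S] by blast
  have "det (transpose P ** S ** P) = 1" unfolding P by simp
  then have d: "det P * det S * det P = 1" by (simp add: det_mul det_transpose)
  then have dP: "det P \<noteq> 0" by auto
  define Q where "Q = transpose (matrix_inv P)"
  have invP: "matrix_inv P ** P = mat 1" "P ** matrix_inv P = mat 1"
    using matrix_inv_cancel[of P] dP invertible_det_nz by blast+
  have tq: "transpose Q = matrix_inv P" by (simp add: Q_def)
  have QP: "Q ** transpose P = mat 1"
    using arg_cong[OF invP(2), of transpose] by (simp add: Q_def matrix_transpose_mul transpose_mat)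
  have SQ: "S = Q ** transpose Q"
  proof -
    have "Q ** (transpose P ** S ** P) ** transpose Q = (Q ** transpose P) ** S ** (P ** matrix_inv P)"
      by (simp add: tq matrix_mul_assoc)
    then show ?thesis by (simp add: P QP invP)
  qed
  have dS: "(det Q)\<^sup>2 = det S"
    by (simp add: SQ det_mul det_transpose power2_eq_square)
  have "matrix_inv S = P ** transpose P"
  proof (rule matrix_inv_unique)
    have "S ** (P ** transpose P) = Q ** (transpose Q ** P) ** transpose P" by (simp add: SQ matrix_mul_assoc)
    then show "S ** (P ** transpose P) = mat 1" by (simp add: tq invP QP)
  qed
  moreover have "transpose P ** Q = mat 1"
    using arg_cong[OF invP(1), of transpose] by (simp add: Q_def matrix_transpose_mul transpose_mat)
  ultimately have "(Q *v y) \<bullet> (matrix_inv S *v (Q *v y)) = y \<bullet> y" for y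
  proof -
    assume 1: "matrix_inv S = P ** transpose P" and 2: "transpose P ** Q = mat 1"
    have "matrix_inv S *v (Q *v y) = P *v ((transpose P ** Q) *v y)"
      by (simp add: 1 matrix_vector_mul_assoc matrix_mul_assoc)
    also have "\<dots> = P *v y" by (simp add: 2)
    finally have "(Q *v y) \<bullet> (matrix_inv S *v (Q *v y)) = y \<bullet> ((transpose Q ** P) *v y)"
      by (simp add: dot_lmul_matrix[symmetric] matrix_vector_mul_assoc[symmetric] transpose_matrix_vector)
         (metis dot_lmul_matrix inner_commute transpose_matrix_vector)
    then show ?thesis by (simp add: tq invP)
  qed
  moreover have "det Q \<noteq> 0" using dS d by auto
  ultimately show thesis using that SQ dS by blast
qed

text \<open>At the point Q y the normal density times the Jacobian \<bar>det Q\<bar> is the standard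
  density at y. As a linear image of \<open>std_gauss\<close> the law has total mass 1 and an
  explicit characteristic function.\<close>

lemma mv_normal_eq_distr:
  fixes S Q :: "real^'n^'n"
  assumes Q: "det Q \<noteq> 0" "(det Q)\<^sup>2 = det S"
    "\<And>y. (Q *v y) \<bullet> (matrix_inv S *v (Q *v y)) = y \<bullet> y"
  shows "mv_normal 0 S = distr std_gauss borel ((*v) Q)"
proof (rule measure_eqI)
  show "sets (mv_normal 0 S) = sets (distr std_gauss borel ((*v) Q))"
    by (simp add: mv_normal_def)
  have [measurable]: "(*v) Q \<in> borel_measurable borel"
    by (intro borel_measurable_continuous_onI matrix_vector_mult_linear_continuous_on)
  have [measurable]: "(*v) (matrix_inv S) \<in> borel_measurable borel"
    by (intro borel_measurable_continuous_onI matrix_vector_mult_linear_continuous_on)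
  fix A assume "A \<in> sets (mv_normal 0 S)"
  then have [measurable]: "A \<in> sets borel" by (simp add: mv_normal_def)
  define g where "g x = ennreal (exp (- ((x - 0) \<bullet> (matrix_inv S *v (x - 0))) / 2) / sqrt ((2 * pi) ^ CARD('n) * det S))" for x
  have [measurable]: "g \<in> borel_measurable borel" unfolding g_def by measurable
  have mv: "mv_normal 0 S = density lborel g" unfolding mv_normal_def g_def ..
  have g: "ennreal \<bar>det Q\<bar> * g (Q *v y) = ennreal (\<Prod>b\<in>Basis. std_normal_density (y \<bullet> b))" for y
  proof -
    have "sqrt (det S) = \<bar>det Q\<bar>" using Q(2) by (metis real_sqrt_abs)
    then show ?thesis
      using Q(1) unfolding g_def std_gauss_density_eq
      by (subst ennreal_mult[symmetric]) (auto simp: Q(3) real_sqrt_mult power2_norm_eq_inner)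
  qed
  have "emeasure (mv_normal 0 S) A = (\<integral>\<^sup>+x. g x * indicator A x \<partial>lborel)"
    unfolding mv by (simp add: emeasure_density)
  also have "\<dots> = \<bar>det (matrix ((*v) Q))\<bar> * (\<integral>\<^sup>+y. g (Q *v y) * indicator A (Q *v y) \<partial>lborel)"
    by (rule nn_integral_lborel_linear[symmetric]) (use Q(1) in auto)
  also have "\<dots> = (\<integral>\<^sup>+y. ennreal \<bar>det Q\<bar> * g (Q *v y) * indicator A (Q *v y) \<partial>lborel)"
    by (subst nn_integral_cmult[symmetric]) (auto simp: mult.assoc)
  also have "\<dots> = (\<integral>\<^sup>+y. ennreal (\<Prod>b\<in>Basis. std_normal_density (y \<bullet> b)) * indicator ((*v) Q -` A) y \<partial>lborel)"
    unfolding g by (simp add: indicator_def)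
  also have "\<dots> = emeasure (distr std_gauss borel ((*v) Q)) A"
    using measurable_sets_borel[of "(*v) Q" borel A]
    by (subst emeasure_distr) (simp_all add: std_gauss_def emeasure_density)
  finally show "emeasure (mv_normal 0 S) A = emeasure (distr std_gauss borel ((*v) Q)) A" .
qed

lemma
  fixes S :: "real^'n^'n"
  assumes S: "positive_definite S"
  shows prob_space_mv_normal: "prob_space (mv_normal 0 S)"
    and vchar_mv_normal: "vchar (mv_normal 0 S) u = exp (- (u \<bullet> (S *v u)) / 2)"
proof -
  obtain Q where Q: "S = Q ** transpose Q" "det Q \<noteq> 0" "(det Q)\<^sup>2 = det S"
    "\<And>y. (Q *v y) \<bullet> (matrix_inv S *v (Q *v y)) = y \<bullet> y"
    using positive_definite_factor[OF S] by blast
  have eq: "mv_normal 0 S = distr std_gauss borel ((*v) Q)" by (rule mv_normal_eq_distr[OF Q(2-4)])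
  have [measurable]: "(*v) Q \<in> borel_measurable borel"
    by (intro borel_measurable_continuous_onI matrix_vector_mult_linear_continuous_on)
  show "prob_space (mv_normal 0 S)"
    unfolding eq by (intro prob_space.prob_space_distr prob_space_std_gauss) auto
  have tr: "u \<bullet> (Q *v x) = (transpose Q *v u) \<bullet> x" for x u
    by (metis dot_lmul_matrix transpose_matrix_vector)
  have "vchar (mv_normal 0 S) u = (\<integral>x. iexp (u \<bullet> (Q *v x)) \<partial>std_gauss)"
    unfolding eq vchar_def by (subst integral_distr) auto
  also have "\<dots> = vchar std_gauss (transpose Q *v u)"
    unfolding vchar_def tr ..
  also have "\<dots> = exp (- (u \<bullet> (S *v u)) / 2)"
    by (simp add: vchar_std_gauss Q(1) power2_norm_eq_inner tr matrix_vector_mul_assoc[symmetric])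
  finally show "vchar (mv_normal 0 S) u = exp (- (u \<bullet> (S *v u)) / 2)" .
qed

lemma eq_mv_normal_convolutionI:
  fixes S :: "real^'n^'n"
  assumes S: "positive_definite S" and L: "prob_space L" "sets L = sets borel"
    and \<nu>: "prob_space \<nu>" "sets \<nu> = sets borel"
    and eq: "\<And>u. vchar L u = exp (- (u \<bullet> (S *v u)) / 2) * vchar \<nu> u"
  shows "L = (mv_normal 0 S \<star> \<nu>)"
proof -
  have s: "sets (mv_normal 0 S) = sets borel" by (simp add: mv_normal_def)
  note N = prob_space_mv_normal[OF S]
  show ?thesis
    by (rule vchar_unique)
       (use L N \<nu> s in \<open>simp_all add: prob_space_convolution vchar_convolution vchar_mv_normal[OF S] eq\<close>)
qed

section \<open>Weak compactness\<close>

text \<open>Schoenberg's space-filling curve: \<open>zigzag\<close> has period 2 and reads off the leading ternary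
  digit of \<open>t \<in> [0, 1]\<close> when that digit is 0 or 2.\<close>

definition zigzag :: "real \<Rightarrow> real" where
  "zigzag t = max 0 (min 1 (1/2 - cos (pi * t)))"

lemma zigzag_bounds: "0 \<le> zigzag t" "zigzag t \<le> 1"
  by (auto simp: zigzag_def)

lemma continuous_zigzag [continuous_intros]:
  fixes f :: "real \<Rightarrow> real"
  shows "continuous_on S f \<Longrightarrow> continuous_on S (\<lambda>t. zigzag (f t))"
  unfolding zigzag_def by (intro continuous_intros)

lemma zigzag_add_even: "zigzag (2 * real k + t) = zigzag t"
proof -
  have "cos (pi * (2 * real k + t)) = cos (pi * t + real k * (2 * pi))" by (simp add: algebra_simps)
  also have "\<dots> = cos (pi * t)"
    using cos.plus_of_nat[of "pi * t" k] by simp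
  finally show ?thesis by (simp add: zigzag_def)
qed

lemma zigzag_low: assumes "0 \<le> t" "t \<le> 1/3" shows "zigzag t = 0"
proof -
  have "cos (pi * t) \<ge> cos (pi / 3)"
    using assms by (intro cos_monotone_0_pi_le) (auto simp: field_simps)
  then show ?thesis by (simp add: zigzag_def cos_60)
qed

lemma zigzag_high: assumes "2/3 \<le> t" "t \<le> 1" shows "zigzag t = 1"
proof -
  have "cos (pi * t) \<le> cos (2 * pi / 3)"
    using assms by (intro cos_monotone_0_pi_le) (auto simp: field_simps)
  then show ?thesis by (simp add: zigzag_def cos_120' cos_120 mult.commute)
qed

text \<open>All ternary digits of t are 0 or 2. Multiplication by 3^m turns the digits before
  position m into an even integer, which the period 2 absorbs; what remains has the digit of
  \<open>a m\<close> in first place and so lies in [0, 1/3] or [2/3, 1], where \<open>zigzag\<close>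
  is constant.\<close>

lemma zigzag_ternary:
  fixes a :: "nat \<Rightarrow> bool"
  defines "t \<equiv> \<Sum>k. (2 / 3) * of_bool (a k) * (1 / 3) ^ k"
  shows "zigzag (3 ^ m * t) = of_bool (a m)" "0 \<le> t" "t \<le> 1"
proof -
  define c where "c k = (2 / 3 :: real) * of_bool (a k) * (1 / 3) ^ k" for k
  have c0: "0 \<le> c k" and c1: "c k \<le> (2/3) * (1/3) ^ k" for k by (auto simp: c_def)
  have gs: "(\<lambda>k. (2/3 :: real) * (1/3) ^ k) sums 1"
    using sums_mult[OF geometric_sums[of "1/3 :: real"], of "2/3"] by simp
  have sc: "summable c"
    by (rule summable_comparison_test'[OF sums_summable[OF gs]]) (use c0 c1 in auto)
  have tb: "0 \<le> suminf d \<and> suminf d \<le> 1" if "\<And>k. 0 \<le> d k" "\<And>k. d k \<le> (2/3) * (1/3) ^ k" for d :: "nat \<Rightarrow> real"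
  proof -
    have "summable d" by (rule summable_comparison_test'[OF sums_summable[OF gs]]) (use that in auto)
    then show ?thesis
      using suminf_nonneg[of d] suminf_le[of d, OF that(2)] sums_summable[OF gs] sums_unique[OF gs] that by auto
  qed
  have t: "t = suminf c" unfolding t_def c_def ..
  show "0 \<le> t" "t \<le> 1" using tb[of c] c0 c1 by (auto simp: t)
  \<comment> \<open>The tail after digit m, rescaled to a number of the same kind as t and hence in
    [0, 1].\<close>
  let ?r = "\<Sum>k. c (k + Suc m) * 3 ^ Suc m"
  have r: "0 \<le> ?r \<and> ?r \<le> 1"
    by (rule tb) (auto simp: c_def power_add field_simps)
  have "(\<Sum>k. c (k + Suc m)) * 3 ^ Suc m = ?r"
    using sc summable_ignore_initial_segment[OF sc, of "Suc m"] by (intro suminf_mult2) auto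
  moreover have "t = (\<Sum>k. c (k + Suc m)) + (\<Sum>k<Suc m. c k)"
    unfolding t by (rule suminf_split_initial_segment[OF sc])
  ultimately have "3 ^ m * t = ?r / 3 + 3 ^ m * (\<Sum>k<Suc m. c k)"
    by (simp add: field_simps)
  also have "3 ^ m * (\<Sum>k<Suc m. c k) = (2/3) * of_bool (a m) + (\<Sum>k<m. 3 ^ m * c k)"
    by (simp add: sum_distrib_left distrib_left c_def power_one_over field_simps)
  also have "(\<Sum>k<m. 3 ^ m * c k) = 2 * real (\<Sum>k<m. of_bool (a k) * 3 ^ (m - Suc k))"
  proof -
    have "3 ^ m * c k = 2 * real (of_bool (a k) * 3 ^ (m - Suc k))" if "k < m" for k
    proof -
      have "(3::real) ^ m = 3 ^ (m - Suc k) * 3 ^ Suc k" using that power_add[of "3::real" "m - Suc k" "Suc k"] by simp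
      then show ?thesis by (simp add: c_def power_one_over)
    qed
    then have "(\<Sum>k<m. 3 ^ m * c k) = (\<Sum>k<m. 2 * real (of_bool (a k) * 3 ^ (m - Suc k)))"
      by (intro sum.cong) auto
    then show ?thesis by (simp only: of_nat_sum sum_distrib_left)
  qed
  finally have "zigzag (3 ^ m * t) = zigzag ((2/3) * of_bool (a m) + ?r / 3)"
    using zigzag_add_even[of "\<Sum>k<m. of_bool (a k) * 3 ^ (m - Suc k)" "(2/3) * of_bool (a m) + ?r / 3"]
    by (simp add: add_ac)
  also have "\<dots> = of_bool (a m)"
    using r by (cases "a m") (auto intro!: zigzag_low zigzag_high)
  finally show "zigzag (3 ^ m * t) = of_bool (a m)" .
qed

lemma binary_expansion:
  fixes x :: real
  assumes "0 \<le> x" "x < 1"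
  shows "\<exists>a :: nat \<Rightarrow> bool. (\<lambda>k. of_bool (a k) * (1/2) ^ Suc k) sums x"
proof -
  define a where "a k \<longleftrightarrow> odd \<lfloor>2 ^ Suc k * x\<rfloor>" for k
  have part: "(\<Sum>k<n. of_bool (a k) * (1/2) ^ Suc k) = real_of_int \<lfloor>2 ^ n * x\<rfloor> / 2 ^ n" for n
  proof (induction n)
    case 0
    have "\<lfloor>x\<rfloor> = 0" using assms by linarith
    then show ?case by simp
  next
    case (Suc n)
    have "\<lfloor>2 ^ Suc n * x\<rfloor> = 2 * \<lfloor>2 ^ n * x\<rfloor> + of_bool (a n)"
    proof -
      let ?y = "2 ^ n * x"
      have "\<lfloor>2 * ?y\<rfloor> = 2 * \<lfloor>?y\<rfloor> \<or> \<lfloor>2 * ?y\<rfloor> = 2 * \<lfloor>?y\<rfloor> + 1" by linarith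
      then show ?thesis unfolding a_def by (auto simp: mult.assoc)
    qed
    then have "real_of_int \<lfloor>2 ^ Suc n * x\<rfloor> = 2 * of_int \<lfloor>2 ^ n * x\<rfloor> + of_bool (a n)"
      by simp
    then show ?case by (simp only: sum.lessThan_Suc Suc.IH) (simp add: field_simps)
  qed
  have "(\<lambda>n. of_int \<lfloor>2 ^ n * x\<rfloor> / 2 ^ n) \<longlonglongrightarrow> x"
  proof (rule tendsto_sandwich[where f="\<lambda>n. x - (1/2) ^ n" and h="\<lambda>n. x"])
    have "x - (1/2) ^ n \<le> of_int \<lfloor>2 ^ n * x\<rfloor> / 2 ^ n" for n
    proof -
      have "2 ^ n * x - 1 \<le> of_int \<lfloor>2 ^ n * x\<rfloor>" by linarith
      then show ?thesis
        using divide_right_mono[of "2 ^ n * x - 1" "of_int \<lfloor>2 ^ n * x\<rfloor>" "2 ^ n"]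
        by (simp add: diff_divide_distrib power_one_over)
    qed
    then show "\<forall>\<^sub>F n in sequentially. x - (1/2) ^ n \<le> of_int \<lfloor>2 ^ n * x\<rfloor> / 2 ^ n" by simp
    have "of_int \<lfloor>2 ^ n * x\<rfloor> / 2 ^ n \<le> x" for n by (simp add: field_simps)
    then show "\<forall>\<^sub>F n in sequentially. of_int \<lfloor>2 ^ n * x\<rfloor> / 2 ^ n \<le> x" by simp
    have "(\<lambda>n. x - (1/2) ^ n) \<longlonglongrightarrow> x - 0" by (intro tendsto_intros LIMSEQ_power_zero) auto
    then show "(\<lambda>n. x - (1/2) ^ n) \<longlonglongrightarrow> x" by simp
  qed simp
  then show ?thesis unfolding sums_def part[symmetric] by blast
qed

text \<open>By periodicity every block [2 m, 2 m + 1] traces a whole unit cube, and the amplitude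
  grows with m, so all of space is covered. The bound on the time needed to reach a ball is what
  later carries tightness over to the line.\<close>

lemma space_filling_curve:
  obtains c :: "real \<Rightarrow> 'a::euclidean_space" where "continuous_on UNIV c"
    "\<And>(n::nat) x. norm x < real n \<Longrightarrow> \<exists>t\<in>{0..2 * real n + 1}. c t = x"
proof -
  let ?d = "DIM('a)"
  obtain e :: "'a \<Rightarrow> nat" where e: "bij_betw e Basis {0..<?d}"
    using ex_bij_betw_finite_nat[OF finite_Basis] by blast
  \<comment> \<open>Digits are dealt out cyclically: the coordinate with index \<open>e b\<close>
    receives those at positions congruent to \<open>e b\<close> modulo the dimension, and reads them
    as binary digits.\<close>
  define s where "s b t = (\<Sum>k. zigzag (3 ^ (k * ?d + e b) * t) * (1/2) ^ Suc k)" for b :: 'a and t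
  have cont_s: "continuous_on UNIV (s b)" for b
  proof -
    have "uniform_limit UNIV (\<lambda>n t. \<Sum>k<n. zigzag (3 ^ (k * ?d + e b) * t) * (1/2) ^ Suc k)
        (\<lambda>t. \<Sum>k. zigzag (3 ^ (k * ?d + e b) * t) * (1/2) ^ Suc k) sequentially"
      by (rule Weierstrass_m_test[where M="\<lambda>k. (1/2) ^ Suc k"])
         (use zigzag_bounds in \<open>auto simp: abs_mult intro!: mult_left_le_one_le summable_geometric\<close>)
    then show ?thesis unfolding s_def
      by (rule uniform_limit_theorem[rotated]) (auto intro!: always_eventually continuous_intros)
  qed
  have surj_s: "\<exists>t. 0 \<le> t \<and> t \<le> 1 \<and> (\<forall>m::nat. \<forall>b\<in>Basis. s b (2 * m + t) = x \<bullet> b)"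
    if x: "\<And>b. b \<in> Basis \<Longrightarrow> 0 \<le> x \<bullet> b \<and> x \<bullet> b < 1" for x :: 'a
  proof -
    have "\<forall>b\<in>Basis. \<exists>a :: nat \<Rightarrow> bool. (\<lambda>k. of_bool (a k) * (1/2) ^ Suc k) sums (x \<bullet> b)"
      using x binary_expansion by blast
    then obtain a :: "'a \<Rightarrow> nat \<Rightarrow> bool"
      where a: "\<And>b. b \<in> Basis \<Longrightarrow> (\<lambda>k. of_bool (a b k) * (1/2) ^ Suc k) sums (x \<bullet> b)" by metis
    define A where "A m = a (inv_into Basis e (m mod ?d)) (m div ?d)" for m
    have A: "A (k * ?d + e b) = a b k" if "b \<in> Basis" for k b
    proof -
      have "e b < ?d" using e that by (auto simp: bij_betw_def)
      moreover have "inv_into Basis e (e b) = b" using e that by (simp add: bij_betw_def)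
      ultimately show ?thesis by (simp add: A_def)
    qed
    define t where "t = (\<Sum>k. (2 / 3) * of_bool (A k) * (1 / 3 :: real) ^ k)"
    note t = zigzag_ternary[where a=A, folded t_def]
    have "s b (2 * m + t) = x \<bullet> b" if b: "b \<in> Basis" for b and m :: nat
    proof -
      have "zigzag (3 ^ j * (2 * m + t)) = zigzag (3 ^ j * t)" for j
        using zigzag_add_even[of "3 ^ j * m" "3 ^ j * t"] by (simp add: algebra_simps)
      then show ?thesis
        unfolding s_def using t(1) A[OF b] sums_unique[OF a[OF b]] by simp
    qed
    then show ?thesis using t(2,3) by (intro exI[of _ t]) simp
  qed
  \<comment> \<open>The subtracted term is the triangle wave giving the distance from t to the
    nearest even integer. Hence \<open>\<rho>\<close> is continuous, yet constant and equal to 2 m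
    on the block [2 m, 2 m + 1].\<close>
  define \<rho> where "\<rho> t = t - arccos (cos (pi * t)) / pi" for t
  have \<rho>: "\<rho> (2 * real m + t) = 2 * real m" if "0 \<le> t" "t \<le> 1" for m t
  proof -
    have "cos (pi * (2 * real m + t)) = cos (pi * t + real m * (2 * pi))" by (simp add: algebra_simps)
    also have "\<dots> = cos (pi * t)" using cos.plus_of_nat[of "pi * t" m] by simp
    finally show ?thesis using that arccos_cos[of "pi * t"] by (simp add: \<rho>_def)
  qed
  have cont_\<rho>: "continuous_on UNIV \<rho>"
    unfolding \<rho>_def by (intro continuous_intros) auto
  define c where "c t = (\<Sum>b\<in>Basis. (\<rho> t * (2 * s b t - 1)) *\<^sub>R b)" for t :: real
  show thesis
  proof (rule that)
    show "continuous_on UNIV (c :: real \<Rightarrow> 'a)"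
      unfolding c_def by (intro continuous_intros cont_s cont_\<rho>)
    fix n :: nat and x :: 'a assume x: "norm x < real n"
    then have n: "n > 0" by (cases n) auto
    \<comment> \<open>The inverse of the affine map applied on block n, which sends the unit cube to
      the cube of half-side 2 n; the ball of radius n lands well inside the unit cube.\<close>
    define y where "y = (\<Sum>b\<in>Basis. ((x \<bullet> b / (2 * real n) + 1) / 2) *\<^sub>R b)"
    have y: "y \<bullet> b = (x \<bullet> b / (2 * real n) + 1) / 2" if "b \<in> Basis" for b
      using that by (simp add: y_def)
    have "0 \<le> y \<bullet> b \<and> y \<bullet> b < 1" if "b \<in> Basis" for b
    proof -
      have "\<bar>x \<bullet> b\<bar> < 2 * real n" using Basis_le_norm[OF that, of x] x by linarith
      then show ?thesis using n unfolding y[OF that] by (simp add: field_simps abs_less_iff)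
    qed
    from surj_s[of y, OF this] obtain t where t: "0 \<le> t" "t \<le> 1" "\<And>b. b \<in> Basis \<Longrightarrow> s b (2 * real n + t) = y \<bullet> b"
      by blast
    have "\<rho> (2 * real n + t) * (2 * s b (2 * real n + t) - 1) = x \<bullet> b" if "b \<in> Basis" for b
      using n by (simp only: t(3)[OF that] \<rho>[OF t(1,2)] y[OF that]) (simp add: field_simps)
    then have "c (2 * real n + t) = (\<Sum>b\<in>Basis. (x \<bullet> b) *\<^sub>R b)"
      unfolding c_def by (intro sum.cong refl) simp
    then show "\<exists>t\<in>{0..2 * real n + 1}. c t = x"
      using t by (intro bexI[of _ "2 * real n + t"]) (auto simp: euclidean_representation)
  qed
qed

text \<open>A right inverse \<open>g\<close> of the curve pushes the laws to the line, where
  tightness yields a weakly convergent subsequence; the continuous curve pushes its limit back. The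
  choice function \<open>g\<close> need not be Borel: every function is measurable on a
  \<open>pmf\<close>.\<close>

lemma prohorov_pmf:
  fixes \<mu> :: "nat \<Rightarrow> 'a::euclidean_space pmf"
  assumes tight: "\<And>e. e > 0 \<Longrightarrow> \<exists>R. \<forall>n. measure_pmf.prob (\<mu> n) {x. norm x \<ge> R} < e"
  obtains r \<nu> where "strict_mono (r :: nat \<Rightarrow> nat)" "prob_space \<nu>" "sets \<nu> = sets borel"
    "\<And>f :: 'a \<Rightarrow> complex. continuous_on UNIV f \<Longrightarrow> bounded (range f) \<Longrightarrow>
      (\<lambda>n. measure_pmf.expectation (\<mu> (r n)) f) \<longlonglongrightarrow> integral\<^sup>L \<nu> f"
proof -
  obtain c :: "real \<Rightarrow> 'a" where c: "continuous_on UNIV c"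
    "\<And>(n::nat) x. norm x < real n \<Longrightarrow> \<exists>t\<in>{0..2 * real n + 1}. c t = x"
    using space_filling_curve by blast
  have [measurable]: "c \<in> borel_measurable borel" using c(1) by (rule borel_measurable_continuous_onI)
  define g where "g x = (SOME t. t \<in> {0..2 * (real (nat \<lfloor>norm x\<rfloor> + 1)) + 1} \<and> c t = x)" for x
  have g: "g x \<in> {0..2 * real (nat \<lfloor>norm x\<rfloor> + 1) + 1}" "c (g x) = x" for x
  proof -
    have "norm x < real (nat \<lfloor>norm x\<rfloor> + 1)" by linarith
    then have "\<exists>t. t \<in> {0..2 * real (nat \<lfloor>norm x\<rfloor> + 1) + 1} \<and> c t = x" using c(2) by blast
    from someI_ex[OF this] show "g x \<in> {0..2 * real (nat \<lfloor>norm x\<rfloor> + 1) + 1}" "c (g x) = x"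
      unfolding g_def by auto
  qed
  define m where "m n = distr (measure_pmf (\<mu> n)) borel g" for n
  have rd: "real_distribution (m n)" for n
    unfolding m_def real_distribution_def real_distribution_axioms_def
    by (auto intro!: measure_pmf.prob_space_distr)
  have "tight m"
    unfolding tight_def
  proof (intro conjI allI impI rd)
    fix e :: real assume "e > 0"
    from tight[OF this] obtain R where R: "\<And>n. measure_pmf.prob (\<mu> n) {x. norm x \<ge> R} < e" by blast
    \<comment> \<open>A point of norm below R has code at most 2 R + 3. The left endpoint -1 below
      makes the half-open interval contain the code 0.\<close>
    define b where "b = 2 * \<bar>R\<bar> + 4"
    have sub: "- {x :: 'a. norm x \<ge> R} \<subseteq> g -` {-1<..b}"
    proof
      fix x :: 'a assume "x \<in> - {x. norm x \<ge> R}"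
      then have "norm x < R" by auto
      moreover have "real (nat \<lfloor>norm x\<rfloor>) \<le> norm x" by simp
      ultimately show "x \<in> g -` {-1<..b}" using g(1)[of x] unfolding b_def vimage_def by (simp; linarith)
    qed
    have "measure (m n) {-1<..b} > 1 - e" for n
    proof -
      have "1 - e < measure_pmf.prob (\<mu> n) (- {x. norm x \<ge> R})"
        using R[of n] measure_pmf.prob_compl[of "{x. norm x \<ge> R}" "\<mu> n"] by (simp add: Compl_eq_Diff_UNIV)
      also have "\<dots> \<le> measure_pmf.prob (\<mu> n) (g -` {-1<..b})"
        by (intro measure_pmf.finite_measure_mono sub) auto
      finally show ?thesis by (simp add: m_def measure_distr)
    qed
    then show "\<exists>a b. a < b \<and> (\<forall>n. 1 - e < measure (m n) {a<..b})"
      by (intro exI[of _ "-1"] exI[of _ b]) (auto simp: b_def)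
  qed
  from tight_imp_convergent_subsubsequence[OF this strict_mono_id] obtain r M
    where r: "strict_mono (r :: nat \<Rightarrow> nat)" and M: "real_distribution M" and conv: "weak_conv_m (m \<circ> r) M"
    by (auto simp: o_def)
  interpret M: real_distribution M by (rule M)
  have cM[measurable]: "c \<in> borel_measurable M" by simp
  show thesis
  proof (rule that[OF r])
    show "prob_space (distr M borel c)" by (rule M.prob_space_distr) simp
    show "sets (distr M borel c) = sets borel" by simp
    fix f :: "'a \<Rightarrow> complex" assume f: "continuous_on UNIV f" and "bounded (range f)"
    then obtain B where B: "\<And>x. norm (f x) \<le> B" by (auto simp: bounded_iff)
    have [measurable]: "f \<in> borel_measurable borel" using f by (rule borel_measurable_continuous_onI)
    have "(\<lambda>n. integral\<^sup>L ((m \<circ> r) n) (\<lambda>t. f (c t))) \<longlonglongrightarrow> integral\<^sup>L M (\<lambda>t. f (c t))"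
    proof (rule weak_conv_imp_integral_bdd_continuous_conv)
      show "isCont (\<lambda>t. f (c t)) x" for x
        using continuous_on_compose2[OF f c(1)] by (simp add: continuous_on_eq_continuous_at)
    qed (use B rd M conv in \<open>auto simp: o_def\<close>)
    moreover have "integral\<^sup>L ((m \<circ> r) n) (\<lambda>t. f (c t)) = measure_pmf.expectation (\<mu> (r n)) f" for n
      by (simp add: m_def integral_distr g)
    ultimately show "(\<lambda>n. measure_pmf.expectation (\<mu> (r n)) f) \<longlonglongrightarrow> integral\<^sup>L (distr M borel c) f"
      by (simp add: integral_distr)
  qed
qed

section \<open>The discrete likelihood\<close>

text \<open>The law of the first observations: \<open>\<kappa> t x\<close> is the conditional
  probability that the gate opens after the past \<open>x\<close>, and \<open>q t\<close> is the
  event probability. Arbitrary dependence on the past sits in \<open>\<kappa>\<close>; the parameter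
  will occur in \<open>q\<close> only.\<close>

primrec traj :: "(nat \<Rightarrow> (bool \<times> bool) list \<Rightarrow> real) \<Rightarrow> (nat \<Rightarrow> real) \<Rightarrow> nat \<Rightarrow> (bool \<times> bool) list pmf" where
  "traj \<kappa> q 0 = return_pmf []"
| "traj \<kappa> q (Suc t) = bind_pmf (traj \<kappa> q t) (\<lambda>x. bind_pmf (bernoulli_pmf (\<kappa> t x))
     (\<lambda>g. map_pmf (\<lambda>z. x @ [(g, g \<and> z)]) (bernoulli_pmf (q t))))"

abbreviation traj_mean :: "(nat \<Rightarrow> (bool \<times> bool) list \<Rightarrow> real) \<Rightarrow> (nat \<Rightarrow> real) \<Rightarrow> nat \<Rightarrow>
    ((bool \<times> bool) list \<Rightarrow> 'b::{banach, second_countable_topology}) \<Rightarrow> 'b" where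
  "traj_mean \<kappa> q n f \<equiv> measure_pmf.expectation (traj \<kappa> q n) f"

lemma finite_set_traj [simp]: "finite (set_pmf (traj \<kappa> q n))"
  by (induction n) auto

lemma length_traj: "x \<in> set_pmf (traj \<kappa> q n) \<Longrightarrow> length x = n"
  by (induction n arbitrary: x) auto

lemma integrable_traj [simp]: "integrable (measure_pmf (traj \<kappa> q n)) f"
  for f :: "_ \<Rightarrow> 'b::{banach, second_countable_topology}"
  by (rule integrable_measure_pmf_finite) simp

lemma traj_mean_sum:
  fixes f :: "_ \<Rightarrow> 'b::{banach, second_countable_topology}"
  shows "traj_mean \<kappa> q n f = (\<Sum>x\<in>set_pmf (traj \<kappa> q n). pmf (traj \<kappa> q n) x *\<^sub>R f x)"
  by (rule integral_measure_pmf) auto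

lemma traj_mean_mono:
  fixes f g :: "_ \<Rightarrow> real"
  assumes "\<And>x. length x = n \<Longrightarrow> f x \<le> g x"
  shows "traj_mean \<kappa> q n f \<le> traj_mean \<kappa> q n g"
  by (rule integral_mono_AE) (use assms length_traj in \<open>auto simp: AE_measure_pmf_iff\<close>)

lemma traj_mean_cong:
  fixes f g :: "_ \<Rightarrow> 'b::{banach, second_countable_topology}"
  assumes "\<And>x. length x = n \<Longrightarrow> f x = g x"
  shows "traj_mean \<kappa> q n f = traj_mean \<kappa> q n g"
  by (rule integral_cong_AE) (use assms length_traj in \<open>auto simp: AE_measure_pmf_iff\<close>)

lemma traj_mean_Suc:
  fixes f :: "_ \<Rightarrow> 'b::{banach, second_countable_topology}"
  assumes \<kappa>: "\<And>t x. \<kappa> t x \<in> {0..1}" and q: "q n \<in> {0..1}"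
  shows "traj_mean \<kappa> q (Suc n) f = traj_mean \<kappa> q n (\<lambda>x.
    \<kappa> n x *\<^sub>R (q n *\<^sub>R f (x @ [(True, True)]) + (1 - q n) *\<^sub>R f (x @ [(True, False)])) +
    (1 - \<kappa> n x) *\<^sub>R f (x @ [(False, False)]))"
proof -
  have inner: "measure_pmf.expectation (map_pmf (\<lambda>z. x @ [(g, g \<and> z)]) (bernoulli_pmf (q n))) f =
      q n *\<^sub>R f (x @ [(g, g)]) + (1 - q n) *\<^sub>R f (x @ [(g, False)])" for x g
  proof -
    have "measure_pmf.expectation (bernoulli_pmf (q n)) (\<lambda>z. f (x @ [(g, g \<and> z)])) =
        (\<Sum>z\<in>UNIV. pmf (bernoulli_pmf (q n)) z *\<^sub>R f (x @ [(g, g \<and> z)]))"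
      by (rule integral_measure_pmf) auto
    then show ?thesis using q by (simp add: UNIV_bool add.commute)
  qed
  have outer: "measure_pmf.expectation (bind_pmf (bernoulli_pmf (\<kappa> n x))
      (\<lambda>g. map_pmf (\<lambda>z. x @ [(g, g \<and> z)]) (bernoulli_pmf (q n)))) f =
    \<kappa> n x *\<^sub>R (q n *\<^sub>R f (x @ [(True, True)]) + (1 - q n) *\<^sub>R f (x @ [(True, False)])) +
    (1 - \<kappa> n x) *\<^sub>R f (x @ [(False, False)])" for x
  proof -
    have "measure_pmf.expectation (bind_pmf (bernoulli_pmf (\<kappa> n x))
      (\<lambda>g. map_pmf (\<lambda>z. x @ [(g, g \<and> z)]) (bernoulli_pmf (q n)))) f =
      (\<Sum>g\<in>UNIV. pmf (bernoulli_pmf (\<kappa> n x)) g *\<^sub>R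
        measure_pmf.expectation (map_pmf (\<lambda>z. x @ [(g, g \<and> z)]) (bernoulli_pmf (q n))) f)"
      by (rule pmf_expectation_bind) auto
    then show ?thesis
      unfolding inner using \<kappa>[of n x]
      by (simp add: UNIV_bool add.commute scaleR_add_left[symmetric] del: scaleR_left.add)
  qed
  show ?thesis
    unfolding traj.simps(2)
    by (subst pmf_expectation_bind[where A="set_pmf (traj \<kappa> q n)"]) (auto simp: outer traj_mean_sum)
qed

section \<open>Products of step factors along an observed path\<close>

definition path_prod :: "(nat \<Rightarrow> bool \<times> bool \<Rightarrow> real) \<Rightarrow> (bool \<times> bool) list \<Rightarrow> real" where
  "path_prod a x = (\<Prod>t<length x. a t (x ! t))"

lemma path_prod_snoc: "path_prod a (x @ [z]) = path_prod a x * a (length x) z"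
  by (simp add: path_prod_def nth_append)

lemma path_prod_Nil [simp]: "path_prod a [] = 1"
  by (simp add: path_prod_def)

text \<open>The conditional mean of a step factor given the past and an open gate; a closed gate
  always yields (False, False).\<close>

definition open_mean :: "real \<Rightarrow> (bool \<times> bool \<Rightarrow> real) \<Rightarrow> real" where
  "open_mean q \<phi> = q * \<phi> (True, True) + (1 - q) * \<phi> (True, False)"

text \<open>A closed gate contributes the factor 1, which is at most c, so the conditional mean of a
  step is at most c whatever the gate probability.\<close>

lemma traj_mean_path_prod_le:
  assumes \<kappa>: "\<And>t x. \<kappa> t x \<in> {0..1}" and q: "\<And>t. q t \<in> {0..1}"
    and b: "\<And>t z. 0 \<le> b t z" "\<And>t. b t (False, False) = 1" "\<And>t. open_mean (q t) (b t) \<le> c" and c: "c \<ge> 1"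
  shows "traj_mean \<kappa> q n (path_prod b) \<le> c ^ n"
proof (induction n)
  case 0 then show ?case by simp
next
  case (Suc n)
  have "traj_mean \<kappa> q (Suc n) (path_prod b) =
      traj_mean \<kappa> q n (\<lambda>x. path_prod b x * (\<kappa> n x * open_mean (q n) (b n) + (1 - \<kappa> n x)))"
    unfolding traj_mean_Suc[OF \<kappa> q]
    by (rule traj_mean_cong) (simp add: path_prod_snoc b(2) open_mean_def algebra_simps)
  also have "\<dots> \<le> traj_mean \<kappa> q n (\<lambda>x. path_prod b x * c)"
  proof (rule traj_mean_mono, rule mult_left_mono)
    fix x
    have "\<kappa> n x * open_mean (q n) (b n) + (1 - \<kappa> n x) \<le> \<kappa> n x * c + (1 - \<kappa> n x) * c"
      using \<kappa>[of n x] b(3)[of n] c by (intro add_mono mult_left_mono) (auto simp: mult_le_cancel_left1)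
    then show "\<kappa> n x * open_mean (q n) (b n) + (1 - \<kappa> n x) \<le> c" by (simp add: algebra_simps)
    show "0 \<le> path_prod b x" unfolding path_prod_def by (intro prod_nonneg b(1))
  qed
  also have "\<dots> \<le> c ^ n * c"
    using Suc.IH c by simp
  finally show ?case by (simp add: mult.commute)
qed

text \<open>With B the product of the b and D the difference, one open step maps D to a D + (a - b)
  B. Squaring gives three conditional moments. The mixed moment of a (a - b) is a separate
  hypothesis: Cauchy-Schwarz would bound it only by the root of the last moment, too weak to be
  summed over n steps.\<close>

lemma traj_mean_path_prod_diff:
  assumes \<kappa>: "\<And>t x. \<kappa> t x \<in> {0..1}" and q: "\<And>t. q t \<in> {0..1}"
    and z: "\<And>t. a t (False, False) = 1" "\<And>t. b t (False, False) = 1"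
    and e: "0 \<le> \<eta>" "0 \<le> \<epsilon>"
    and a2: "\<And>t. open_mean (q t) (\<lambda>z. (a t z)\<^sup>2) \<le> 1 + \<eta>"
    and b2: "\<And>t. open_mean (q t) (\<lambda>z. (b t z)\<^sup>2) \<le> 1 + \<eta>"
    and ar: "\<And>t. \<bar>open_mean (q t) (\<lambda>z. a t z * (a t z - b t z))\<bar> \<le> \<epsilon>"
    and r2: "\<And>t. open_mean (q t) (\<lambda>z. (a t z - b t z)\<^sup>2) \<le> \<epsilon>"
  shows "traj_mean \<kappa> q n (\<lambda>x. (path_prod a x - path_prod b x)\<^sup>2) \<le> 2 * \<epsilon> * real n * (1 + \<eta> + \<epsilon>) ^ n"
proof (induction n)
  case 0 then show ?case by simp
next
  case (Suc n)
  have "(path_prod b x)\<^sup>2 = path_prod (\<lambda>t z. (b t z)\<^sup>2) x" for x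
    by (simp add: path_prod_def prod_power_distrib)
  then have B: "traj_mean \<kappa> q n (\<lambda>x. (path_prod b x)\<^sup>2) \<le> (1 + \<eta>) ^ n"
    using traj_mean_path_prod_le[OF \<kappa> q, where b="\<lambda>t z. (b t z)\<^sup>2" and c="1 + \<eta>" and n=n] z b2 e by simp
  let ?d = "\<lambda>x. path_prod a x - path_prod b x"
  have step: "\<kappa> n x * (q n * (?d (x @ [(True, True)]))\<^sup>2 +
      (1 - q n) * (?d (x @ [(True, False)]))\<^sup>2) +
      (1 - \<kappa> n x) * (?d (x @ [(False, False)]))\<^sup>2
    \<le> (1 + \<eta> + \<epsilon>) * (?d x)\<^sup>2 + 2 * \<epsilon> * (path_prod b x)\<^sup>2"
    (is "?lhs \<le> ?rhs") if len: "length x = n" for x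
  proof -
    define D B where "D = path_prod a x - path_prod b x" and "B = path_prod b x"
    have A: "path_prod a x = D + B" by (simp add: D_def B_def)
    have "q n * (?d (x @ [(True, True)]))\<^sup>2 +
      (1 - q n) * (?d (x @ [(True, False)]))\<^sup>2 =
      D\<^sup>2 * open_mean (q n) (\<lambda>z. (a n z)\<^sup>2) + 2 * (D * B) * open_mean (q n) (\<lambda>z. a n z * (a n z - b n z))
      + B\<^sup>2 * open_mean (q n) (\<lambda>z. (a n z - b n z)\<^sup>2)"
      unfolding path_prod_snoc A B_def[symmetric] open_mean_def len by algebra
    also have "\<dots> \<le> D\<^sup>2 * (1 + \<eta>) + (D\<^sup>2 + B\<^sup>2) * \<epsilon> + B\<^sup>2 * \<epsilon>"
    proof (intro add_mono mult_left_mono a2 r2)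
      have "2 * (D * B) * open_mean (q n) (\<lambda>z. a n z * (a n z - b n z))
          \<le> \<bar>2 * (D * B)\<bar> * \<bar>open_mean (q n) (\<lambda>z. a n z * (a n z - b n z))\<bar>"
        by (simp flip: abs_mult)
      also have "\<dots> \<le> (D\<^sup>2 + B\<^sup>2) * \<epsilon>"
        using sum_squares_bound[of "\<bar>D\<bar>" "\<bar>B\<bar>"] by (intro mult_mono ar) (auto simp: abs_mult)
      finally show "2 * (D * B) * open_mean (q n) (\<lambda>z. a n z * (a n z - b n z)) \<le> (D\<^sup>2 + B\<^sup>2) * \<epsilon>" .
    qed auto
    also have "\<dots> = ?rhs" by (simp add: D_def B_def algebra_simps)
    finally have "?lhs \<le> \<kappa> n x * ?rhs + (1 - \<kappa> n x) * (?d (x @ [(False, False)]))\<^sup>2"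
      using \<kappa>[of n x] by (simp add: mult_left_mono)
    also have "\<dots> \<le> \<kappa> n x * ?rhs + (1 - \<kappa> n x) * ?rhs"
    proof (intro add_left_mono mult_left_mono)
      have "(?d x)\<^sup>2 \<le> (1 + \<eta> + \<epsilon>) * (?d x)\<^sup>2"
        using e by (simp add: mult_le_cancel_right1)
      then show "(?d (x @ [(False, False)]))\<^sup>2 \<le> ?rhs"
        using e unfolding path_prod_snoc z by (simp add: add_increasing2)
    qed (use \<kappa>[of n x] in auto)
    finally show ?thesis by (simp add: algebra_simps)
  qed
  have "traj_mean \<kappa> q (Suc n) (\<lambda>x. (?d x)\<^sup>2) \<le>
      traj_mean \<kappa> q n (\<lambda>x. (1 + \<eta> + \<epsilon>) * (?d x)\<^sup>2 + 2 * \<epsilon> * (path_prod b x)\<^sup>2)"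
    unfolding traj_mean_Suc[OF \<kappa> q] by (rule traj_mean_mono) (use step in simp)
  also have "\<dots> = (1 + \<eta> + \<epsilon>) * traj_mean \<kappa> q n (\<lambda>x. (?d x)\<^sup>2)
      + 2 * \<epsilon> * traj_mean \<kappa> q n (\<lambda>x. (path_prod b x)\<^sup>2)"
    by simp
  also have "\<dots> \<le> (1 + \<eta> + \<epsilon>) * (2 * \<epsilon> * real n * (1 + \<eta> + \<epsilon>) ^ n) + 2 * \<epsilon> * (1 + \<eta> + \<epsilon>) ^ Suc n"
  proof (intro add_mono mult_left_mono Suc.IH)
    have "(1 + \<eta>) ^ n \<le> (1 + \<eta> + \<epsilon>) ^ n" using e by (intro power_mono) auto
    also have "\<dots> \<le> (1 + \<eta> + \<epsilon>) ^ Suc n" using e by (intro power_increasing) auto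
    finally show "traj_mean \<kappa> q n (\<lambda>x. (path_prod b x)\<^sup>2) \<le> (1 + \<eta> + \<epsilon>) ^ Suc n" using B by linarith
  qed (use e in auto)
  also have "\<dots> = 2 * \<epsilon> * real (Suc n) * (1 + \<eta> + \<epsilon>) ^ Suc n" by (simp add: algebra_simps)
  finally show ?case .
qed

section \<open>One Bernoulli step: exact ratio against Gaussian factor\<close>

definition std_score :: "real \<Rightarrow> bool \<Rightarrow> real" where
  "std_score q y = (if y then 1 / q else - 1 / (1 - q))"

text \<open>For an open gate this is q' / q or (1 - q') / (1 - q), written affinely in q' - q;
  \<open>std_score q y\<close> is (y - q) / (q (1 - q)), the derivative of the Bernoulli
  log-likelihood in q.\<close>

definition ratio :: "real \<Rightarrow> real \<Rightarrow> bool \<times> bool \<Rightarrow> real" where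
  "ratio q q' z = (if fst z then 1 + (q' - q) * std_score q (snd z) else 1)"

text \<open>Both laws use the same gate probabilities, which cancel in the likelihood ratio, so only
  steps with an open gate leave a factor.\<close>

lemma traj_mean_change:
  fixes f :: "_ \<Rightarrow> 'b::{banach, second_countable_topology}"
  assumes \<kappa>: "\<And>t x. \<kappa> t x \<in> {0..1}" and q: "\<And>t. 0 < q t \<and> q t < 1" and q': "\<And>t. q' t \<in> {0..1}"
  shows "traj_mean \<kappa> q' n f = traj_mean \<kappa> q n (\<lambda>x. path_prod (\<lambda>t. ratio (q t) (q' t)) x *\<^sub>R f x)"
proof (induction n arbitrary: f)
  case 0 then show ?case by simp
next
  case (Suc n)
  have q01: "q t \<in> {0..1}" for t using q[of t] by auto
  have R: "q n * (1 + (q' n - q n) * std_score (q n) True) = q' n"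
    "(1 - q n) * (1 + (q' n - q n) * std_score (q n) False) = 1 - q' n"
    using q[of n] unfolding std_score_def by (simp_all add: divide_simps)
  have "traj_mean \<kappa> q' (Suc n) f = traj_mean \<kappa> q n (\<lambda>x. path_prod (\<lambda>t. ratio (q t) (q' t)) x *\<^sub>R
     (\<kappa> n x *\<^sub>R (q' n *\<^sub>R f (x @ [(True, True)]) + (1 - q' n) *\<^sub>R f (x @ [(True, False)])) +
    (1 - \<kappa> n x) *\<^sub>R f (x @ [(False, False)])))"
    unfolding traj_mean_Suc[OF \<kappa> q'] Suc.IH ..
  also have "\<dots> = traj_mean \<kappa> q (Suc n) (\<lambda>x. path_prod (\<lambda>t. ratio (q t) (q' t)) x *\<^sub>R f x)"
    unfolding traj_mean_Suc[OF \<kappa> q01]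
  proof (rule traj_mean_cong)
    fix x :: "(bool \<times> bool) list" assume len: "length x = n"
    let ?P = "path_prod (\<lambda>t. ratio (q t) (q' t))"
    have "q n * ?P (x @ [(True, True)]) = ?P x * (q n * (1 + (q' n - q n) * std_score (q n) True))"
      "(1 - q n) * ?P (x @ [(True, False)]) = ?P x * ((1 - q n) * (1 + (q' n - q n) * std_score (q n) False))"
      "?P (x @ [(False, False)]) = ?P x"
      unfolding path_prod_snoc len ratio_def by (simp_all add: mult_ac)
    then have E: "q n * ?P (x @ [(True, True)]) = ?P x * q' n"
      "(1 - q n) * ?P (x @ [(True, False)]) = ?P x * (1 - q' n)" "?P (x @ [(False, False)]) = ?P x"
      unfolding R .
    show "path_prod (\<lambda>t. ratio (q t) (q' t)) x *\<^sub>R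
        (\<kappa> n x *\<^sub>R (q' n *\<^sub>R f (x @ [(True, True)]) + (1 - q' n) *\<^sub>R f (x @ [(True, False)])) +
         (1 - \<kappa> n x) *\<^sub>R f (x @ [(False, False)])) =
       \<kappa> n x *\<^sub>R (q n *\<^sub>R path_prod (\<lambda>t. ratio (q t) (q' t)) (x @ [(True, True)]) *\<^sub>R f (x @ [(True, True)]) +
         (1 - q n) *\<^sub>R path_prod (\<lambda>t. ratio (q t) (q' t)) (x @ [(True, False)]) *\<^sub>R f (x @ [(True, False)])) +
       (1 - \<kappa> n x) *\<^sub>R path_prod (\<lambda>t. ratio (q t) (q' t)) (x @ [(False, False)]) *\<^sub>R f (x @ [(False, False)])"
      by (simp only: scaleR_scaleR E scaleR_add_right) (simp only: mult_ac)
  qed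
  finally show ?case .
qed

text \<open>The exponential of a linear score term minus half its conditional variance, since the
  score of one step has variance 1 / (q (1 - q)).\<close>

definition gauss_factor :: "real \<Rightarrow> real \<Rightarrow> bool \<times> bool \<Rightarrow> real" where
  "gauss_factor q \<alpha> z = (if fst z then exp (\<alpha> * std_score q (snd z) - \<alpha>\<^sup>2 / (q * (1 - q)) / 2) else 1)"

text \<open>Here z is of order n^(-1/2), and the remainder is o (z^2), hence o (1 / n). The
  auxiliary \<open>g\<close> is the remainder divided by x^2, extended continuously by 0.\<close>

lemma exp_second_order_remainder:
  fixes z :: "nat \<Rightarrow> real"
  assumes z: "(\<lambda>n. sqrt (real n) * z n) \<longlonglongrightarrow> l"
  shows "(\<lambda>n. real n * (exp (z n) - 1 - z n - (z n)\<^sup>2 / 2)) \<longlonglongrightarrow> 0"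
proof -
  define g where "g x = (if x = 0 then 0 else (exp x - 1 - x - x\<^sup>2 / 2) / x\<^sup>2)" for x :: real
  have "((\<lambda>x::real. (exp x - 1 - x - x\<^sup>2 / 2) / x\<^sup>2) \<longlongrightarrow> 0) (at 0)" by real_asymp
  then have "(g \<longlongrightarrow> 0) (at 0)"
    by (rule Lim_transform_eventually) (auto simp: g_def eventually_at_filter)
  then have cont: "isCont g 0" by (simp add: isCont_def g_def)
  have "(\<lambda>n. inverse (sqrt (real n))) \<longlonglongrightarrow> 0" by real_asymp
  from tendsto_mult[OF this z] have "(\<lambda>n. inverse (sqrt (real n)) * (sqrt (real n) * z n)) \<longlonglongrightarrow> 0" by simp
  then have "z \<longlonglongrightarrow> 0"
    by (rule Lim_transform_eventually) (use eventually_gt_at_top[of 0] in eventually_elim, simp)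
  then have "(\<lambda>n. g (z n)) \<longlonglongrightarrow> g 0" by (rule isCont_tendsto_compose[OF cont])
  then have "(\<lambda>n. (sqrt (real n) * z n)\<^sup>2 * g (z n)) \<longlonglongrightarrow> l\<^sup>2 * 0"
    by (intro tendsto_intros z) (simp add: g_def)
  moreover have "(sqrt (real n) * z n)\<^sup>2 * g (z n) = real n * (exp (z n) - 1 - z n - (z n)\<^sup>2 / 2)" for n
    by (simp add: g_def power_mult_distrib)
  ultimately show ?thesis by simp
qed

lemma std_score_moments:
  assumes "0 < q" "q < 1"
  shows "q * std_score q True + (1 - q) * std_score q False = 0"
    "q * (std_score q True)\<^sup>2 + (1 - q) * (std_score q False)\<^sup>2 = 1 / (q * (1 - q))"
  using assms by (auto simp: std_score_def power2_eq_square divide_simps)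

text \<open>These are the step moments required by \<open>traj_mean_path_prod_diff\<close>.
  Pointwise the two factors agree to first order, so their difference r is o (n^(-1/2)), which
  settles the last moment. The mixed moment is the mean of r plus the mean of \<delta> m r, and both
  are o (1 / n).\<close>

lemma ratio_gauss_factor_asymptotics:
  fixes q d :: real and q' :: "nat \<Rightarrow> real"
  assumes q: "0 < q" "q < 1" and q': "(\<lambda>n. sqrt (real n) * (q' n - q)) \<longlonglongrightarrow> d"
  defines "a \<equiv> \<lambda>n. ratio q (q' n)" and "b \<equiv> \<lambda>n. gauss_factor q (d / sqrt (real n))"
  shows "(\<lambda>n. real n * (open_mean q (\<lambda>z. (a n z)\<^sup>2) - 1)) \<longlonglongrightarrow> d\<^sup>2 / (q * (1 - q))"
    and "(\<lambda>n. real n * open_mean q (\<lambda>z. a n z * (a n z - b n z))) \<longlonglongrightarrow> 0"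
    and "(\<lambda>n. real n * open_mean q (\<lambda>z. (a n z - b n z)\<^sup>2)) \<longlonglongrightarrow> 0"
proof -
  define m where "m = std_score q"
  define \<sigma> where "\<sigma> = 1 / (q * (1 - q))"
  have mo: "q * m True + (1 - q) * m False = 0" "q * (m True)\<^sup>2 + (1 - q) * (m False)\<^sup>2 = \<sigma>"
    using std_score_moments[OF q] by (auto simp: m_def \<sigma>_def)
  define \<alpha> where "\<alpha> n = d / sqrt (real n)" for n
  define \<delta> where "\<delta> n = q' n - q" for n
  define z where "z n y = \<alpha> n * m y - (\<alpha> n)\<^sup>2 * \<sigma> / 2" for n y
  define r where "r n y = 1 + \<delta> n * m y - exp (z n y)" for n y
  let ?s = "\<lambda>n. sqrt (real n)"
  define R where "R n y = exp (z n y) - 1 - z n y - (z n y)\<^sup>2 / 2" for n y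
  have a: "a n (True, y) = 1 + \<delta> n * m y" for n y by (simp add: a_def ratio_def \<delta>_def m_def)
  have ab: "a n (True, y) - b n (True, y) = r n y" for n y
    by (simp add: a_def ratio_def \<delta>_def m_def r_def b_def gauss_factor_def z_def \<alpha>_def \<sigma>_def)
  have \<delta>: "(\<lambda>n. ?s n * \<delta> n) \<longlonglongrightarrow> d" using q' by (simp add: \<delta>_def)
  have \<alpha>: "(\<lambda>n. ?s n * \<alpha> n) \<longlonglongrightarrow> d"
    by (rule Lim_transform_eventually[OF tendsto_const])
       (use eventually_gt_at_top[of 0] in eventually_elim, simp add: \<alpha>_def)
  have inv: "(\<lambda>n. inverse (?s n)) \<longlonglongrightarrow> 0" by real_asymp
  have n\<alpha>2: "(\<lambda>n. ?s n * (\<alpha> n)\<^sup>2) \<longlonglongrightarrow> 0"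
  proof -
    have "(\<lambda>n. inverse (?s n) * (?s n * \<alpha> n)\<^sup>2) \<longlonglongrightarrow> 0 * d\<^sup>2"
      by (intro tendsto_intros inv \<alpha>)
    moreover have "inverse (?s n) * (?s n * \<alpha> n)\<^sup>2 = ?s n * (\<alpha> n)\<^sup>2" for n
      by (cases "n = 0") (auto simp: power2_eq_square field_simps)
    ultimately show ?thesis by simp
  qed
  have z: "(\<lambda>n. ?s n * z n y) \<longlonglongrightarrow> d * m y" for y
  proof -
    have "(\<lambda>n. (?s n * \<alpha> n) * m y - (?s n * (\<alpha> n)\<^sup>2) * \<sigma> / 2) \<longlonglongrightarrow> d * m y - 0 * \<sigma> / 2"
      by (intro tendsto_intros \<alpha> n\<alpha>2) auto
    then show ?thesis by (simp add: z_def algebra_simps)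
  qed
  have R: "(\<lambda>n. real n * R n y) \<longlonglongrightarrow> 0" for y
    unfolding R_def by (rule exp_second_order_remainder[OF z])
  have r: "(\<lambda>n. ?s n * r n y) \<longlonglongrightarrow> 0" for y
  proof -
    have "(\<lambda>n. (?s n * \<delta> n) * m y - ?s n * z n y
        - inverse (?s n) * (?s n * z n y)\<^sup>2 / 2 - inverse (?s n) * (real n * R n y))
      \<longlonglongrightarrow> d * m y - d * m y - 0 * (d * m y)\<^sup>2 / 2 - 0 * 0"
      by (intro tendsto_intros \<delta> z R inv) auto
    moreover have "(?s n * \<delta> n) * m y - ?s n * z n y
        - inverse (?s n) * (?s n * z n y)\<^sup>2 / 2 - inverse (?s n) * (real n * R n y)
      = ?s n * r n y" for n
    proof (cases "n = 0")
      case False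
      define s where "s = ?s n"
      have s: "s \<noteq> 0" "real n = s * s" using False by (auto simp: s_def)
      show ?thesis unfolding s_def[symmetric] s(2) using s(1)
        by (simp add: r_def R_def power2_eq_square field_simps)
    qed simp
    ultimately show ?thesis by simp
  qed
  \<comment> \<open>The mean of r is much smaller than r: linear terms in the score have mean zero,
    and the compensator - \<alpha>^2 \<sigma> / 2 in z cancels the main part of the mean of z^2 / 2.
    What is left is - \<alpha>^4 \<sigma>^2 / 8 and the exponential remainder.\<close>
  have Er: "(\<lambda>n. real n * (q * r n True + (1 - q) * r n False)) \<longlonglongrightarrow> 0"
  proof -
    have "(\<lambda>n. - ((?s n * (\<alpha> n)\<^sup>2)\<^sup>2 * \<sigma>\<^sup>2 / 8) - (q * (real n * R n True) + (1 - q) * (real n * R n False)))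
        \<longlonglongrightarrow> - (0\<^sup>2 * \<sigma>\<^sup>2 / 8) - (q * 0 + (1 - q) * 0)"
      by (intro tendsto_intros n\<alpha>2 R) auto
    moreover have "- ((?s n * (\<alpha> n)\<^sup>2)\<^sup>2 * \<sigma>\<^sup>2 / 8) - (q * (real n * R n True) + (1 - q) * (real n * R n False))
        = real n * (q * r n True + (1 - q) * r n False)" for n
    proof -
      have "q * r n True + (1 - q) * r n False =
          \<delta> n * (q * m True + (1 - q) * m False) - (q * z n True + (1 - q) * z n False)
          - (q * (z n True)\<^sup>2 + (1 - q) * (z n False)\<^sup>2) / 2 - (q * R n True + (1 - q) * R n False)"
        by (simp add: r_def R_def field_simps)
      moreover have "q * z n True + (1 - q) * z n False =
          \<alpha> n * (q * m True + (1 - q) * m False) - (\<alpha> n)\<^sup>2 * \<sigma> / 2"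
        by (simp add: z_def field_simps)
      moreover have "q * (z n True)\<^sup>2 + (1 - q) * (z n False)\<^sup>2 =
          (\<alpha> n)\<^sup>2 * (q * (m True)\<^sup>2 + (1 - q) * (m False)\<^sup>2)
          - (\<alpha> n)^3 * \<sigma> * (q * m True + (1 - q) * m False) + (\<alpha> n)^4 * \<sigma>\<^sup>2 / 4"
        by (simp add: z_def power2_eq_square power3_eq_cube power4_eq_xxxx field_simps)
      ultimately have e: "q * r n True + (1 - q) * r n False =
          - ((\<alpha> n)^4 * \<sigma>\<^sup>2 / 8) - (q * R n True + (1 - q) * R n False)"
        unfolding mo by (simp add: field_simps)
      show ?thesis
        unfolding e by (simp add: power_mult_distrib algebra_simps flip: power_mult)
    qed
    ultimately show ?thesis by simp
  qed
  have "(\<lambda>n. (?s n * \<delta> n)\<^sup>2 * \<sigma>) \<longlonglongrightarrow> d\<^sup>2 * \<sigma>" by (intro tendsto_intros \<delta>)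
  moreover have "(?s n * \<delta> n)\<^sup>2 * \<sigma> = real n * (open_mean q (\<lambda>z. (a n z)\<^sup>2) - 1)" for n
  proof -
    have "open_mean q (\<lambda>z. (a n z)\<^sup>2) - 1 = 2 * \<delta> n * (q * m True + (1 - q) * m False)
        + (\<delta> n)\<^sup>2 * (q * (m True)\<^sup>2 + (1 - q) * (m False)\<^sup>2)"
      unfolding open_mean_def a by (simp add: power2_eq_square algebra_simps)
    then show ?thesis unfolding mo by (simp add: power_mult_distrib)
  qed
  ultimately show "(\<lambda>n. real n * (open_mean q (\<lambda>z. (a n z)\<^sup>2) - 1)) \<longlonglongrightarrow> d\<^sup>2 / (q * (1 - q))"
    by (simp add: \<sigma>_def)
  have "(\<lambda>n. real n * (q * r n True + (1 - q) * r n False)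
      + q * (?s n * \<delta> n * m True * (?s n * r n True))
      + (1 - q) * (?s n * \<delta> n * m False * (?s n * r n False))) \<longlonglongrightarrow>
      0 + q * (d * m True * 0) + (1 - q) * (d * m False * 0)"
    by (intro tendsto_intros Er \<delta> r)
  moreover have "real n * (q * r n True + (1 - q) * r n False)
      + q * (?s n * \<delta> n * m True * (?s n * r n True))
      + (1 - q) * (?s n * \<delta> n * m False * (?s n * r n False))
    = real n * open_mean q (\<lambda>z. a n z * (a n z - b n z))" for n
  proof -
    have e: "open_mean q (\<lambda>z. a n z * (a n z - b n z)) =
        q * ((1 + \<delta> n * m True) * r n True) + (1 - q) * ((1 + \<delta> n * m False) * r n False)"
      unfolding open_mean_def ab by (simp only: a)
    have nn: "?s n * \<delta> n * m y * (?s n * r n y) = real n * (\<delta> n * m y * r n y)" for y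
    proof -
      have "?s n * \<delta> n * m y * (?s n * r n y) = (?s n * ?s n) * (\<delta> n * m y * r n y)"
        by (simp only: mult_ac)
      then show ?thesis by simp
    qed
    show ?thesis unfolding e nn by (simp add: algebra_simps)
  qed
  ultimately show "(\<lambda>n. real n * open_mean q (\<lambda>z. a n z * (a n z - b n z))) \<longlonglongrightarrow> 0" by simp
  have "(\<lambda>n. q * (?s n * r n True)\<^sup>2 + (1 - q) * (?s n * r n False)\<^sup>2) \<longlonglongrightarrow> q * 0\<^sup>2 + (1 - q) * 0\<^sup>2"
    by (intro tendsto_intros r)
  moreover have "q * (?s n * r n True)\<^sup>2 + (1 - q) * (?s n * r n False)\<^sup>2
    = real n * open_mean q (\<lambda>z. (a n z - b n z)\<^sup>2)" for n
    unfolding open_mean_def ab by (simp add: power_mult_distrib algebra_simps)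
  ultimately show "(\<lambda>n. real n * open_mean q (\<lambda>z. (a n z - b n z)\<^sup>2)) \<longlonglongrightarrow> 0" by simp
qed

text \<open>Each step error is o (1 / n), uniformly over time because only K phases occur, so n
  steps add up to o (1) while the growth factor (1 + const / n)^n stays bounded.\<close>

lemma path_prod_ratio_gauss_factor:
  fixes q :: "nat \<Rightarrow> real" and q' :: "nat \<Rightarrow> nat \<Rightarrow> real"
  assumes \<kappa>: "\<And>t x. \<kappa> t x \<in> {0..1}" and q: "\<And>t. 0 < q t \<and> q t < 1" and K: "K > 0"
    and per: "\<And>t. q t = q (t mod K)" "\<And>n t. q' n t = q' n (t mod K)" "\<And>t. d t = d (t mod K)"
    and q': "\<And>t. (\<lambda>n. sqrt (real n) * (q' n t - q t)) \<longlonglongrightarrow> d t"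
  shows "(\<lambda>n. traj_mean \<kappa> q n (\<lambda>x. (path_prod (\<lambda>t. ratio (q t) (q' n t)) x -
    path_prod (\<lambda>t. gauss_factor (q t) (d t / sqrt (real n))) x)\<^sup>2)) \<longlonglongrightarrow> 0"
proof -
  define a where "a n t = ratio (q t) (q' n t)" for n t
  define b where "b n t = gauss_factor (q t) (d t / sqrt (real n))" for n t
  have per': "a n t = a n (t mod K)" "b n t = b n (t mod K)" for n t
    using per(1)[of t] per(2)[of n t] per(3)[of t] by (simp_all add: a_def b_def)
  define A where "A n t = real n * (open_mean (q t) (\<lambda>z. (a n t z)\<^sup>2) - 1)" for n t
  define B where "B n t = real n * open_mean (q t) (\<lambda>z. a n t z * (a n t z - b n t z))" for n t
  define C where "C n t = real n * open_mean (q t) (\<lambda>z. (a n t z - b n t z)\<^sup>2)" for n t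
  have lim: "(\<lambda>n. A n t) \<longlonglongrightarrow> (d t)\<^sup>2 / (q t * (1 - q t))" "(\<lambda>n. B n t) \<longlonglongrightarrow> 0" "(\<lambda>n. C n t) \<longlonglongrightarrow> 0" for t
    using ratio_gauss_factor_asymptotics[OF _ _ q'[of t]] q[of t]
    unfolding A_def B_def C_def a_def b_def by auto
  \<comment> \<open>The sum over the K phases bounds the error at every time, by
    periodicity.\<close>
  define e where "e n = (\<Sum>t<K. \<bar>B n t\<bar> + \<bar>C n t\<bar>)" for n
  \<comment> \<open>The summand \<open>3 * e n\<close> pays for the second moment of b, through b^2
    = a^2 - 2 a (a - b) + (a - b)^2.\<close>
  define h where "h n = (\<Sum>t<K. \<bar>A n t\<bar>) + 3 * e n" for n
  define H where "H = (\<Sum>t<K. \<bar>(d t)\<^sup>2 / (q t * (1 - q t))\<bar>)"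
  have "e \<longlonglongrightarrow> (\<Sum>t<K. \<bar>0\<bar> + \<bar>0\<bar>)" unfolding e_def by (intro tendsto_intros lim)
  then have e: "e \<longlonglongrightarrow> 0" by simp
  have "h \<longlonglongrightarrow> H + 3 * 0" unfolding h_def H_def by (intro tendsto_intros lim e)
  then have h: "h \<longlonglongrightarrow> H" by simp
  have "(\<lambda>n. 2 * e n * exp (h n + e n)) \<longlonglongrightarrow> 2 * 0 * exp (H + 0)" by (intro tendsto_intros e h)
  then have bound: "(\<lambda>n. 2 * e n * exp (h n + e n)) \<longlonglongrightarrow> 0" by simp
  have ez: "e n \<ge> 0" for n by (auto simp: e_def intro: sum_nonneg)
  have le: "\<bar>A n t\<bar> + 3 * e n \<le> h n" "\<bar>B n t\<bar> \<le> e n" "\<bar>C n t\<bar> \<le> e n" for n t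
  proof -
    have m: "t mod K < K" using K by simp
    have pe: "A n t = A n (t mod K)" "B n t = B n (t mod K)" "C n t = C n (t mod K)"
      using per(1)[of t] per'[of n t] by (simp_all add: A_def B_def C_def)
    show "\<bar>A n t\<bar> + 3 * e n \<le> h n"
      unfolding h_def pe using member_le_sum[of "t mod K" "{..<K}" "\<lambda>t. \<bar>A n t\<bar>"] m by simp
    have "\<bar>B n (t mod K)\<bar> + \<bar>C n (t mod K)\<bar> \<le> e n"
      unfolding e_def using member_le_sum[of "t mod K" "{..<K}" "\<lambda>t. \<bar>B n t\<bar> + \<bar>C n t\<bar>"] m by simp
    then show "\<bar>B n t\<bar> \<le> e n" "\<bar>C n t\<bar> \<le> e n" unfolding pe by auto
  qed
  have main: "traj_mean \<kappa> q n (\<lambda>x. (path_prod (a n) x - path_prod (b n) x)\<^sup>2) \<le> 2 * e n * exp (h n + e n)"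
    if n: "n > 0" for n
  proof -
    let ?\<eta> = "h n / n" and ?\<epsilon> = "e n / n"
    have hz: "h n \<ge> 0" using le(1)[of n 0] ez[of n] by linarith
    have "traj_mean \<kappa> q n (\<lambda>x. (path_prod (a n) x - path_prod (b n) x)\<^sup>2) \<le> 2 * ?\<epsilon> * real n * (1 + ?\<eta> + ?\<epsilon>) ^ n"
    proof (rule traj_mean_path_prod_diff[OF \<kappa>])
      fix t
      show "q t \<in> {0..1}" using q[of t] by auto
      show "a n t (False, False) = 1" "b n t (False, False) = 1"
        by (simp_all add: a_def b_def ratio_def gauss_factor_def)
      show a2: "open_mean (q t) (\<lambda>z. (a n t z)\<^sup>2) \<le> 1 + ?\<eta>"
      proof -
        have "A n t \<le> h n" using le(1)[of n t] ez[of n] by linarith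
        then show ?thesis using n by (simp add: A_def field_simps)
      qed
      show ar: "\<bar>open_mean (q t) (\<lambda>z. a n t z * (a n t z - b n t z))\<bar> \<le> ?\<epsilon>"
        using le(2)[of n t] n by (simp add: B_def abs_mult field_simps)
      show r2: "open_mean (q t) (\<lambda>z. (a n t z - b n t z)\<^sup>2) \<le> ?\<epsilon>"
        using le(3)[of n t] n abs_ge_self[of "C n t"] by (simp add: C_def field_simps)
      have "open_mean (q t) (\<lambda>z. (b n t z)\<^sup>2) = open_mean (q t) (\<lambda>z. (a n t z)\<^sup>2)
          - 2 * open_mean (q t) (\<lambda>z. a n t z * (a n t z - b n t z)) + open_mean (q t) (\<lambda>z. (a n t z - b n t z)\<^sup>2)"
        unfolding open_mean_def by (simp add: power2_eq_square algebra_simps)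
      also have "\<dots> \<le> (1 + A n t / n) + 2 * ?\<epsilon> + ?\<epsilon>"
        using ar r2 n by (intro add_mono) (auto simp: A_def)
      also have "\<dots> \<le> 1 + ?\<eta>"
      proof -
        have "A n t + 3 * e n \<le> h n" using le(1)[of n t] by linarith
        then show ?thesis using divide_right_mono[of "A n t + 3 * e n" "h n" "real n"] by (simp add: add_divide_distrib)
      qed
      finally show "open_mean (q t) (\<lambda>z. (b n t z)\<^sup>2) \<le> 1 + ?\<eta>" .
    qed (use hz ez in auto)
    also have "\<dots> = 2 * e n * (1 + (h n + e n) / n) ^ n" using n by (simp add: add_divide_distrib add.assoc)
    also have "\<dots> \<le> 2 * e n * exp (h n + e n)"
      using exp_ge_one_plus_x_over_n_power_n[of n "h n + e n"] n hz ez[of n]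
      by (intro mult_left_mono) auto
    finally show ?thesis .
  qed
  show ?thesis
    unfolding a_def[symmetric] b_def[symmetric]
  proof (rule tendsto_sandwich[OF _ _ tendsto_const bound])
    show "\<forall>\<^sub>F n in sequentially. 0 \<le> traj_mean \<kappa> q n (\<lambda>x. (path_prod (a n) x - path_prod (b n) x)\<^sup>2)"
      by (auto intro!: always_eventually integral_nonneg_AE)
    show "\<forall>\<^sub>F n in sequentially. traj_mean \<kappa> q n (\<lambda>x. (path_prod (a n) x - path_prod (b n) x)\<^sup>2) \<le> 2 * e n * exp (h n + e n)"
      using eventually_gt_at_top[of 0] by eventually_elim (rule main)
  qed
qed

section \<open>Score, information and the limiting likelihood\<close>

definition score :: "(nat \<Rightarrow> real) \<Rightarrow> (nat \<Rightarrow> real) \<Rightarrow> (bool \<times> bool) list \<Rightarrow> real" where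
  "score q v x = (\<Sum>t<length x. if fst (x ! t) then v t * std_score (q t) (snd (x ! t)) else 0)"

text \<open>The conditional variances of the score summed over the open gates. It is still random,
  because the gates are.\<close>

definition info :: "(nat \<Rightarrow> real) \<Rightarrow> (nat \<Rightarrow> real) \<Rightarrow> (bool \<times> bool) list \<Rightarrow> real" where
  "info q v x = (\<Sum>t<length x. if fst (x ! t) then (v t)\<^sup>2 / (q t * (1 - q t)) else 0)"

lemma path_prod_gauss_factor:
  "path_prod (\<lambda>t. gauss_factor (q t) (d t / sqrt (real n))) x =
    exp (score q d x / sqrt (real n) - info q d x / real n / 2)"
proof -
  have "score q d x / sqrt (real n) - info q d x / real n / 2 = (\<Sum>t<length x. if fst (x ! t) then
      d t / sqrt (real n) * std_score (q t) (snd (x ! t)) - (d t / sqrt (real n))\<^sup>2 / (q t * (1 - q t)) / 2 else 0)"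
    unfolding score_def info_def sum_divide_distrib sum_subtractf[symmetric]
    by (intro sum.cong refl) (simp add: power_divide)
  then show ?thesis
    by (simp add: path_prod_def exp_sum gauss_factor_def if_distrib[of exp] cong: if_cong)
qed

text \<open>A bounded centred step of size n^(-1/2) has exponential moment at most 1 + X / n, so the
  product over n steps is at most exp X. The bound does not depend on n, and it is locally bounded
  in s.\<close>

lemma traj_mean_exp_score:
  assumes \<kappa>: "\<And>t x. \<kappa> t x \<in> {0..1}" and q: "\<And>t. 0 < q t \<and> q t < 1"
    and M: "\<And>t y. \<bar>v t * std_score (q t) y\<bar> \<le> M"
  shows "traj_mean \<kappa> q n (\<lambda>x. exp (s * (score q v x / sqrt (real n)))) \<le> exp ((s * M)\<^sup>2 * exp (\<bar>s * M\<bar>))"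
proof (cases "n = 0")
  case True then show ?thesis by (simp add: score_def)
next
  case n: False
  \<comment> \<open>From the second-order Taylor remainder: each exponent is at most \<bar>s M\<bar>
    in absolute value, and its square is at most (s M)^2 / n.\<close>
  define X where "X = (s * M)\<^sup>2 * exp (\<bar>s * M\<bar>)"
  have X: "X \<ge> 0" by (simp add: X_def)
  have M0: "M \<ge> 0" using M[of 0 True] by linarith
  define b where "b t z = (if fst z then exp (s * (v t * std_score (q t) (snd z)) / sqrt (real n)) else 1)"
    for t and z :: "bool \<times> bool"
  have "exp (s * (score q v x / sqrt (real n))) = path_prod b x" for x
    unfolding score_def path_prod_def b_def
    by (simp add: sum_divide_distrib sum_distrib_left exp_sum if_distrib[of exp] if_distrib[of "\<lambda>a. a / _"] if_distrib[of "\<lambda>a. _ * a"] cong: if_cong)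
  moreover have "traj_mean \<kappa> q n (path_prod b) \<le> (1 + X / n) ^ n"
  proof (rule traj_mean_path_prod_le[OF \<kappa>])
    fix t
    show "q t \<in> {0..1}" using q[of t] by auto
    define \<zeta> where "\<zeta> y = s * (v t * std_score (q t) y) / sqrt (real n)" for y
    have e: "exp (\<zeta> y) \<le> 1 + \<zeta> y + X / n" for y
    proof -
      have 1: "\<bar>s * (v t * std_score (q t) y)\<bar> \<le> \<bar>s * M\<bar>"
        using M[of t y] M0 by (simp add: abs_mult mult_left_mono)
      have "\<bar>\<zeta> y\<bar> \<le> \<bar>s * (v t * std_score (q t) y)\<bar>"
        unfolding \<zeta>_def using n by (simp add: abs_divide divide_le_eq mult_le_cancel_left1)
      with 1 have z1: "\<bar>\<zeta> y\<bar> \<le> \<bar>s * M\<bar>" by linarith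
      have z2: "(\<zeta> y)\<^sup>2 \<le> (s * M)\<^sup>2 / n"
        using power_mono[OF 1, of 2] n by (simp add: \<zeta>_def power_divide divide_right_mono)
      obtain u where u: "\<bar>u\<bar> \<le> \<bar>\<zeta> y\<bar>" "exp (\<zeta> y) = (\<Sum>m<2. (\<zeta> y) ^ m / fact m) + exp u / fact 2 * (\<zeta> y) ^ 2"
        using Maclaurin_exp_le by blast
      have "exp (\<zeta> y) = 1 + \<zeta> y + exp u / 2 * (\<zeta> y)\<^sup>2" using u(2) by (simp add: numeral_2_eq_2)
      moreover have "exp u / 2 * (\<zeta> y)\<^sup>2 \<le> exp \<bar>s * M\<bar> * ((s * M)\<^sup>2 / n)"
      proof (intro mult_mono z2)
        have "exp u \<le> exp \<bar>s * M\<bar>" using u(1) z1 by simp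
        then show "exp u / 2 \<le> exp \<bar>s * M\<bar>" using exp_ge_zero[of u] by linarith
      qed auto
      ultimately show ?thesis by (simp add: X_def mult.commute)
    qed
    have "open_mean (q t) (b t) = q t * exp (\<zeta> True) + (1 - q t) * exp (\<zeta> False)"
      by (simp add: open_mean_def b_def \<zeta>_def)
    also have "\<dots> \<le> q t * (1 + \<zeta> True + X / n) + (1 - q t) * (1 + \<zeta> False + X / n)"
      using q[of t] e by (intro add_mono mult_left_mono) auto
    also have "\<dots> = 1 + X / n + s * v t / sqrt n * (q t * std_score (q t) True + (1 - q t) * std_score (q t) False)"
      unfolding \<zeta>_def by algebra
    also have "\<dots> = 1 + X / n" using std_score_moments(1)[of "q t"] q[of t] by simp
    finally show "open_mean (q t) (b t) \<le> 1 + X / n" .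
  qed (use X in \<open>auto simp: b_def\<close>)
  moreover have "(1 + X / n) ^ n \<le> exp X"
    using exp_ge_one_plus_x_over_n_power_n[of n X] n X by auto
  ultimately show ?thesis by (simp add: X_def)
qed

lemma traj_mean_abs_le_sqrt:
  fixes f :: "_ \<Rightarrow> real"
  shows "traj_mean \<kappa> q n (\<lambda>x. \<bar>f x\<bar>) \<le> sqrt (traj_mean \<kappa> q n (\<lambda>x. (f x)\<^sup>2))"
proof -
  have "0 \<le> measure_pmf.variance (traj \<kappa> q n) (\<lambda>x. \<bar>f x\<bar>)" by (rule measure_pmf.variance_positive)
  also have "\<dots> = traj_mean \<kappa> q n (\<lambda>x. (f x)\<^sup>2) - (traj_mean \<kappa> q n (\<lambda>x. \<bar>f x\<bar>))\<^sup>2"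
    by (subst measure_pmf.variance_eq) auto
  finally show ?thesis by (simp add: real_le_rsqrt)
qed

text \<open>On nonnegative arguments the difference has absolute value at most 1, so its square is
  at most that value, and exp (- x) is 1-Lipschitz. The first power on the right fits
  \<open>info\<close>, which is controlled only in mean absolute value.\<close>

lemma exp_minus_diff_le:
  fixes x y :: real
  assumes "0 \<le> x" "0 \<le> y"
  shows "(exp (- x) - exp (- y))\<^sup>2 \<le> \<bar>x - y\<bar>"
proof -
  have aux: "(exp (- x) - exp (- y))\<^sup>2 \<le> y - x" if "0 \<le> x" "x \<le> y" for x y :: real
  proof -
    have "exp (- x) - exp (- y) = exp (- x) * (1 - exp (x - y))"
      by (simp add: algebra_simps flip: exp_add)
    also have "\<dots> \<le> 1 * (y - x)"
    proof (rule mult_mono)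
      show "1 - exp (x - y) \<le> y - x" using exp_ge_add_one_self[of "x - y"] by linarith
    qed (use that in auto)
    finally have 1: "exp (- x) - exp (- y) \<le> y - x" by simp
    have "exp (- x) \<le> 1" "exp (- y) \<le> exp (- x)" using that by auto
    then have 2: "0 \<le> exp (- x) - exp (- y)" "exp (- x) - exp (- y) \<le> 1"
      using exp_ge_zero[of "- y"] by linarith+
    have "(exp (- x) - exp (- y))\<^sup>2 \<le> 1 * (exp (- x) - exp (- y))"
      unfolding power2_eq_square using 2 by (intro mult_right_mono) auto
    then show ?thesis using 1 by simp
  qed
  show ?thesis
    using aux[of x y] aux[of y x] assms by (cases "x \<le> y") (auto simp: power2_commute)
qed

text \<open>As \<open>f\<close> is bounded by 1, it suffices to compare the densities in L1. The
  exact ratio A is first replaced by B, in L2; then B by E, in which the random information is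
  replaced by its limit c.\<close>

lemma traj_mean_likelihood_limit:
  fixes q :: "nat \<Rightarrow> real" and q' :: "nat \<Rightarrow> nat \<Rightarrow> real" and f :: "nat \<Rightarrow> (bool \<times> bool) list \<Rightarrow> complex"
  assumes \<kappa>: "\<And>t x. \<kappa> t x \<in> {0..1}" and q: "\<And>t. 0 < q t \<and> q t < 1" and K: "K > 0"
    and per: "\<And>t. q t = q (t mod K)" "\<And>n t. q' n t = q' n (t mod K)" "\<And>t. d t = d (t mod K)"
    and q': "\<And>t. (\<lambda>n. sqrt (real n) * (q' n t - q t)) \<longlonglongrightarrow> d t"
    and q'01: "\<forall>\<^sub>F n in sequentially. \<forall>t. q' n t \<in> {0..1}"
    and M: "\<And>t y. \<bar>d t * std_score (q t) y\<bar> \<le> M"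
    and c: "0 \<le> c" "(\<lambda>n. traj_mean \<kappa> q n (\<lambda>x. \<bar>info q d x / real n - c\<bar>)) \<longlonglongrightarrow> 0"
    and f: "\<And>n x. norm (f n x) \<le> 1"
  shows "(\<lambda>n. traj_mean \<kappa> (q' n) n (f n) -
     traj_mean \<kappa> q n (\<lambda>x. of_real (exp (score q d x / sqrt (real n) - c / 2)) * f n x)) \<longlonglongrightarrow> 0"
proof -
  define A where "A n = path_prod (\<lambda>t. ratio (q t) (q' n t))" for n
  define B where "B n x = exp (score q d x / sqrt (real n) - info q d x / real n / 2)" for n x
  define E where "E n x = exp (score q d x / sqrt (real n) - c / 2)" for n x
  let ?s = "\<lambda>n x. score q d x / sqrt (real n)" and ?v = "\<lambda>n x. info q d x / real n"
  let ?AB = "\<lambda>n. traj_mean \<kappa> q n (\<lambda>x. (A n x - B n x)\<^sup>2)"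
  let ?BE = "\<lambda>n. traj_mean \<kappa> q n (\<lambda>x. \<bar>B n x - E n x\<bar>)"
  have "(\<lambda>n. ?AB n) \<longlonglongrightarrow> 0"
    using path_prod_ratio_gauss_factor[where \<kappa>=\<kappa> and q=q and K=K and q'=q' and d=d, OF \<kappa> q K per q'] by (simp add: A_def B_def path_prod_gauss_factor)
  from tendsto_real_sqrt[OF this]
  have lim1: "(\<lambda>n. sqrt (?AB n)) \<longlonglongrightarrow> 0" by simp
  define e where "e n = traj_mean \<kappa> q n (\<lambda>x. \<bar>?v n x - c\<bar>)" for n
  have e: "e \<longlonglongrightarrow> 0" and e0: "e n \<ge> 0" for n
    using c(2) by (auto simp: e_def[abs_def] intro!: integral_nonneg_AE)
  define C where "C = exp ((2 * M)\<^sup>2 * exp (\<bar>2 * M\<bar>))"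
  have le2: "?BE n \<le> (sqrt (e n) + 1 / real (Suc n)) * C + sqrt (e n)" for n
  proof -
    \<comment> \<open>The choice of order sqrt (e n) balances the two terms of the bound below; the
      second summand only keeps \<eta> positive.\<close>
    define \<eta> where "\<eta> = sqrt (e n) + 1 / real (Suc n)"
    have \<eta>: "\<eta> > 0" using e0[of n] by (auto simp: \<eta>_def intro: add_nonneg_pos)
    \<comment> \<open>B - E = u w, with u the exponential of the score and w the difference of the
      information terms. The weighted inequality \<bar>u w\<bar> <= \<eta> u^2 + w^2 / \<eta>
      separates a factor with bounded second moment from one whose second moment tends to 0.\<close>
    have pw: "\<bar>B n x - E n x\<bar> \<le> \<eta> * exp (2 * (?s n x)) + \<bar>?v n x - c\<bar> / \<eta>" for x
    proof -
      define u where "u = exp (?s n x)"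
      define V where "V = ?v n x"
      have V: "V \<ge> 0"
        unfolding V_def info_def by (intro divide_nonneg_nonneg sum_nonneg) (auto simp: q less_imp_le)
      define w where "w = exp (- (V / 2)) - exp (- (c / 2))"
      have "w\<^sup>2 \<le> \<bar>V / 2 - c / 2\<bar>" unfolding w_def by (rule exp_minus_diff_le) (use V c in auto)
      then have w2: "w\<^sup>2 \<le> \<bar>V - c\<bar>" by linarith
      have "B n x - E n x = u * w"
        unfolding B_def E_def u_def w_def V_def right_diff_distrib exp_add[symmetric] by simp
      moreover have "\<bar>u * w\<bar> \<le> \<eta> * u\<^sup>2 + w\<^sup>2 / \<eta>"
      proof -
        have "0 \<le> (\<eta> * \<bar>u\<bar> - \<bar>w\<bar>)\<^sup>2" by simp
        then have "2 * (\<eta> * \<bar>u\<bar> * \<bar>w\<bar>) \<le> \<eta>\<^sup>2 * u\<^sup>2 + w\<^sup>2"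
          by (simp add: power2_diff power_mult_distrib)
        moreover have "0 \<le> \<eta> * (\<bar>u\<bar> * \<bar>w\<bar>)" using \<eta> by simp
        ultimately have "\<eta> * (\<bar>u\<bar> * \<bar>w\<bar>) \<le> \<eta>\<^sup>2 * u\<^sup>2 + w\<^sup>2"
          unfolding mult.assoc by linarith
        then show ?thesis using \<eta> by (simp add: abs_mult field_simps power2_eq_square)
      qed
      moreover have "u\<^sup>2 = exp (2 * (?s n x))"
        unfolding u_def by (rule exp_double[symmetric])
      moreover have "w\<^sup>2 / \<eta> \<le> \<bar>V - c\<bar> / \<eta>" using w2 \<eta> by (simp add: divide_right_mono)
      ultimately show ?thesis by (simp add: V_def)
    qed
    have "?BE n \<le> traj_mean \<kappa> q n (\<lambda>x. \<eta> * exp (2 * (?s n x)) + \<bar>?v n x - c\<bar> / \<eta>)"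
      by (rule traj_mean_mono) (rule pw)
    also have "\<dots> = \<eta> * traj_mean \<kappa> q n (\<lambda>x. exp (2 * (?s n x))) + e n / \<eta>"
      by (simp add: e_def)
    also have "\<dots> \<le> \<eta> * C + sqrt (e n)"
    proof (intro add_mono mult_left_mono)
      show "traj_mean \<kappa> q n (\<lambda>x. exp (2 * (?s n x))) \<le> C"
        unfolding C_def by (rule traj_mean_exp_score[OF \<kappa> q M])
      have "e n = sqrt (e n) * sqrt (e n)" using e0 by simp
      also have "\<dots> \<le> sqrt (e n) * \<eta>" using e0 by (intro mult_left_mono) (auto simp: \<eta>_def)
      finally show "e n / \<eta> \<le> sqrt (e n)" using \<eta> by (simp add: field_simps)
    qed (use \<eta> in auto)
    finally show ?thesis by (simp add: \<eta>_def)
  qed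
  have "(\<lambda>n. sqrt (?AB n) + ((sqrt (e n) + 1 / real (Suc n)) * C + sqrt (e n)))
      \<longlonglongrightarrow> 0 + ((sqrt 0 + 0) * C + sqrt 0)"
  proof (intro tendsto_intros lim1 e)
    show "(\<lambda>n. 1 / real (Suc n)) \<longlonglongrightarrow> 0" using LIMSEQ_inverse_real_of_nat by (simp add: inverse_eq_divide)
  qed
  then have bound: "(\<lambda>n. sqrt (?AB n) + ((sqrt (e n) + 1 / real (Suc n)) * C + sqrt (e n))) \<longlonglongrightarrow> 0"
    by simp
  show ?thesis
  proof (rule Lim_null_comparison[OF _ bound])
    show "\<forall>\<^sub>F n in sequentially. norm (traj_mean \<kappa> (q' n) n (f n) -
        traj_mean \<kappa> q n (\<lambda>x. of_real (exp (?s n x - c / 2)) * f n x)) \<le>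
        sqrt (?AB n) + ((sqrt (e n) + 1 / real (Suc n)) * C + sqrt (e n))"
      using q'01
    proof eventually_elim
      case (elim n)
      have "traj_mean \<kappa> (q' n) n (f n) = traj_mean \<kappa> q n (\<lambda>x. A n x *\<^sub>R f n x)"
        unfolding A_def by (rule traj_mean_change[OF \<kappa> q]) (use elim in auto)
      then have "traj_mean \<kappa> (q' n) n (f n) - traj_mean \<kappa> q n (\<lambda>x. of_real (E n x) * f n x) =
          traj_mean \<kappa> q n (\<lambda>x. of_real (A n x - E n x) * f n x)"
        by (simp add: scaleR_conv_of_real left_diff_distrib)
      also have "norm \<dots> \<le> traj_mean \<kappa> q n (\<lambda>x. norm (of_real (A n x - E n x) * f n x))"
        by (rule integral_norm_bound)
      also have "\<dots> \<le> traj_mean \<kappa> q n (\<lambda>x. \<bar>A n x - B n x\<bar> + \<bar>B n x - E n x\<bar>)"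
      proof (rule traj_mean_mono)
        fix x
        have "norm (of_real (A n x - E n x) * f n x) \<le> \<bar>A n x - E n x\<bar> * 1"
          unfolding norm_mult norm_of_real by (intro mult_left_mono f) auto
        then show "norm (of_real (A n x - E n x) * f n x) \<le> \<bar>A n x - B n x\<bar> + \<bar>B n x - E n x\<bar>"
          using abs_triangle_ineq[of "A n x - B n x" "B n x - E n x"] by simp
      qed
      also have "\<dots> = traj_mean \<kappa> q n (\<lambda>x. \<bar>A n x - B n x\<bar>) + ?BE n"
        by simp
      also have "\<dots> \<le> sqrt (?AB n) + ((sqrt (e n) + 1 / real (Suc n)) * C + sqrt (e n))"
        by (intro add_mono traj_mean_abs_le_sqrt le2)
      finally show ?case unfolding E_def .
    qed
  qed
qed

section \<open>The law of the observations\<close>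

text \<open>The conditional probability of an open gate after the past \<open>x\<close>, independent
  of the parameter because \<Phi> is. The event is cut down to [0, 1], where measurability of \<Phi>
  is assumed.\<close>

definition gate_prob :: "(nat \<Rightarrow> (bool \<times> bool) list \<Rightarrow> real \<Rightarrow> bool) \<Rightarrow> nat \<Rightarrow> (bool \<times> bool) list \<Rightarrow> real" where
  "gate_prob \<Phi> t x = measure (uniform_measure lborel {0..1}) {u \<in> {0..1}. \<Phi> t x u}"

lemma prob_space_unif: "prob_space (uniform_measure lborel {0..1::real})"
  by (rule prob_space_uniform_measure) auto

lemma gate_prob_bounds: "gate_prob \<Phi> t x \<in> {0..1}"
  using prob_space.prob_le_1[OF prob_space_unif] by (simp add: gate_prob_def)

lemma pmf_traj_snoc:
  assumes \<kappa>: "\<And>t x. \<kappa> t x \<in> {0..1}" and q: "q n \<in> {0..1}"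
  shows "pmf (traj \<kappa> q (Suc n)) (x @ [(g, b)]) = pmf (traj \<kappa> q n) x *
    (if g then \<kappa> n x * (if b then q n else 1 - q n) else if b then 0 else 1 - \<kappa> n x)"
proof -
  have pmf_ind: "pmf (traj \<kappa> q n) y = traj_mean \<kappa> q n (indicat_real {y})" for n y
    by (simp add: measure_pmf_single)
  have "pmf (traj \<kappa> q (Suc n)) (x @ [(g, b)]) = traj_mean \<kappa> q n (\<lambda>y. indicat_real {x} y *
    (if g then \<kappa> n x * (if b then q n else 1 - q n) else if b then 0 else 1 - \<kappa> n x))"
    unfolding pmf_ind traj_mean_Suc[where \<kappa>=\<kappa> and q=q and n=n, OF \<kappa> q]
    by (rule traj_mean_cong) (auto simp: indicator_def)
  then show ?thesis by (simp add: pmf_ind)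
qed

lemma observations_Suc: "observations G Y (Suc t) \<omega> = observations G Y t \<omega> @ [(G t \<omega>, Y t \<omega>)]"
  by (simp add: observations_def)

lemma length_observations [simp]: "length (observations G Y t \<omega>) = t"
  by (simp add: observations_def)

lemma measurable_observations:
  assumes [measurable]: "\<And>t. G t \<in> measurable M (count_space UNIV)" "\<And>t. Y t \<in> measurable M (count_space UNIV)"
  shows "observations G Y t \<in> measurable M (count_space UNIV)"
proof (induction t)
  case 0 then show ?case by (simp add: observations_def)
next
  case (Suc t)
  note Suc [measurable]
  have "(\<lambda>\<omega>. (\<lambda>(x, g, y). x @ [(g, y)]) (observations G Y t \<omega>, G t \<omega>, Y t \<omega>)) \<in> measurable M (count_space UNIV)"
    by (rule measurable_compose[where N="count_space UNIV"])
       (auto simp: measurable_pair_iff pair_measure_countable[symmetric] comp_def intro!: measurable_Pair Suc assms)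
  then show ?case by (simp add: observations_Suc[abs_def])
qed

text \<open>The model under a single parameter value: the latent \<open>Z\<close> belongs to that
  value, whereas \<Phi> is shared by all.\<close>

locale causal_observation = prob_space M for M :: "'w measure" +
  fixes q :: "nat \<Rightarrow> real" and G Y Z :: "nat \<Rightarrow> 'w \<Rightarrow> bool"
    and \<Phi> :: "nat \<Rightarrow> (bool \<times> bool) list \<Rightarrow> real \<Rightarrow> bool"
  assumes q: "\<And>t. q t \<in> {0..1}"
    and G [measurable]: "\<And>t. G t \<in> measurable M (count_space UNIV)"
    and Y [measurable]: "\<And>t. Y t \<in> measurable M (count_space UNIV)"
    and obs: "observation_condition M q G Y Z"
    and caus: "causality_condition M \<Phi> G Y Z"
    and \<Phi>: "\<And>t. case_prod (\<Phi> t) \<in> measurable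
      (count_space {xs. length xs = t} \<Otimes>\<^sub>M restrict_space borel {0..1}) (count_space UNIV)"
begin

lemma Z_meas [measurable]: "Z t \<in> measurable M (count_space UNIV)"
  using obs by (auto simp: observation_condition_def indep_vars_def2)

lemma obs_meas [measurable]: "observations G Y t \<in> measurable M (count_space UNIV)"
  by (rule measurable_observations) auto

lemma Z_prob: "prob {\<omega> \<in> space M. \<forall>s\<in>{t..<t + m}. Z s \<omega> = z s} = (\<Prod>s\<in>{t..<t + m}. pmf (bernoulli_pmf (q s)) (z s))"
proof (cases "m = 0")
  case True then show ?thesis by (simp add: prob_space)
next
  case False
  have ind: "indep_vars (\<lambda>_. count_space UNIV) Z UNIV"
    and d: "\<And>t. distr M (count_space UNIV) (Z t) = measure_pmf (bernoulli_pmf (q t))"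
    using obs by (auto simp: observation_condition_def)
  have single: "prob (Z s -` {z s} \<inter> space M) = pmf (bernoulli_pmf (q s)) (z s)" for s
  proof -
    have "prob (Z s -` {z s} \<inter> space M) = measure (distr M (count_space UNIV) (Z s)) {z s}"
      by (simp add: measure_distr)
    then show ?thesis by (simp add: d measure_pmf_single)
  qed
  have "{\<omega> \<in> space M. \<forall>s\<in>{t..<t + m}. Z s \<omega> = z s} = (\<Inter>s\<in>{t..<t + m}. Z s -` {z s} \<inter> space M)"
    using False by auto
  then show ?thesis
    using indep_varsD[OF ind, of "{t..<t + m}" "\<lambda>s. {z s}"] False by (simp add: single)
qed

text \<open>On \<open>B\<close> the past is frozen at \<open>x\<close>, so the gate is a function of
  U alone, and U is independent of the past together with the whole sequence Z. For this reason
  \<open>B\<close> may also constrain future coins.\<close>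

lemma gate_independent:
  assumes len: "length x = t" and B: "B \<in> sets ((\<Pi>\<^sub>M s\<in>UNIV. count_space UNIV) \<Otimes>\<^sub>M count_space UNIV)"
    and Bx: "\<And>\<zeta> y. (\<zeta>, y) \<in> B \<Longrightarrow> y = x"
  shows "prob {\<omega> \<in> space M. G t \<omega> = g \<and> (\<lambda>s. Z s \<omega>, observations G Y t \<omega>) \<in> B} =
    (if g then gate_prob \<Phi> t x else 1 - gate_prob \<Phi> t x) *
    prob {\<omega> \<in> space M. (\<lambda>s. Z s \<omega>, observations G Y t \<omega>) \<in> B}"
proof -
  let ?V = "\<lambda>\<omega>. (\<lambda>s. Z s \<omega>, observations G Y t \<omega>)"
  let ?U = "uniform_measure lborel {0..1::real}"
  let ?S = "(\<Pi>\<^sub>M s\<in>UNIV. count_space UNIV) \<Otimes>\<^sub>M count_space UNIV"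
  let ?A = "{\<omega> \<in> space M. G t \<omega> = g \<and> ?V \<omega> \<in> B}"
  from caus obtain U :: "'w \<Rightarrow> real" where U: "distr M lborel U = ?U"
    and ind: "indep_set (sets (vimage_algebra (space M) U borel))
       (sets (vimage_algebra (space M) ?V ?S))"
    and GU: "AE \<omega> in M. G t \<omega> = \<Phi> t (observations G Y t \<omega>) (U \<omega>)"
    unfolding causality_condition_def by blast
  have ev: "sets (vimage_algebra (space M) U borel) \<subseteq> events"
    "sets (vimage_algebra (space M) ?V ?S) \<subseteq> events"
    using ind by (auto simp: indep_set_def indep_sets_def split: bool.splits)
  \<comment> \<open>Measurability of U is implicit in the causality condition: the sigma-algebra it
    generates consists of events.\<close>
  have [measurable]: "U \<in> borel_measurable M"
    by (rule measurableI) (use ev(1) in \<open>auto intro!: subsetD[OF ev(1)] in_vimage_algebra\<close>)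
  define S where "S = {u \<in> {0..1}. \<Phi> t x u = g}"
  have sl: "(\<lambda>u. \<Phi> t x u) \<in> measurable (restrict_space borel {0..1}) (count_space UNIV)"
    using measurable_compose[OF measurable_Pair1'[of x "count_space {xs. length xs = t}" "restrict_space borel {0..1}"] \<Phi>[of t]] len
    by simp
  have "(\<lambda>u. \<Phi> t x u) -` {h} \<inter> space (restrict_space borel {0..1}) \<in> sets (restrict_space borel {0..1::real})" for h
    by (rule measurable_sets[OF sl]) simp
  moreover have "(\<lambda>u. \<Phi> t x u) -` {h} \<inter> space (restrict_space borel {0..1}) = {u \<in> {0..1}. \<Phi> t x u = h}" for h
    by (auto simp: space_restrict_space)
  ultimately have Sh: "{u \<in> {0..1}. \<Phi> t x u = h} \<in> sets borel" for h
    by (metis (no_types, lifting) atLeastAtMost_borel sets_restrict_space_iff space_borel Int_UNIV_right)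
  then have [measurable]: "S \<in> sets borel" by (simp add: S_def)
  interpret unif: prob_space "uniform_measure lborel {0..1::real}" by (rule prob_space_unif)
  have pS: "prob (U -` S \<inter> space M) = (if g then gate_prob \<Phi> t x else 1 - gate_prob \<Phi> t x)"
  proof -
    have "prob (U -` S \<inter> space M) = measure (distr M lborel U) S" by (simp add: measure_distr)
    also have "\<dots> = measure (?U) S" by (simp add: U)
    also have "\<dots> = (if g then gate_prob \<Phi> t x else 1 - gate_prob \<Phi> t x)"
    proof (cases g)
      case True then show ?thesis by (simp add: S_def gate_prob_def)
    next
      case False
      let ?T = "{u \<in> {0..1}. \<Phi> t x u}"
      have T: "?T \<in> sets borel" using Sh[of True] by simp
      have "emeasure (?U) S = emeasure (?U) (UNIV - ?T)"
      proof -
        have "{0..1} \<inter> S = {0..1} \<inter> (UNIV - ?T)" by (auto simp: S_def False)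
        moreover have "S \<in> sets lborel" "UNIV - ?T \<in> sets lborel" using T by auto
        ultimately show ?thesis by (simp only: emeasure_uniform_measure sets_lborel atLeastAtMost_borel)
      qed
      then have "measure (?U) S = measure (?U) (UNIV - ?T)"
        by (simp add: measure_def)
      also have "\<dots> = 1 - measure (?U) ?T"
        using unif.prob_compl[of ?T] T by simp
      finally show ?thesis using False by (simp add: gate_prob_def)
    qed
    finally show ?thesis .
  qed
  have U01: "AE \<omega> in M. U \<omega> \<in> {0..1}"
  proof -
    have "prob (U -` {0..1} \<inter> space M) = measure (distr M lborel U) {0..1}" by (simp add: measure_distr)
    also have "\<dots> = 1" by (simp add: U measure_def)
    finally have "prob {\<omega> \<in> space M. U \<omega> \<in> {0..1}} = 1" by (simp add: vimage_def Int_def conj_commute)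
    then show ?thesis by (subst (asm) prob_Collect_eq_1) auto
  qed
  have VB: "?V -` B \<inter> space M \<in> sets (vimage_algebra (space M) ?V ?S)"
    by (rule in_vimage_algebra[OF B])
  have VBe: "?V -` B \<inter> space M \<in> events" using VB ev(2) by blast
  have eq: "?A = {\<omega> \<in> space M. G t \<omega> = g} \<inter> (?V -` B \<inter> space M)" by auto
  have "prob ?A = prob ((U -` S \<inter> space M) \<inter> (?V -` B \<inter> space M))"
  proof (rule finite_measure_eq_AE)
    show "AE \<omega> in M. \<omega> \<in> ?A \<longleftrightarrow> \<omega> \<in> (U -` S \<inter> space M) \<inter> (?V -` B \<inter> space M)"
      using GU U01 by eventually_elim (auto simp: S_def dest: Bx)
    show "?A \<in> events"
      unfolding eq by (rule sets.Int[OF _ VBe]) measurable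
    show "(U -` S \<inter> space M) \<inter> (?V -` B \<inter> space M) \<in> events"
      by (rule sets.Int[OF _ VBe]) measurable
  qed
  also have "\<dots> = prob (U -` S \<inter> space M) * prob (?V -` B \<inter> space M)"
    by (rule indep_setD[OF ind]) (auto intro!: in_vimage_algebra B)
  also have "?V -` B \<inter> space M = {\<omega> \<in> space M. ?V \<omega> \<in> B}" by auto
  finally show ?thesis by (simp add: pS)
qed

text \<open>That the coin \<open>Z t\<close> is independent of the past has to be derived, so the
  induction carries the next \<open>m\<close> coins along. At each step
  \<open>gate_independent\<close> splits off the gate, and the hypothesis for \<open>Suc m\<close>
  coins supplies the coin at time t together with the later ones.\<close>

lemma obs_prob:
  "prob {\<omega> \<in> space M. observations G Y t \<omega> = x \<and> (\<forall>s\<in>{t..<t + m}. Z s \<omega> = z s)} =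
    pmf (traj (gate_prob \<Phi>) q t) x * (\<Prod>s\<in>{t..<t + m}. pmf (bernoulli_pmf (q s)) (z s))"
proof (induction t arbitrary: x m z)
  case 0
  show ?case
  proof (cases "x = []")
    case True then show ?thesis using Z_prob[of 0 m z] by (simp add: observations_def)
  next
    case False
    then have "{\<omega> \<in> space M. observations G Y 0 \<omega> = x \<and> (\<forall>s\<in>{0..<0 + m}. Z s \<omega> = z s)} = {}"
      by (auto simp: observations_def)
    then show ?thesis using False by (simp only: measure_empty) simp
  qed
next
  case (Suc t y)
  show ?case
  proof (cases "length y = Suc t")
    case False
    then have "{\<omega> \<in> space M. observations G Y (Suc t) \<omega> = y \<and> (\<forall>s\<in>{Suc t..<Suc t + m}. Z s \<omega> = z s)} = {}"
      by auto
    moreover have "pmf (traj (gate_prob \<Phi>) q (Suc t)) y = 0"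
      using False length_traj[of y] by (auto simp: pmf_eq_0_set_pmf simp del: traj.simps)
    ultimately show ?thesis by (simp only: measure_empty mult_zero_left)
  next
    case True
    then obtain x g b where y: "y = x @ [(g, b)]" and len: "length x = t"
      by (metis length_Suc_conv_rev surj_pair)
    let ?Zs = "\<lambda>\<zeta>. \<forall>s\<in>{Suc t..<Suc t + m}. \<zeta> s = z s"
    let ?P = "\<Prod>s\<in>{Suc t..<Suc t + m}. pmf (bernoulli_pmf (q s)) (z s)"
    let ?p = "pmf (traj (gate_prob \<Phi>) q t) x"
    let ?O = "\<lambda>h. {\<omega> \<in> space M. observations G Y t \<omega> = x \<and> Z t \<omega> = h \<and> ?Zs (\<lambda>s. Z s \<omega>)}"
    \<comment> \<open>Almost surely \<open>Y t\<close> is the conjunction of \<open>G t\<close> and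
      \<open>Z t\<close>; with the gate fixed at \<open>g\<close>, the value of \<open>Y t\<close>
      becomes a condition on the coin, and \<open>B\<close> no longer mentions the gate.\<close>
    define B where "B = {p :: (nat \<Rightarrow> bool) \<times> (bool \<times> bool) list. snd p = x \<and> (g \<and> fst p t) = b \<and> ?Zs (fst p)}"
    let ?B = "{\<omega> \<in> space M. G t \<omega> = g \<and> (\<lambda>s. Z s \<omega>, observations G Y t \<omega>) \<in> B}"
    have B: "B \<in> sets ((\<Pi>\<^sub>M s\<in>UNIV. count_space UNIV) \<Otimes>\<^sub>M count_space UNIV)"
    proof -
      have "{p \<in> space ((\<Pi>\<^sub>M s\<in>UNIV. count_space UNIV) \<Otimes>\<^sub>M count_space UNIV). snd p = x \<and> (g \<and> fst p t) = b \<and> ?Zs (fst p)}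
          \<in> sets ((\<Pi>\<^sub>M s\<in>UNIV. count_space UNIV) \<Otimes>\<^sub>M count_space UNIV)"
        by measurable
      then show ?thesis by (simp add: B_def space_pair_measure space_PiM)
    qed
    have "prob {\<omega> \<in> space M. observations G Y (Suc t) \<omega> = y \<and> ?Zs (\<lambda>s. Z s \<omega>)} =
        prob ?B"
    proof (rule finite_measure_eq_AE)
      have "AE \<omega> in M. Y t \<omega> \<longleftrightarrow> G t \<omega> \<and> Z t \<omega>"
        using obs by (auto simp: observation_condition_def)
      then show "AE \<omega> in M. \<omega> \<in> {\<omega> \<in> space M. observations G Y (Suc t) \<omega> = y \<and> ?Zs (\<lambda>s. Z s \<omega>)} \<longleftrightarrow>
          \<omega> \<in> ?B"
        by eventually_elim (auto simp: y observations_Suc B_def)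
      show "?B \<in> events"
        unfolding B_def by simp
    qed measurable
    also have "\<dots> = (if g then gate_prob \<Phi> t x else 1 - gate_prob \<Phi> t x) *
        prob {\<omega> \<in> space M. (\<lambda>s. Z s \<omega>, observations G Y t \<omega>) \<in> B}"
      by (rule gate_independent[OF len B]) (simp add: B_def)
    also have "{\<omega> \<in> space M. (\<lambda>s. Z s \<omega>, observations G Y t \<omega>) \<in> B} =
        {\<omega> \<in> space M. observations G Y t \<omega> = x \<and> (g \<and> Z t \<omega>) = b \<and> ?Zs (\<lambda>s. Z s \<omega>)}"
      by (auto simp: B_def)
    also have "prob \<dots> = ?p *
        ((if g then (if b then q t else 1 - q t) else if b then 0 else 1) * ?P)"
    proof -
      have split: "{t..<t + Suc m} = insert t {Suc t..<Suc t + m}" by auto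
      have one: "prob (?O h) =
          ?p * ((if h then q t else 1 - q t) * ?P)" for h
      proof -
        have "prob (?O h) =
           prob {\<omega> \<in> space M. observations G Y t \<omega> = x \<and> (\<forall>s\<in>{t..<t + Suc m}. Z s \<omega> = (z(t := h)) s)}"
          unfolding split by (rule arg_cong[where f=prob]) auto
        also have "\<dots> = ?p * (\<Prod>s\<in>{t..<t + Suc m}. pmf (bernoulli_pmf (q s)) ((z(t := h)) s))"
          by (rule Suc.IH)
        also have "(\<Prod>s\<in>{t..<t + Suc m}. pmf (bernoulli_pmf (q s)) ((z(t := h)) s)) =
            pmf (bernoulli_pmf (q t)) h * (\<Prod>s\<in>{Suc t..<Suc t + m}. pmf (bernoulli_pmf (q s)) ((z(t := h)) s))"
          unfolding split by simp
        also have "(\<Prod>s\<in>{Suc t..<Suc t + m}. pmf (bernoulli_pmf (q s)) ((z(t := h)) s)) = ?P"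
          by (rule prod.cong) auto
        also have "pmf (bernoulli_pmf (q t)) h = (if h then q t else 1 - q t)" using q[of t] by (cases h) auto
        finally show ?thesis .
      qed
      show ?thesis
      proof (cases g)
        case True then show ?thesis using one[of b] by simp
      next
        case g: False
        show ?thesis
        proof (cases b)
          case True then show ?thesis using g by simp
        next
          case False
          \<comment> \<open>A closed gate hides the coin, so both of its values contribute.\<close>
          have "prob {\<omega> \<in> space M. observations G Y t \<omega> = x \<and> (g \<and> Z t \<omega>) = b \<and> ?Zs (\<lambda>s. Z s \<omega>)} =
              prob ((?O True) \<union>
              (?O False))"
            using g False by (intro arg_cong[where f=prob]) auto
          also have "\<dots> = prob (?O True) +
              prob (?O False)"
            by (rule finite_measure_Union) (measurable, auto)
          also have "\<dots> = ?p * (q t * ?P) + ?p * ((1 - q t) * ?P)"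
            unfolding one if_True if_False ..
          also have "\<dots> = ?p * (1 * ?P)" by algebra
          finally show ?thesis using g False by (simp only: if_False)
        qed
      qed
    qed
    also have "(if g then gate_prob \<Phi> t x else 1 - gate_prob \<Phi> t x) * (?p *
        ((if g then (if b then q t else 1 - q t) else if b then 0 else 1) * ?P)) =
      ?p * (if g then gate_prob \<Phi> t x * (if b then q t else 1 - q t)
        else if b then 0 else 1 - gate_prob \<Phi> t x) * ?P"
      by (cases g; cases b) (simp_all del: traj.simps)
    also have "?p * (if g then gate_prob \<Phi> t x * (if b then q t else 1 - q t)
        else if b then 0 else 1 - gate_prob \<Phi> t x) = pmf (traj (gate_prob \<Phi>) q (Suc t)) y"
      unfolding y by (rule pmf_traj_snoc[symmetric]) (rule gate_prob_bounds q)+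
    finally show ?thesis .
  qed
qed

lemma distr_observations: "distr M (count_space UNIV) (observations G Y n) = measure_pmf (traj (gate_prob \<Phi>) q n)"
proof (rule measure_eqI_countable[where A=UNIV])
  fix x :: "(bool \<times> bool) list"
  have "emeasure (distr M (count_space UNIV) (observations G Y n)) {x} = emeasure M {\<omega> \<in> space M. observations G Y n \<omega> = x}"
    by (subst emeasure_distr) (auto intro!: arg_cong[where f="emeasure M"])
  also have "\<dots> = ennreal (pmf (traj (gate_prob \<Phi>) q n) x)"
    using obs_prob[of n x 0] by (simp add: emeasure_eq_measure)
  finally show "emeasure (distr M (count_space UNIV) (observations G Y n)) {x} = emeasure (measure_pmf (traj (gate_prob \<Phi>) q n)) {x}"
    by (simp add: emeasure_pmf_single)
qed auto

end

section \<open>Vitali's theorem, gating averages and weak limits\<close>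

text \<open>By Montel, a subsequence staying away from H z would have a further subsequence
  converging to an entire function. That limit equals H on the segment, which accumulates at 0,
  hence everywhere, a contradiction at z.\<close>

lemma vitali_real_segment:
  fixes F :: "nat \<Rightarrow> complex \<Rightarrow> complex"
  assumes hol: "\<And>n. F n holomorphic_on UNIV" "H holomorphic_on UNIV"
    and bdd: "\<And>R. \<exists>B. \<forall>n z. norm z \<le> R \<longrightarrow> norm (F n z) \<le> B"
    and \<delta>: "\<delta> > 0"
    and lim: "\<And>s::real. \<bar>s\<bar> < \<delta> \<Longrightarrow> (\<lambda>n. F n (of_real s)) \<longlonglongrightarrow> H (of_real s)"
  shows "(\<lambda>n. F n z) \<longlonglongrightarrow> H z"
proof (rule ccontr)
  assume "\<not> (\<lambda>n. F n z) \<longlonglongrightarrow> H z"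
  then obtain e where e: "e > 0" "\<exists>\<^sub>F n in sequentially. dist (F n z) (H z) \<ge> e"
    unfolding tendsto_iff by (auto simp: not_eventually not_less)
  then have "infinite {n. dist (F n z) (H z) \<ge> e}"
    by (simp add: frequently_cofinite flip: cofinite_eq_sequentially)
  then obtain s where s: "strict_mono (s :: nat \<Rightarrow> nat)" "\<And>n. dist (F (s n) z) (H z) \<ge> e"
    using infinite_enumerate by blast
  obtain g r where g: "g holomorphic_on UNIV" "strict_mono (r :: nat \<Rightarrow> nat)"
    "\<And>x. x \<in> UNIV \<Longrightarrow> (\<lambda>n. F (s (r n)) x) \<longlonglongrightarrow> g x"
  proof (rule Montel[of UNIV "range F" "\<lambda>n. F (s n)"])
    fix K :: "complex set" assume "compact K"
    then obtain R where R: "\<And>x. x \<in> K \<Longrightarrow> norm x \<le> R"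
      using compact_imp_bounded bounded_iff by metis
    from bdd[of R] R show "\<exists>B. \<forall>h\<in>range F. \<forall>z\<in>K. norm (h z) \<le> B" by blast
  qed (use hol in auto)
  have eq: "g (of_real t) = H (of_real t)" if "\<bar>t\<bar> < \<delta>" for t :: real
  proof (rule LIMSEQ_unique[OF g(3)])
    show "(\<lambda>n. F (s (r n)) (of_real t)) \<longlonglongrightarrow> H (of_real t)"
      using LIMSEQ_subseq_LIMSEQ[OF lim[OF that] strict_mono_o[OF s(1) g(2)]] by (simp add: o_def)
  qed simp
  have "g z - H z = 0"
  proof (rule analytic_continuation[of "\<lambda>w. g w - H w" UNIV "of_real ` {0<..<\<delta>}" 0])
    show "(\<lambda>w. g w - H w) holomorphic_on UNIV" using g(1) hol(2) by (intro holomorphic_intros)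
    show "0 islimpt (of_real ` {0<..<\<delta>} :: complex set)"
      unfolding islimpt_approachable
    proof (intro allI impI)
      fix d :: real assume "d > 0"
      then show "\<exists>x'\<in>of_real ` {0<..<\<delta>}. x' \<noteq> (0::complex) \<and> dist x' 0 < d"
        using \<delta> by (intro bexI[of _ "of_real (min d \<delta> / 2)"] imageI) (auto simp: min_def)
    qed
    show "g w - H w = 0" if "w \<in> of_real ` {0<..<\<delta>}" for w using that eq by auto
  qed auto
  then have "(\<lambda>n. F (s (r n)) z) \<longlonglongrightarrow> H z" using g(3)[of z] by simp
  from tendstoD[OF this e(1)] obtain n where "dist (F (s (r n)) z) (H z) < e"
    by (auto simp: eventually_sequentially)
  with s(2)[of "r n"] show False by simp
qed

text \<open>The first n times are cut into complete periods, which give the gating frequency of each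
  phase. With W the sum of the weights, the incomplete last period costs at most K W / n, and
  replacing 1 / K by (n div K) / n costs at most W / n.\<close>

lemma periodic_average_bound:
  fixes g w \<gamma> :: "nat \<Rightarrow> real"
  assumes K: "K > 0" and n: "n div K > 0"
    and g: "\<And>t. 0 \<le> g t \<and> g t \<le> 1" and w: "\<And>t. 0 \<le> w t" "\<And>t. w t = w (t mod K)"
    and \<gamma>: "\<And>r. r < K \<Longrightarrow> 0 \<le> \<gamma> r \<and> \<gamma> r \<le> 1"
  shows "\<bar>(\<Sum>t<n. g t * w t) / n - (\<Sum>r<K. \<gamma> r * w r) / K\<bar> \<le>
    (\<Sum>r<K. w r * \<bar>(\<Sum>l<n div K. g (r + l * K)) / (n div K) - \<gamma> r\<bar>) + (real K + 1) * (\<Sum>r<K. w r) / n"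
proof -
  define L where "L = n div K"
  have L: "L > 0" "L * K \<le> n" "n < L * K + K" and n0: "n > 0"
    using n K dividend_less_div_times[OF K, of n] by (auto simp: L_def div_times_less_eq_dividend intro: gr0I)
  define W where "W = (\<Sum>r<K. w r)"
  have W0: "W \<ge> 0" using w(1) by (auto simp: W_def intro: sum_nonneg)
  have wW: "w t \<le> W" for t
    unfolding W_def using w member_le_sum[of "t mod K" "{..<K}" w] K by simp
  have wr: "w (r + l * K) = w r" for r l
    using w(2)[of "r + l * K"] w(2)[of r] by simp
  define N where "N r = (\<Sum>l<L. g (r + l * K)) / L" for r
  have "(\<Sum>t<L * K. g t * w t) = (\<Sum>l<L. \<Sum>t\<in>{l * K..<l * K + K}. g t * w t)"
    by (rule sum.nat_group[symmetric])
  also have "\<dots> = (\<Sum>l<L. \<Sum>r<K. g (r + l * K) * w r)"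
  proof (rule sum.cong[OF refl])
    fix l
    have "(\<Sum>t\<in>{l * K..<l * K + K}. g t * w t) = (\<Sum>r\<in>{0..<K}. g (r + l * K) * w (r + l * K))"
      using sum.shift_bounds_nat_ivl[of "\<lambda>t. g t * w t" 0 "l * K" K] by (simp add: add.commute)
    also have "\<dots> = (\<Sum>r<K. g (r + l * K) * w r)"
      unfolding atLeast0LessThan wr ..
    finally show "(\<Sum>t\<in>{l * K..<l * K + K}. g t * w t) = (\<Sum>r<K. g (r + l * K) * w r)" .
  qed
  also have "\<dots> = (\<Sum>r<K. w r * (L * N r))"
  proof -
    have LN: "real L * N r = (\<Sum>l<L. g (r + l * K))" for r using L by (simp add: N_def)
    show ?thesis unfolding LN by (subst sum.swap) (simp add: sum_distrib_left mult.commute)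
  qed
  finally have A: "(\<Sum>t<L * K. g t * w t) = (\<Sum>r<K. w r * (L * N r))" .
  define Q where "Q = (\<Sum>t\<in>{L * K..<n}. g t * w t)"
  have "{..<n} = {..<L * K} \<union> {L * K..<n}" using L(2) by (simp add: ivl_disj_un)
  then have "(\<Sum>t<n. g t * w t) = (\<Sum>t<L * K. g t * w t) + Q"
    unfolding Q_def by (metis finite_lessThan finite_atLeastLessThan ivl_disj_int_one(2) sum.union_disjoint)
  then have S: "(\<Sum>t<n. g t * w t) = (\<Sum>r<K. w r * (L * N r)) + Q" unfolding A .
  have Q0: "Q \<ge> 0" unfolding Q_def using g w by (intro sum_nonneg) auto
  have "Q \<le> (\<Sum>t\<in>{L * K..<n}. W)"
    unfolding Q_def using g w wW W0 by (intro sum_mono) (metis mult_left_le_one_le order_trans)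
  also have "\<dots> = (real n - real L * K) * W" using L by (simp add: of_nat_diff)
  also have "\<dots> \<le> K * W"
  proof (intro mult_right_mono W0)
    have "real n < real (L * K + K)" using L(3) by (simp only: of_nat_less_iff)
    then show "real n - real L * real K \<le> real K" by simp
  qed
  finally have Q: "Q \<le> K * W" .
  have "(\<Sum>t<n. g t * w t) / n - (\<Sum>r<K. \<gamma> r * w r) / K =
      (\<Sum>r<K. w r * (N r - \<gamma> r)) * (L / n) + (\<Sum>r<K. \<gamma> r * w r) * (L / n - 1 / K) + Q / n"
  proof -
    have e1: "(\<Sum>r<K. w r * (L * N r)) = L * (\<Sum>r<K. w r * N r)" by (simp add: sum_distrib_left mult_ac)
    have e2: "(\<Sum>r<K. w r * (N r - \<gamma> r)) = (\<Sum>r<K. w r * N r) - (\<Sum>r<K. \<gamma> r * w r)"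
      by (simp add: right_diff_distrib sum_subtractf mult.commute)
    have "(l * a + c) / m - b / k = (a - b) * (l / m) + b * (l / m - 1 / k) + c / m" for a b c l m k :: real
      by (simp add: add_divide_distrib diff_divide_distrib algebra_simps)
    then show ?thesis unfolding S e1 e2 .
  qed
  also have "\<bar>\<dots>\<bar> \<le> (\<Sum>r<K. w r * \<bar>N r - \<gamma> r\<bar>) * 1 + W * (1 / n) + K * W / n"
  proof -
    have Ln: "L \<le> n" using L K by (metis Suc_leI le_trans mult.right_neutral mult_le_mono2 One_nat_def)
    have b1: "\<bar>(\<Sum>r<K. w r * (N r - \<gamma> r)) * (L / n)\<bar> \<le> (\<Sum>r<K. w r * \<bar>N r - \<gamma> r\<bar>) * 1"
      unfolding abs_mult
    proof (intro mult_mono)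
      show "\<bar>\<Sum>r<K. w r * (N r - \<gamma> r)\<bar> \<le> (\<Sum>r<K. w r * \<bar>N r - \<gamma> r\<bar>)"
        using sum_abs[of "\<lambda>r. w r * (N r - \<gamma> r)" "{..<K}"] w by (simp add: abs_mult)
      show "\<bar>real L / real n\<bar> \<le> 1" using Ln n0 by simp
    qed (use w in \<open>auto intro: sum_nonneg\<close>)
    have "(\<Sum>r<K. \<gamma> r * w r) \<le> W" unfolding W_def using \<gamma> w by (intro sum_mono mult_left_le_one_le) auto
    moreover have "0 \<le> (\<Sum>r<K. \<gamma> r * w r)" using \<gamma> w by (intro sum_nonneg) auto
    moreover have "\<bar>real L / real n - 1 / K\<bar> \<le> 1 / n"
    proof -
      have "real L / real n - 1 / K = (real L * K - n) / (n * K)" using n0 K by (simp add: field_simps)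
      moreover have "\<bar>real L * K - n\<bar> \<le> K"
      proof -
        have "real n < real (L * K + K)" "real (L * K) \<le> real n" using L by (simp_all only: of_nat_less_iff of_nat_le_iff)
        then show ?thesis by simp
      qed
      ultimately show ?thesis using n0 K by (simp add: abs_divide divide_le_eq)
    qed
    ultimately have b2: "\<bar>(\<Sum>r<K. \<gamma> r * w r) * (L / n - 1 / K)\<bar> \<le> W * (1 / n)"
      unfolding abs_mult by (intro mult_mono) auto
    have b3: "\<bar>Q / n\<bar> \<le> K * W / n" using Q Q0 by (simp add: divide_right_mono)
    show ?thesis
      by (rule order_trans[OF abs_triangle_ineq add_mono[OF order_trans[OF abs_triangle_ineq add_mono[OF b1 b2]] b3]])
  qed
  also have "\<dots> = (\<Sum>r<K. w r * \<bar>N r - \<gamma> r\<bar>) + (real K + 1) * W / n"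
    by (simp only: add_divide_distrib distrib_right mult_1_left mult_1_right times_divide_eq_right add.assoc add.commute[of "W / real n"])
  finally show ?thesis unfolding N_def W_def L_def .
qed

text \<open>Deviations are at most 1, so the mean deviation is at most e / 2 plus the probability
  that the deviation exceeds e / 2.\<close>

lemma (in prob_space) converges_in_probability_imp_L1:
  assumes X: "\<And>n. X n \<in> borel_measurable M" and b: "\<And>n \<omega>. \<bar>X n \<omega> - c\<bar> \<le> 1"
    and conv: "converges_in_probability M X c"
  shows "(\<lambda>n. expectation (\<lambda>\<omega>. \<bar>X n \<omega> - c\<bar>)) \<longlonglongrightarrow> 0"
proof (rule tendstoI)
  fix e :: real assume e: "e > 0"
  have [measurable]: "X n \<in> borel_measurable M" for n by (rule X)
  have "(\<lambda>n. prob {\<omega> \<in> space M. \<bar>X n \<omega> - c\<bar> > e / 2}) \<longlonglongrightarrow> 0"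
    using conv[unfolded converges_in_probability_def, rule_format, of "e / 2"] e by simp
  from order_tendstoD(2)[OF this, of "e / 2"] e
  have "\<forall>\<^sub>F n in sequentially. prob {\<omega> \<in> space M. \<bar>X n \<omega> - c\<bar> > e / 2} < e / 2" by simp
  then show "\<forall>\<^sub>F n in sequentially. dist (expectation (\<lambda>\<omega>. \<bar>X n \<omega> - c\<bar>)) 0 < e"
  proof eventually_elim
    case (elim n)
    define A where "A = {\<omega> \<in> space M. \<bar>X n \<omega> - c\<bar> > e / 2}"
    have [measurable]: "A \<in> events" unfolding A_def by measurable
    have iA: "integrable M (indicat_real A)"
      by (rule integrable_bounded[where B=1]) (auto simp: indicator_def)
    have "expectation (\<lambda>\<omega>. \<bar>X n \<omega> - c\<bar>) \<le> expectation (\<lambda>\<omega>. e / 2 + indicator A \<omega>)"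
    proof (rule integral_mono)
      show "integrable M (\<lambda>\<omega>. \<bar>X n \<omega> - c\<bar>)" by (rule integrable_bounded[where B=1]) (use b in auto)
      show "integrable M (\<lambda>\<omega>. e / 2 + indicator A \<omega> :: real)"
        by (intro integrable_bounded[where B="e / 2 + 1"]) (use e in \<open>auto simp: indicator_def\<close>)
      fix \<omega> assume "\<omega> \<in> space M"
      then show "\<bar>X n \<omega> - c\<bar> \<le> e / 2 + indicator A \<omega>"
        using b[of n \<omega>] e by (auto simp: indicator_def A_def)
    qed
    also have "\<dots> = e / 2 + prob A" using iA by (subst Bochner_Integration.integral_add) (auto simp: prob_space)
    also have "\<dots> < e" using elim by (simp add: A_def)
    finally show ?case by (simp add: dist_real_def integral_nonneg_AE)
  qed
qed

context causal_observation
begin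

lemma traj_mean_observations:
  fixes f :: "_ \<Rightarrow> 'b::{banach, second_countable_topology}"
  shows "traj_mean (gate_prob \<Phi>) q n f = expectation (\<lambda>\<omega>. f (observations G Y n \<omega>))"
  unfolding distr_observations[symmetric] by (rule integral_distr) auto

text \<open>Here the gating-frequency condition enters: \<open>info\<close> divided by n is an
  average of gate indicators with periodic weights, so its limit is the average over the phases
  weighted by the limiting frequencies.\<close>

lemma info_limit:
  assumes K: "K > 0" and per: "\<And>t. q t = q (t mod K)" "\<And>t. d t = d (t mod K)"
    and gat: "gating_frequency_condition M K G \<gamma>"
  shows "(\<lambda>n. traj_mean (gate_prob \<Phi>) q n (\<lambda>x. \<bar>info q d x / n -
    (\<Sum>r<K. \<gamma> r * ((d r)\<^sup>2 / (q r * (1 - q r)))) / K\<bar>)) \<longlonglongrightarrow> 0"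
proof -
  define w where "w t = (d t)\<^sup>2 / (q t * (1 - q t))" for t
  have w: "0 \<le> w t" "w t = w (t mod K)" for t
    using q[of t] per(1)[of t] per(2)[of t] by (auto simp: w_def)
  have \<gamma>: "0 \<le> \<gamma> r \<and> \<gamma> r \<le> 1" and cip: "converges_in_probability M (\<lambda>L \<omega>. (\<Sum>l<L. of_bool (G (r + l * K) \<omega>)) / real L) (\<gamma> r)"
    if "r < K" for r
    using gat that by (auto simp: gating_frequency_condition_def)
  define X where "X r L \<omega> = (\<Sum>l<L. of_bool (G (r + l * K) \<omega>)) / real L" for r L \<omega>
  let ?I = "\<lambda>n \<omega>. (\<Sum>t<n. of_bool (G t \<omega>) * w t)"
  let ?c = "(\<Sum>r<K. \<gamma> r * w r) / K"
  let ?X = "\<lambda>r n \<omega>. \<bar>X r (n div K) \<omega> - \<gamma> r\<bar>"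
  let ?E = "\<lambda>n f. traj_mean (gate_prob \<Phi>) q n f :: real"
  have Xm[measurable]: "X r L \<in> borel_measurable M" for r L unfolding X_def by measurable
  have X01: "0 \<le> X r L \<omega> \<and> X r L \<omega> \<le> 1" for r L \<omega>
  proof -
    have "(\<Sum>l<L. of_bool (G (r + l * K) \<omega>) :: real) \<le> (\<Sum>l<L. 1)" by (intro sum_mono) auto
    then show ?thesis by (cases "L = 0") (auto simp: X_def intro: sum_nonneg divide_nonneg_nonneg)
  qed
  have Xb: "\<bar>X r L \<omega> - \<gamma> r\<bar> \<le> 1" if "r < K" for r L \<omega> using X01[of r L \<omega>] \<gamma>[OF that] by linarith
  have EX: "(\<lambda>L. expectation (\<lambda>\<omega>. \<bar>X r L \<omega> - \<gamma> r\<bar>)) \<longlonglongrightarrow> 0" if "r < K" for r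
    by (rule converges_in_probability_imp_L1) (use Xb cip that in \<open>auto simp: X_def[abs_def]\<close>)
  have fl: "filterlim (\<lambda>n. n div K) sequentially sequentially"
    unfolding filterlim_at_top
  proof
    fix Z show "\<forall>\<^sub>F n in sequentially. Z \<le> n div K"
      using eventually_ge_at_top[of "Z * K"] by eventually_elim (use K in \<open>simp add: less_eq_div_iff_mult_less_eq\<close>)
  qed
  have "(\<lambda>n. (\<Sum>r<K. w r * expectation (\<lambda>\<omega>. ?X r n \<omega>)) + (real K + 1) * (\<Sum>r<K. w r) * inverse (real n))
      \<longlonglongrightarrow> (\<Sum>r<K. w r * 0) + (real K + 1) * (\<Sum>r<K. w r) * 0"
    by (intro tendsto_intros filterlim_compose[OF EX fl] lim_inverse_n) auto
  then have bound: "(\<lambda>n. (\<Sum>r<K. w r * expectation (\<lambda>\<omega>. ?X r n \<omega>)) + (real K + 1) * (\<Sum>r<K. w r) * inverse (real n)) \<longlonglongrightarrow> 0"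
    by simp
  show ?thesis
  proof (rule Lim_null_comparison[OF _ bound])
    show "\<forall>\<^sub>F n in sequentially. norm (?E n (\<lambda>x. \<bar>info q d x / n -
        (\<Sum>r<K. \<gamma> r * ((d r)\<^sup>2 / (q r * (1 - q r)))) / K\<bar>)) \<le>
      (\<Sum>r<K. w r * expectation (\<lambda>\<omega>. ?X r n \<omega>)) + (real K + 1) * (\<Sum>r<K. w r) * inverse (real n)"
      using eventually_ge_at_top[of K]
    proof eventually_elim
      case (elim n)
      then have n: "n div K > 0" using K by (simp add: div_greater_zero_iff)
      have iX: "integrable M (\<lambda>\<omega>. w r * ?X r n \<omega>)" if "r < K" for r
        by (intro integrable_mult_right integrable_bounded[where B=1]) (use Xb that in auto)
      have info: "info q d (observations G Y n \<omega>) = ?I n \<omega>" for \<omega>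
        unfolding info_def by (auto simp: observations_def w_def intro!: sum.cong)
      have "norm (?E n (\<lambda>x. \<bar>info q d x / n - ?c\<bar>)) =
          expectation (\<lambda>\<omega>. \<bar>?I n \<omega> / n - ?c\<bar>)"
        unfolding traj_mean_observations info by (simp add: integral_nonneg_AE)
      also have "\<dots> \<le> expectation (\<lambda>\<omega>. (\<Sum>r<K. w r * ?X r n \<omega>) + (real K + 1) * (\<Sum>r<K. w r) / n)"
      proof (rule integral_mono)
        show "integrable M (\<lambda>\<omega>. \<bar>?I n \<omega> / n - ?c\<bar>)"
        proof (rule integrable_bounded[where B="(\<Sum>t<n. w t) / n + \<bar>?c\<bar>"])
          fix \<omega>
          have "0 \<le> ?I n \<omega>" by (rule sum_nonneg) (use w(1) in auto)
          moreover have "?I n \<omega> \<le> (\<Sum>t<n. w t)" by (rule sum_mono) (use w(1) in auto)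
          ultimately have "\<bar>?I n \<omega> / n\<bar> \<le> (\<Sum>t<n. w t) / n" by (simp add: divide_right_mono)
          then show "norm \<bar>?I n \<omega> / n - ?c\<bar> \<le> (\<Sum>t<n. w t) / n + \<bar>?c\<bar>"
            using abs_triangle_ineq4[of "?I n \<omega> / n" "?c"]
            unfolding real_norm_def abs_idempotent by linarith
        qed measurable
        show "integrable M (\<lambda>\<omega>. (\<Sum>r<K. w r * ?X r n \<omega>) + (real K + 1) * (\<Sum>r<K. w r) / n)"
          by (intro Bochner_Integration.integrable_add Bochner_Integration.integrable_sum iX) auto
        fix \<omega>
        show "\<bar>?I n \<omega> / n - ?c\<bar> \<le>
           (\<Sum>r<K. w r * ?X r n \<omega>) + (real K + 1) * (\<Sum>r<K. w r) / n"
          unfolding X_def by (rule periodic_average_bound[where w=w and \<gamma>=\<gamma> and K=K and n=n and g="\<lambda>t. of_bool (G t \<omega>)"])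
             (use K n w \<gamma> in auto)
      qed
      also have "\<dots> = (\<Sum>r<K. w r * expectation (\<lambda>\<omega>. ?X r n \<omega>)) + (real K + 1) * (\<Sum>r<K. w r) / n"
      proof -
        have iS: "integrable M (\<lambda>\<omega>. \<Sum>r<K. w r * ?X r n \<omega>)"
          by (rule Bochner_Integration.integrable_sum) (rule iX, simp)
        have "expectation (\<lambda>\<omega>. \<Sum>r<K. w r * ?X r n \<omega>) =
            (\<Sum>r<K. expectation (\<lambda>\<omega>. w r * ?X r n \<omega>))"
          by (rule Bochner_Integration.integral_sum) (rule iX, simp)
        then show ?thesis
          by (subst Bochner_Integration.integral_add[OF iS]) (simp_all add: prob_space)
      qed
      finally show ?case by (simp add: w_def divide_inverse)
    qed
  qed
qed

end

section \<open>Consequences of weak convergence\<close>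

lemma weakly_converges_bounded_in_prob:
  fixes L :: "'a::euclidean_space measure" and \<mu> :: "nat \<Rightarrow> 'a measure"
  assumes L: "prob_space L" "sets L = sets borel" and \<mu>: "\<And>n. prob_space (\<mu> n)" "\<And>n. sets (\<mu> n) = sets borel"
    and conv: "weakly_converges \<mu> L" and e: "e > 0"
  shows "\<exists>R\<ge>0. \<forall>\<^sub>F n in sequentially. measure (\<mu> n) {x. norm x \<ge> R} < e"
proof -
  interpret L: prob_space L by fact
  note [measurable_cong] = L(2) \<mu>(2)
  have mk: "{x :: 'a. norm x \<ge> c} \<in> sets borel" for c by measurable
  have spL: "space L = UNIV" using L(2) by (simp add: sets_eq_imp_space_eq)
  have "(\<lambda>k. measure L {x. norm x \<ge> real k}) \<longlonglongrightarrow> measure L (\<Inter>k. {x. norm x \<ge> real k})"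
  proof (rule L.finite_Lim_measure_decseq)
    show "range (\<lambda>k. {x. norm x \<ge> real k}) \<subseteq> L.events"
      unfolding L(2) using mk by (rule image_subsetI)
    show "decseq (\<lambda>k. {x :: 'a. norm x \<ge> real k})"
      unfolding decseq_def by (intro allI impI Collect_mono) (meson of_nat_mono order_trans)
  qed
  moreover have "(\<Inter>k. {x :: 'a. norm x \<ge> real k}) = {}"
    by auto (meson reals_Archimedean2 not_le)
  ultimately have "(\<lambda>k. measure L {x. norm x \<ge> real k}) \<longlonglongrightarrow> 0" by simp
  from order_tendstoD(2)[OF this e] obtain k where k: "measure L {x. norm x \<ge> real k} < e"
    by (auto simp: eventually_sequentially)
  \<comment> \<open>A continuous function squeezed between the indicators of norm at least k + 1 and
    of norm at least k, hence the final radius k + 1.\<close>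
  define f where "f x = min 1 (max 0 (norm x - real k))" for x :: 'a
  have fc: "continuous_on UNIV f" unfolding f_def by (intro continuous_intros)
  have [measurable]: "f \<in> borel_measurable borel" using fc by (rule borel_measurable_continuous_onI)
  have fb: "\<bar>f x\<bar> \<le> 1" for x by (auto simp: f_def)
  have "bounded (range f)" using fb by (auto simp: bounded_iff)
  then have lim: "(\<lambda>n. integral\<^sup>L (\<mu> n) f) \<longlonglongrightarrow> integral\<^sup>L L f"
    using conv fc by (auto simp: weakly_converges_def)
  have "integral\<^sup>L L f \<le> integral\<^sup>L L (indicator {x. norm x \<ge> real k})"
    by (rule integral_mono) (use fb mk L(2) in \<open>auto intro!: L.integrable_bounded[where B=1] simp: indicator_def f_def\<close>)
  also have "\<dots> = measure L {x. norm x \<ge> real k}" using spL by simp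
  finally have "integral\<^sup>L L f < e" using k by simp
  from order_tendstoD(2)[OF lim this]
  have "\<forall>\<^sub>F n in sequentially. measure (\<mu> n) {x. norm x \<ge> real k + 1} < e"
  proof eventually_elim
    case (elim n)
    interpret m: prob_space "\<mu> n" by (rule \<mu>)
    have sp: "space (\<mu> n) = UNIV" using \<mu>(2)[of n] by (simp add: sets_eq_imp_space_eq)
    have "measure (\<mu> n) {x. norm x \<ge> real k + 1} = integral\<^sup>L (\<mu> n) (indicator {x. norm x \<ge> real k + 1})"
      using sp by simp
    also have "\<dots> \<le> integral\<^sup>L (\<mu> n) f"
      by (rule integral_mono) (use fb mk \<mu>(2)[of n] in \<open>auto intro!: m.integrable_bounded[where B=1] simp: indicator_def f_def\<close>)
    finally show ?case using elim by simp
  qed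
  then show ?thesis by (intro exI[of _ "real k + 1"]) auto
qed

text \<open>Weak convergence is tested on real functions, so real and imaginary parts are treated as
  integrals of cosine and sine.\<close>

lemma weakly_converges_vchar:
  assumes conv: "weakly_converges \<mu> L" and \<mu>: "\<And>n. prob_space (\<mu> n)" "\<And>n. sets (\<mu> n) = sets borel"
    and L: "prob_space L" "sets L = sets borel"
  shows "(\<lambda>n. vchar (\<mu> n) u) \<longlonglongrightarrow> vchar L u"
proof -
  have split: "vchar m u = Complex (integral\<^sup>L m (\<lambda>x. cos (u \<bullet> x))) (integral\<^sup>L m (\<lambda>x. sin (u \<bullet> x)))"
    if m: "prob_space m" and [measurable_cong]: "sets m = sets borel" for m
  proof -
    interpret m: prob_space m by fact
    have i: "integrable m (\<lambda>x. iexp (u \<bullet> x))"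
      by (rule m.integrable_bounded[where B=1]) auto
    have "Re (vchar m u) = integral\<^sup>L m (\<lambda>x. cos (u \<bullet> x))"
      unfolding vchar_def using integral_Re[OF i] by (simp add: Re_exp)
    moreover have "Im (vchar m u) = integral\<^sup>L m (\<lambda>x. sin (u \<bullet> x))"
      unfolding vchar_def using integral_Im[OF i] by (simp add: Im_exp)
    ultimately show ?thesis by (simp add: complex_eq_iff)
  qed
  have "(\<lambda>n. integral\<^sup>L (\<mu> n) (\<lambda>x. cos (u \<bullet> x))) \<longlonglongrightarrow> integral\<^sup>L L (\<lambda>x. cos (u \<bullet> x))"
    "(\<lambda>n. integral\<^sup>L (\<mu> n) (\<lambda>x. sin (u \<bullet> x))) \<longlonglongrightarrow> integral\<^sup>L L (\<lambda>x. sin (u \<bullet> x))"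
    by (rule conv[unfolded weakly_converges_def, rule_format];
        auto intro!: continuous_intros simp: bounded_iff intro!: exI[of _ 1])+
  then show ?thesis
    unfolding split[OF \<mu>] split[OF L] by (intro tendsto_Complex)
qed

section \<open>The convolution theorem\<close>

lemma gradient_has_derivative:
  fixes f :: "'a::euclidean_space \<Rightarrow> real"
  assumes "f differentiable (at x)"
  shows "(f has_derivative (\<lambda>h. gradient f x \<bullet> h)) (at x)"
proof -
  obtain f' where f': "(f has_derivative f') (at x)" using assms by (auto simp: differentiable_def)
  define D where "D = (\<Sum>b\<in>Basis. f' b *\<^sub>R b)"
  have lin: "linear f'" using f' by (rule has_derivative_linear)
  have "f' h = h \<bullet> D" for h
  proof -
    have "f' h = f' (\<Sum>b\<in>Basis. (h \<bullet> b) *\<^sub>R b)" by (simp add: euclidean_representation)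
    also have "\<dots> = (\<Sum>b\<in>Basis. (h \<bullet> b) * f' b)" by (simp add: linear_sum[OF lin] linear_cmul[OF lin])
    also have "\<dots> = h \<bullet> D" by (simp add: D_def inner_sum_right mult.commute)
    finally show ?thesis .
  qed
  then have "f' = (\<lambda>h. h \<bullet> D)" by blast
  then have "GDERIV f x :> D" using f' by (simp add: gderiv_def)
  moreover have "D' = D" if "GDERIV f x :> D'" for D'
  proof -
    have "(\<lambda>h. h \<bullet> D') = (\<lambda>h. h \<bullet> D)"
      using that \<open>GDERIV f x :> D\<close> unfolding gderiv_def by (rule has_derivative_unique)
    then show ?thesis by (metis inner_commute vector_eq_rdot)
  qed
  ultimately have "gradient f x = D" unfolding gradient_def by blast
  then show ?thesis using \<open>GDERIV f x :> D\<close> by (simp add: gderiv_def inner_commute)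
qed

lemma extends_Ck_differentiable:
  assumes "extends_Ck (Suc k) S f" and x: "x \<in> interior S"
  shows "f differentiable (at x)"
proof -
  obtain V F where V: "open V" "S \<subseteq> V" "Ck_on (Suc k) V F" "\<And>x. x \<in> S \<Longrightarrow> F x = f x"
    using assms(1) unfolding extends_Ck_def by blast
  have "x \<in> V" using x V(2) interior_subset[of S] by blast
  then have "F differentiable (at x)" using V(3) by simp
  then obtain F' where "(F has_derivative F') (at x)" by (auto simp: differentiable_def)
  then have "(f has_derivative F') (at x)"
    by (rule has_derivative_transform_within_open[where s="interior S"])
       (use x V(4) interior_subset in auto)
  then show ?thesis by (auto simp: differentiable_def)
qed

text \<open>A difference quotient of 1 - exp (- f) along the ray through \<open>h\<close>, with step
  n^(-1/2). The chain-rule factor exp (- f x) is the 1 - p that appears in the gradient of the event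
  probability.\<close>

lemma scaled_increment_limit:
  fixes f :: "'a::euclidean_space \<Rightarrow> real"
  assumes f: "(f has_derivative (\<lambda>h. g \<bullet> h)) (at x)"
  shows "(\<lambda>n. sqrt (real n) * ((1 - exp (- f (x + h /\<^sub>R sqrt (real n)))) - (1 - exp (- f x))))
    \<longlonglongrightarrow> exp (- f x) * (g \<bullet> h)"
proof -
  define \<phi> where "\<phi> s = 1 - exp (- f (x + s *\<^sub>R h))" for s
  have "((\<lambda>s. x + s *\<^sub>R h) has_derivative (\<lambda>s. s *\<^sub>R h)) (at 0)"
    by (auto intro!: derivative_eq_intros)
  moreover have "(f has_derivative (\<lambda>h. g \<bullet> h)) (at (x + 0 *\<^sub>R h))" using f by simp
  ultimately have "((\<lambda>s. f (x + s *\<^sub>R h)) has_derivative (\<lambda>s. g \<bullet> (s *\<^sub>R h))) (at 0)"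
    by (rule has_derivative_compose)
  moreover have "(\<lambda>s. g \<bullet> (s *\<^sub>R h)) = (*) (g \<bullet> h)" by (auto simp: mult.commute)
  ultimately have "((\<lambda>s. f (x + s *\<^sub>R h)) has_real_derivative (g \<bullet> h)) (at 0)"
    by (simp only: has_field_derivative_def)
  then have "(\<phi> has_real_derivative (exp (- f x) * (g \<bullet> h))) (at 0)"
    unfolding \<phi>_def by (auto intro!: derivative_eq_intros)
  then have lim: "((\<lambda>s. (\<phi> (0 + s) - \<phi> 0) / s) \<longlongrightarrow> exp (- f x) * (g \<bullet> h)) (at 0)"
    by (simp only: DERIV_def)
  have "filterlim (\<lambda>n. inverse (sqrt (real n))) (at 0) sequentially"
  proof (rule filterlim_atI)
    show "(\<lambda>n. inverse (sqrt (real n))) \<longlonglongrightarrow> 0" by real_asymp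
    show "\<forall>\<^sub>F n in sequentially. inverse (sqrt (real n)) \<noteq> 0"
      using eventually_gt_at_top[of 0] by eventually_elim simp
  qed
  from filterlim_compose[OF lim this] show ?thesis
    by (simp add: \<phi>_def divide_inverse mult.commute)
qed

text \<open>The finitely many exceptional laws have finite support, so enlarging the radius beyond
  their atoms covers them.\<close>

lemma tight_of_eventually_tight:
  fixes W :: "nat \<Rightarrow> 'b \<Rightarrow> 'a::euclidean_space" and p :: "nat \<Rightarrow> 'b pmf"
  assumes fin: "\<And>n. finite (set_pmf (p n))"
    and ev: "\<And>e. e > 0 \<Longrightarrow> \<exists>R. \<forall>\<^sub>F n in sequentially. measure_pmf.prob (p n) {x. norm (W n x) \<ge> R} < e"
    and e: "e > 0"
  shows "\<exists>R. \<forall>n. measure_pmf.prob (map_pmf (W n) (p n)) {x. norm x \<ge> R} < e"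
proof -
  obtain R N where R: "\<And>n. n \<ge> N \<Longrightarrow> measure_pmf.prob (p n) {x. norm (W n x) \<ge> R} < e"
    using ev[OF e] unfolding eventually_sequentially by blast
  define A where "A = (\<Union>n<N. norm ` W n ` set_pmf (p n))"
  have finA: "finite A" using fin by (auto simp: A_def)
  define R' where "R' = Max (insert R A) + 1"
  have RR': "R \<le> R'" "\<And>a. a \<in> A \<Longrightarrow> a < R'"
  proof -
    have "R \<le> Max (insert R A)" using finA by (intro Max_ge) auto
    then show "R \<le> R'" by (simp add: R'_def)
    fix a assume "a \<in> A"
    then have "a \<le> Max (insert R A)" using finA by (intro Max_ge) auto
    then show "a < R'" by (simp add: R'_def)
  qed
  have "measure_pmf.prob (map_pmf (W n) (p n)) {x. norm x \<ge> R'} < e" for n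
  proof -
    have eq: "measure_pmf.prob (map_pmf (W n) (p n)) {x. norm x \<ge> R'} = measure_pmf.prob (p n) {x. norm (W n x) \<ge> R'}"
      by (simp add: vimage_def)
    show ?thesis
    proof (cases "n < N")
      case True
      then have "\<And>x. x \<in> set_pmf (p n) \<Longrightarrow> norm (W n x) < R'"
        by (intro RR'(2)) (auto simp: A_def)
      then have "measure_pmf.prob (p n) {x. norm (W n x) \<ge> R'} = 0"
        by (subst measure_pmf_zero_iff) (auto simp: disjoint_iff not_le)
      then show ?thesis using e eq by simp
    next
      case False
      have "measure_pmf.prob (p n) {x. norm (W n x) \<ge> R'} \<le> measure_pmf.prob (p n) {x. norm (W n x) \<ge> R}"
        using RR'(1) by (intro measure_pmf.finite_measure_mono) auto
      then show ?thesis using R[of n] False eq by simp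
    qed
  qed
  then show ?thesis by blast
qed

section \<open>The limit theory near a fixed parameter\<close>

definition vscore :: "(nat \<Rightarrow> real) \<Rightarrow> (nat \<Rightarrow> real^'d) \<Rightarrow> (bool \<times> bool) list \<Rightarrow> real^'d" where
  "vscore q b x = (\<Sum>t<length x. if fst (x ! t) then std_score (q t) (snd (x ! t)) *\<^sub>R b t else 0)"

lemma score_eq_vscore: "score q (\<lambda>t. b t \<bullet> v) x = vscore q b x \<bullet> v"
  unfolding score_def vscore_def inner_sum_left by (intro sum.cong refl) (simp add: mult.commute)

text \<open>Everything the limit argument uses of the model at one parameter: \<open>b t\<close>
  stands for the gradient of the event probability, \<open>J\<close> for the Fisher information, and
  \<open>info\<close> is the convergence of the normalised information to the quadratic form of
  \<open>J\<close>.\<close>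

locale local_experiment =
  fixes \<kappa> :: "nat \<Rightarrow> (bool \<times> bool) list \<Rightarrow> real" and q :: "nat \<Rightarrow> real" and K :: nat
    and b :: "nat \<Rightarrow> real^'d" and J :: "real^'d^'d"
  assumes \<kappa>: "\<And>t x. \<kappa> t x \<in> {0..1}" and q: "\<And>t. 0 < q t \<and> q t < 1" and K: "K > 0"
    and per_q: "\<And>t. q t = q (t mod K)" and per_b: "\<And>t. b t = b (t mod K)"
    and J: "positive_definite J"
    and info: "\<And>h. (\<lambda>n. traj_mean \<kappa> q n (\<lambda>x. \<bar>info q (\<lambda>t. b t \<bullet> h) x / real n - h \<bullet> (J *v h)\<bar>)) \<longlonglongrightarrow> 0"
begin

text \<open>Regularity in the direction \<open>h\<close>, expressed by characteristic functions. The
  array \<open>q'\<close> stands for the event probabilities at the shifted parameter; they are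
  required to be probabilities only for large n, when that parameter lies in the parameter
  set.\<close>

definition local_limit :: "(nat \<Rightarrow> (bool \<times> bool) list \<Rightarrow> real^'d) \<Rightarrow> (real^'d) measure \<Rightarrow> real^'d \<Rightarrow> bool" where
  "local_limit S L h \<longleftrightarrow> (\<exists>q'. (\<forall>n t. q' n t = q' n (t mod K)) \<and>
      (\<forall>t. (\<lambda>n. sqrt (real n) * (q' n t - q t)) \<longlonglongrightarrow> b t \<bullet> h) \<and>
      (\<forall>\<^sub>F n in sequentially. \<forall>t. q' n t \<in> {0..1}) \<and>
      (\<forall>u. (\<lambda>n. traj_mean \<kappa> (q' n) n (\<lambda>x. iexp (u \<bullet> (S n x - h)))) \<longlonglongrightarrow> vchar L u))"

lemma score_bound: "\<exists>M. \<forall>t y. \<bar>(b t \<bullet> v) * std_score (q t) y\<bar> \<le> M"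
proof (intro exI allI)
  fix t y
  define B where "B t y = \<bar>(b t \<bullet> v) * std_score (q t) y\<bar>" for t y
  have "B t y = B (t mod K) y" using per_q[of t] per_b[of t] by (simp add: B_def)
  also have "\<dots> \<le> B (t mod K) True + B (t mod K) False" by (cases y) (auto simp: B_def)
  also have "\<dots> \<le> (\<Sum>r<K. B r True + B r False)"
    by (rule member_le_sum) (use K in \<open>auto simp: B_def\<close>)
  finally show "\<bar>(b t \<bullet> v) * std_score (q t) y\<bar> \<le> (\<Sum>r<K. B r True + B r False)" by (simp add: B_def)
qed

lemma exp_score_bound: "\<exists>C. \<forall>n s. \<bar>s\<bar> \<le> R \<longrightarrow> traj_mean \<kappa> q n (\<lambda>x. exp (s * (vscore q b x \<bullet> v / sqrt (real n)))) \<le> C"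
proof -
  obtain M where M: "\<And>t y. \<bar>(b t \<bullet> v) * std_score (q t) y\<bar> \<le> M" using score_bound by blast
  have M0: "M \<ge> 0" using M[of 0 True] by linarith
  show ?thesis
  proof (intro exI allI impI)
    fix n and s :: real assume s: "\<bar>s\<bar> \<le> R"
    have "traj_mean \<kappa> q n (\<lambda>x. exp (s * (vscore q b x \<bullet> v / sqrt (real n)))) \<le> exp ((s * M)\<^sup>2 * exp \<bar>s * M\<bar>)"
      using traj_mean_exp_score[where \<kappa>=\<kappa> and q=q and v="\<lambda>t. b t \<bullet> v" and M=M, OF \<kappa> q M] by (simp add: score_eq_vscore)
    also have "\<dots> \<le> exp ((R * M)\<^sup>2 * exp (R * M))"
    proof -
      have le: "\<bar>s * M\<bar> \<le> R * M" using s M0 by (simp add: abs_mult mult_right_mono)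
      then have "(s * M)\<^sup>2 \<le> (R * M)\<^sup>2" using power_mono[OF le, of 2] by simp
      then show ?thesis using le by (simp add: mult_mono)
    qed
    finally show "traj_mean \<kappa> q n (\<lambda>x. exp (s * (vscore q b x \<bullet> v / sqrt (real n)))) \<le> exp ((R * M)\<^sup>2 * exp (R * M))" .
  qed
qed

text \<open>Each coordinate is bounded through \<bar>y\<bar> <= exp y + exp (- y), that is, by the
  exponential moments at s = 1 and s = -1.\<close>

lemma vscore_tight: "\<exists>C. \<forall>n. traj_mean \<kappa> q n (\<lambda>x. norm (A *v (vscore q b x /\<^sub>R sqrt (real n)))) \<le> C"
  for A :: "real^'d^'d"
proof -
  define v where "v i = transpose A *v axis i 1" for i
  let ?y = "\<lambda>n i x. vscore q b x \<bullet> v i / sqrt (real n)"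
  let ?N = "\<lambda>n x. norm (A *v (vscore q b x /\<^sub>R sqrt (real n)))"
  have "\<exists>C. \<forall>n s. \<bar>s\<bar> \<le> 1 \<longrightarrow> traj_mean \<kappa> q n (\<lambda>x. exp (s * ?y n i x)) \<le> C" for i
    by (rule exp_score_bound)
  then obtain C where C: "\<And>i n s. \<bar>s\<bar> \<le> 1 \<Longrightarrow> traj_mean \<kappa> q n (\<lambda>x. exp (s * ?y n i x)) \<le> C i"
    by metis
  have comp: "(A *v (y /\<^sub>R c)) $ i = y \<bullet> v i / c" for y :: "real^'d" and c i
  proof -
    have "(A *v (y /\<^sub>R c)) $ i = axis i 1 \<bullet> (A *v (y /\<^sub>R c))" by (simp add: inner_axis')
    also have "\<dots> = v i \<bullet> (y /\<^sub>R c)" unfolding v_def by (metis dot_lmul_matrix transpose_matrix_vector)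
    finally show ?thesis by (simp add: inner_commute divide_inverse)
  qed
  have abs_le: "\<bar>y\<bar> \<le> exp (1 * y) + exp ((- 1) * y)" for y :: real
  proof -
    have "1 + y \<le> exp y" "1 - y \<le> exp (- y)" "0 < exp y" "0 < exp (- y)"
      using exp_ge_add_one_self[of "- y"] by (auto simp: exp_ge_add_one_self)
    then show ?thesis unfolding mult_1_left mult_minus1 by linarith
  qed
  have "traj_mean \<kappa> q n (\<lambda>x. ?N n x) \<le> (\<Sum>i\<in>UNIV. C i + C i)" for n
  proof -
    have "traj_mean \<kappa> q n (\<lambda>x. ?N n x) \<le>
      traj_mean \<kappa> q n (\<lambda>x. \<Sum>i\<in>UNIV. exp (1 * ?y n i x) + exp ((- 1) * ?y n i x))"
    proof (rule traj_mean_mono)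
      fix x
      have "?N n x \<le> (\<Sum>i\<in>UNIV. \<bar>(A *v (vscore q b x /\<^sub>R sqrt (real n))) $ i\<bar>)"
        by (rule norm_le_l1_cart)
      also have "\<dots> \<le> (\<Sum>i\<in>UNIV. exp (1 * ?y n i x) + exp ((- 1) * ?y n i x))"
        unfolding comp by (intro sum_mono abs_le)
      finally show "?N n x \<le> \<dots>" .
    qed
    also have "\<dots> = (\<Sum>i\<in>UNIV. traj_mean \<kappa> q n (\<lambda>x. exp (1 * ?y n i x)) +
        traj_mean \<kappa> q n (\<lambda>x. exp ((- 1) * ?y n i x)))"
      by (subst Bochner_Integration.integral_sum, simp, subst Bochner_Integration.integral_add) simp_all
    also have "\<dots> \<le> (\<Sum>i\<in>UNIV. C i + C i)"
      by (intro sum_mono add_mono C) auto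
    finally show ?thesis .
  qed
  then show ?thesis by blast
qed

text \<open>The left side is F at - i, a point that no real direction reaches; regularity fixes the
  limit of F on a real segment and \<open>vitali_real_segment\<close> extends it.\<close>

lemma convolution_limit:
  fixes S :: "nat \<Rightarrow> (bool \<times> bool) list \<Rightarrow> real^'d" and L :: "(real^'d) measure"
  assumes \<epsilon>: "\<epsilon> > 0"
    and reg: "\<And>h. norm h < \<epsilon> \<Longrightarrow> local_limit S L h"
  shows "(\<lambda>n. traj_mean \<kappa> q n (\<lambda>x. iexp (u \<bullet> (S n x - matrix_inv J *v (vscore q b x /\<^sub>R sqrt (real n))))))
    \<longlonglongrightarrow> exp ((u \<bullet> (matrix_inv J *v u)) / 2) * vchar L u"
proof -
  define v where "v = matrix_inv J *v u"
  define c where "c = u \<bullet> v"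
  have Jv: "J *v v = u"
    using matrix_inv_cancel(2)[OF positive_definite_invertible[OF J]] by (simp add: v_def matrix_vector_mul_assoc)
  have c: "v \<bullet> (J *v v) = c" by (simp add: Jv c_def inner_commute)
  define D where "D n x = vscore q b x \<bullet> v / sqrt (real n)" for n :: nat and x
  define F where "F n z = traj_mean \<kappa> q n (\<lambda>x. iexp (u \<bullet> S n x) * exp (z * of_real (D n x)))" for n and z :: complex
  \<comment> \<open>For h = s v the likelihood factor is exp (s D - s^2 c / 2), and centring at h
    contributes exp (- i s c), because h . J h = s^2 c and u . h = s c. Solving the regularity limit
    for F gives H; at - i the exponent is - c / 2 + c = c / 2.\<close>
  define H where "H z = exp (z\<^sup>2 * of_real c / 2 + \<i> * z * of_real c) * vchar L u" for z :: complex
  \<comment> \<open>The added 1 keeps the denominator positive when u, and with it v, is 0.\<close>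
  define \<delta> where "\<delta> = \<epsilon> / (norm v + 1)"
  have nv: "norm v + 1 > 0" by (smt (verit) norm_ge_zero)
  have "(\<lambda>n. F n (- \<i>)) \<longlonglongrightarrow> H (- \<i>)"
  proof (rule vitali_real_segment[where F=F and H=H and z="- \<i>" and \<delta>=\<delta>])
    show "F n holomorphic_on UNIV" for n
      unfolding F_def traj_mean_sum scaleR_conv_of_real by (intro holomorphic_intros)
    show "H holomorphic_on UNIV" unfolding H_def by (intro holomorphic_intros) auto
    show "\<exists>B. \<forall>n z. norm z \<le> R \<longrightarrow> norm (F n z) \<le> B" for R
    proof -
      obtain C where C: "\<And>n s. \<bar>s\<bar> \<le> R \<Longrightarrow> traj_mean \<kappa> q n (\<lambda>x. exp (s * D n x)) \<le> C"
        using exp_score_bound[of R v] unfolding D_def by blast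
      have "norm (F n z) \<le> C" if "norm z \<le> R" for n z
      proof -
        have "norm (F n z) \<le> traj_mean \<kappa> q n (\<lambda>x. norm (iexp (u \<bullet> S n x) * exp (z * of_real (D n x))))"
          unfolding F_def by (rule integral_norm_bound)
        also have "\<dots> = traj_mean \<kappa> q n (\<lambda>x. exp (Re z * D n x))"
          by (simp add: norm_mult)
        also have "\<dots> \<le> C" using C abs_Re_le_cmod[of z] that by auto
        finally show ?thesis .
      qed
      then show ?thesis by blast
    qed
    show "\<delta> > 0" using \<epsilon> nv by (simp add: \<delta>_def)
    fix s :: real assume s: "\<bar>s\<bar> < \<delta>"
    define h where "h = s *\<^sub>R v"
    have "norm h \<le> \<bar>s\<bar> * (norm v + 1)" by (simp add: h_def mult_left_mono)
    also have "\<dots> < \<epsilon>" using s nv by (simp add: \<delta>_def pos_less_divide_eq)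
    finally obtain q' where q': "\<And>n t. q' n t = q' n (t mod K)"
      "\<And>t. (\<lambda>n. sqrt (real n) * (q' n t - q t)) \<longlonglongrightarrow> b t \<bullet> h"
      "\<forall>\<^sub>F n in sequentially. \<forall>t. q' n t \<in> {0..1}"
      "\<And>u. (\<lambda>n. traj_mean \<kappa> (q' n) n (\<lambda>x. iexp (u \<bullet> (S n x - h)))) \<longlonglongrightarrow> vchar L u"
      using reg unfolding local_limit_def by blast
    obtain M where M: "\<And>t y. \<bar>(b t \<bullet> h) * std_score (q t) y\<bar> \<le> M" using score_bound by blast
    let ?E = "\<lambda>n x. of_real (exp (score q (\<lambda>t. b t \<bullet> h) x / sqrt (real n) - (s\<^sup>2 * c) / 2)) * iexp (u \<bullet> (S n x - h))"
    let ?e = "exp (of_real (s\<^sup>2 * c / 2) + \<i> * of_real (s * c)) :: complex"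
    have hJh: "h \<bullet> (J *v h) = s\<^sup>2 * c"
      by (simp add: h_def matrix_vector_mult_scaleR c power2_eq_square)
    have c0: "0 \<le> c"
    proof (cases "v = 0")
      case False then show ?thesis using J c by (metis less_imp_le positive_definite_def)
    qed (simp add: c_def)
    have "(\<lambda>n. traj_mean \<kappa> (q' n) n (\<lambda>x. iexp (u \<bullet> (S n x - h))) -
       traj_mean \<kappa> q n (\<lambda>x. ?E n x)) \<longlonglongrightarrow> 0"
    proof (rule traj_mean_likelihood_limit[where K=K and M=M])
      show "b t \<bullet> h = b (t mod K) \<bullet> h" for t using per_b[of t] by simp
      show "(\<lambda>n. traj_mean \<kappa> q n (\<lambda>x. \<bar>info q (\<lambda>t. b t \<bullet> h) x / real n - s\<^sup>2 * c\<bar>)) \<longlonglongrightarrow> 0"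
        using info[of h] unfolding hJh .
      show "norm (iexp (u \<bullet> (S n x - h))) \<le> 1" for n x by simp
      show "0 \<le> s\<^sup>2 * c" using c0 by simp
    qed (rule \<kappa> q K per_q q'(1,2,3) M)+
    from tendsto_diff[OF q'(4)[of u] this]
    have "(\<lambda>n. traj_mean \<kappa> q n (\<lambda>x. ?E n x))
        \<longlonglongrightarrow> vchar L u" by simp
    then have "(\<lambda>n. ?e * traj_mean \<kappa> q n (\<lambda>x. ?E n x))
        \<longlonglongrightarrow> ?e * vchar L u"
      by (intro tendsto_intros)
    moreover have "?e * traj_mean \<kappa> q n (\<lambda>x. ?E n x)
        = F n (of_real s)" for n
    proof -
      have "?e * (?E n x)
        = iexp (u \<bullet> S n x) * exp (of_real s * of_real (D n x))" for x
      proof -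
        have "score q (\<lambda>t. b t \<bullet> h) x / sqrt (real n) = s * D n x"
          unfolding score_eq_vscore by (simp add: h_def D_def)
        moreover have "u \<bullet> (S n x - h) = u \<bullet> S n x - s * c" by (simp add: inner_diff_right h_def c_def)
        ultimately show ?thesis
          unfolding exp_of_real[symmetric] exp_add[symmetric]
          by (intro arg_cong[of _ _ exp]) (simp add: algebra_simps)
      qed
      then show ?thesis unfolding F_def by (simp flip: integral_mult_right_zero)
    qed
    ultimately show "(\<lambda>n. F n (of_real s)) \<longlonglongrightarrow> H (of_real s)"
      by (simp add: H_def algebra_simps)
  qed
  moreover have "H (- \<i>) = exp ((u \<bullet> (matrix_inv J *v u)) / 2) * vchar L u"
  proof -
    have "(- \<i>)\<^sup>2 * of_real c / 2 + \<i> * (- \<i>) * of_real c = (of_real (c / 2) :: complex)"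
      by (simp add: power2_eq_square)
    then show ?thesis unfolding H_def by (simp only: exp_of_real) (simp add: c_def v_def)
  qed
  moreover have "F n (- \<i>) = traj_mean \<kappa> q n (\<lambda>x. iexp (u \<bullet> (S n x - matrix_inv J *v (vscore q b x /\<^sub>R sqrt (real n)))))" for n
  proof -
    have sym: "transpose (matrix_inv J) = matrix_inv J"
      using positive_definite_matrix_inv(1)[OF J] by (simp add: positive_definite_def)
    have "u \<bullet> (matrix_inv J *v (vscore q b x /\<^sub>R sqrt (real n))) = D n x" for x
    proof -
      have "u \<bullet> (matrix_inv J *v (vscore q b x /\<^sub>R sqrt (real n))) = v \<bullet> (vscore q b x /\<^sub>R sqrt (real n))"
        using symmetric_matrix_inner[OF sym, of u "vscore q b x /\<^sub>R sqrt (real n)"] by (simp add: v_def)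
      then show ?thesis by (simp add: D_def inner_commute divide_inverse)
    qed
    then have "iexp (u \<bullet> S n x) * exp ((- \<i>) * of_real (D n x)) =
        iexp (u \<bullet> (S n x - matrix_inv J *v (vscore q b x /\<^sub>R sqrt (real n))))" for x
      unfolding exp_add[symmetric] by (intro arg_cong[of _ _ exp]) (simp add: inner_diff_right algebra_simps)
    then show ?thesis unfolding F_def by simp
  qed
  ultimately show ?thesis by simp
qed

text \<open>Both terms of W are bounded in probability, so its laws have a weak limit point, which
  is a genuine probability measure. The known limit of the characteristic functions identifies it,
  and uniqueness turns the product of characteristic functions into a convolution.\<close>

lemma convolution_theorem:
  fixes S :: "nat \<Rightarrow> (bool \<times> bool) list \<Rightarrow> real^'d" and L :: "(real^'d) measure"
  assumes L: "prob_space L" "sets L = sets borel"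
    and \<epsilon>: "\<epsilon> > 0"
    and reg: "\<And>h. norm h < \<epsilon> \<Longrightarrow> local_limit S L h"
    and tight: "\<And>e. e > 0 \<Longrightarrow> \<exists>R\<ge>0. \<forall>\<^sub>F n in sequentially. measure_pmf.prob (traj \<kappa> q n) {x. norm (S n x) \<ge> R} < e"
  shows "\<exists>\<nu>. prob_space \<nu> \<and> sets \<nu> = sets borel \<and> L = (mv_normal 0 (matrix_inv J) \<star> \<nu>)"
proof -
  define V where "V n x = matrix_inv J *v (vscore q b x /\<^sub>R sqrt (real n))" for n :: nat and x
  define W where "W n x = S n x - V n x" for n x
  have "\<exists>R. \<forall>n. measure_pmf.prob (map_pmf (W n) (traj \<kappa> q n)) {x. norm x \<ge> R} < e" if "e > 0" for e
  proof (rule tight_of_eventually_tight[OF _ _ that])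
    fix e :: real assume e: "e > 0"
    obtain R where R: "R \<ge> 0" "\<forall>\<^sub>F n in sequentially. measure_pmf.prob (traj \<kappa> q n) {x. norm (S n x) \<ge> R} < e / 2"
      using tight[of "e / 2"] e by auto
    obtain C where C: "\<And>n. traj_mean \<kappa> q n (\<lambda>x. norm (V n x)) \<le> C"
      using vscore_tight[of "matrix_inv J"] unfolding V_def by blast
    have "0 \<le> traj_mean \<kappa> q 0 (\<lambda>x. norm (V 0 x))" by (rule integral_nonneg_AE) auto
    then have "C \<ge> 0" using C[of 0] by linarith
    \<comment> \<open>Chosen so that Markov's bound C / R' is at most e / 2; the added 1 keeps R'
      positive if C = 0.\<close>
    define R' where "R' = 2 * C / e + 1"
    have R': "R' > 0" using \<open>C \<ge> 0\<close> e by (simp add: R'_def add_nonneg_pos)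
    have V: "measure_pmf.prob (traj \<kappa> q n) {x. norm (V n x) \<ge> R'} \<le> e / 2" for n
    proof -
      have "measure_pmf.prob (traj \<kappa> q n) {x \<in> space (measure_pmf (traj \<kappa> q n)). norm (V n x) \<ge> R'} \<le> traj_mean \<kappa> q n (\<lambda>x. norm (V n x)) / R'"
        by (rule integral_Markov_inequality_measure[where A="UNIV"]) (use R' in auto)
      also have "\<dots> \<le> C / R'" using C R' by (simp add: divide_right_mono)
      also have "\<dots> \<le> e / 2"
      proof -
        have "2 * C \<le> e * R'" using e by (simp add: R'_def field_simps)
        then show ?thesis using R' by (simp add: field_simps)
      qed
      finally show ?thesis by simp
    qed
    have "\<forall>\<^sub>F n in sequentially. measure_pmf.prob (traj \<kappa> q n) {x. norm (W n x) \<ge> R + R'} < e"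
      using R(2)
    proof eventually_elim
      case (elim n)
      have "{x. norm (W n x) \<ge> R + R'} \<subseteq> {x. norm (S n x) \<ge> R} \<union> {x. norm (V n x) \<ge> R'}"
      proof
        fix x assume "x \<in> {x. norm (W n x) \<ge> R + R'}"
        then have "R + R' \<le> norm (S n x) + norm (V n x)"
          using norm_triangle_ineq4[of "S n x" "V n x"] by (simp add: W_def)
        then show "x \<in> {x. norm (S n x) \<ge> R} \<union> {x. norm (V n x) \<ge> R'}" by auto
      qed
      then have "measure_pmf.prob (traj \<kappa> q n) {x. norm (W n x) \<ge> R + R'} \<le>
          measure_pmf.prob (traj \<kappa> q n) ({x. norm (S n x) \<ge> R} \<union> {x. norm (V n x) \<ge> R'})"
        by (intro measure_pmf.finite_measure_mono) auto
      also have "\<dots> \<le> measure_pmf.prob (traj \<kappa> q n) {x. norm (S n x) \<ge> R} + measure_pmf.prob (traj \<kappa> q n) {x. norm (V n x) \<ge> R'}"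
        by (rule measure_Un_le) auto
      finally show ?case using elim V[of n] by linarith
    qed
    then show "\<exists>R. \<forall>\<^sub>F n in sequentially. measure_pmf.prob (traj \<kappa> q n) {x. norm (W n x) \<ge> R} < e" by blast
  qed simp
  then obtain r \<nu> where r: "strict_mono (r :: nat \<Rightarrow> nat)" and \<nu>: "prob_space \<nu>" "sets \<nu> = sets borel"
    and lim: "\<And>f :: real^'d \<Rightarrow> complex. continuous_on UNIV f \<Longrightarrow> bounded (range f) \<Longrightarrow>
      (\<lambda>n. measure_pmf.expectation (map_pmf (W (r n)) (traj \<kappa> q (r n))) f) \<longlonglongrightarrow> integral\<^sup>L \<nu> f"
    by (rule prohorov_pmf[of "\<lambda>n. map_pmf (W n) (traj \<kappa> q n)"]) (blast, rule that)
  have vc: "vchar \<nu> u = exp ((u \<bullet> (matrix_inv J *v u)) / 2) * vchar L u" for u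
  proof (rule LIMSEQ_unique)
    have "(\<lambda>n. measure_pmf.expectation (map_pmf (W (r n)) (traj \<kappa> q (r n))) (\<lambda>x. iexp (u \<bullet> x))) \<longlonglongrightarrow> vchar \<nu> u"
      unfolding vchar_def
      by (rule lim) (auto intro!: continuous_intros simp: bounded_iff intro!: exI[of _ 1])
    then show "(\<lambda>n. traj_mean \<kappa> q (r n) (\<lambda>x. iexp (u \<bullet> W (r n) x))) \<longlonglongrightarrow> vchar \<nu> u"
      by simp
    show "(\<lambda>n. traj_mean \<kappa> q (r n) (\<lambda>x. iexp (u \<bullet> W (r n) x))) \<longlonglongrightarrow> exp ((u \<bullet> (matrix_inv J *v u)) / 2) * vchar L u"
      using LIMSEQ_subseq_LIMSEQ[OF convolution_limit[OF \<epsilon> reg] r, of u] by (simp add: o_def W_def V_def)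
  qed
  have "L = (mv_normal 0 (matrix_inv J) \<star> \<nu>)"
  proof (rule eq_mv_normal_convolutionI[OF positive_definite_matrix_inv(1)[OF J] L \<nu>])
    fix u
    have "exp (- (u \<bullet> (matrix_inv J *v u)) / 2) * exp ((u \<bullet> (matrix_inv J *v u)) / 2) = 1"
      by (simp flip: exp_add)
    then have "complex_of_real (exp (- (u \<bullet> (matrix_inv J *v u)) / 2)) * of_real (exp ((u \<bullet> (matrix_inv J *v u)) / 2)) = 1"
      by (metis of_real_1 of_real_mult)
    then show "vchar L u = complex_of_real (exp (- (u \<bullet> (matrix_inv J *v u)) / 2)) * vchar \<nu> u"
      unfolding vc by (metis mult.assoc mult_1_left)
  qed
  then show ?thesis using \<nu> by blast
qed

end

section \<open>Fisher information of the detection process and conclusion\<close>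

lemma inner_outer_product_mult: "h \<bullet> (outer_product u u *v h) = (u \<bullet> h)\<^sup>2"
proof -
  have "outer_product u u *v h = (u \<bullet> h) *\<^sub>R u"
    by (simp add: vec_eq_iff outer_product_def matrix_vector_mult_def inner_vec_def sum_distrib_left sum_distrib_right mult_ac)
  then show ?thesis by (simp add: inner_commute power2_eq_square)
qed

lemma inner_sum_matrix_mult:
  fixes A :: "nat \<Rightarrow> real^'n^'n"
  shows "h \<bullet> ((\<Sum>r<K. A r) *v h) = (\<Sum>r<K. h \<bullet> (A r *v h))"
  by (induction K) (simp_all add: matrix_vector_mult_add_rdistrib inner_add_right)

text \<open>Since the gradient of p is (1 - p) times that of \<open>lam\<close>, the weight (1 - p)
  / p is rewritten as (1 - p)^2 / (p (1 - p)), the form in which \<open>info_limit\<close> delivers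
  the limit.\<close>

lemma inner_fisher_information:
  assumes "\<And>r. r < K \<Longrightarrow> 0 < p r \<theta> \<and> p r \<theta> < 1"
  shows "h \<bullet> (fisher_information K p lam \<theta> \<alpha> *v h) =
    (\<Sum>r<K. \<alpha> r * ((((1 - p r \<theta>) *\<^sub>R gradient (lam r) \<theta>) \<bullet> h)\<^sup>2 / (p r \<theta> * (1 - p r \<theta>)))) / real K"
proof -
  have "h \<bullet> (fisher_information K p lam \<theta> \<alpha> *v h) =
      (\<Sum>r<K. \<alpha> r * ((1 - p r \<theta>) / p r \<theta> * (gradient (lam r) \<theta> \<bullet> h)\<^sup>2)) / real K"
    unfolding fisher_information_def phase_information_def
    by (simp add: scaleR_matrix_vector_assoc[symmetric] inner_sum_matrix_mult inner_outer_product_mult mult.assoc)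
  also have "(\<Sum>r<K. \<alpha> r * ((1 - p r \<theta>) / p r \<theta> * (gradient (lam r) \<theta> \<bullet> h)\<^sup>2)) =
      (\<Sum>r<K. \<alpha> r * ((((1 - p r \<theta>) *\<^sub>R gradient (lam r) \<theta>) \<bullet> h)\<^sup>2 / (p r \<theta> * (1 - p r \<theta>))))"
  proof (rule sum.cong[OF refl])
    fix r assume "r \<in> {..<K}"
    then have "p r \<theta> \<noteq> 0" "1 - p r \<theta> \<noteq> 0" using assms[of r] by auto
    then show "\<alpha> r * ((1 - p r \<theta>) / p r \<theta> * (gradient (lam r) \<theta> \<bullet> h)\<^sup>2) =
       \<alpha> r * ((((1 - p r \<theta>) *\<^sub>R gradient (lam r) \<theta>) \<bullet> h)\<^sup>2 / (p r \<theta> * (1 - p r \<theta>)))"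
      by (simp add: power_mult_distrib power2_eq_square)
  qed
  finally show ?thesis .
qed

lemma weakly_converges_cong:
  assumes "weakly_converges \<mu> L" "\<forall>\<^sub>F n in sequentially. \<mu> n = \<mu>' n"
  shows "weakly_converges \<mu>' L"
  unfolding weakly_converges_def
proof (intro allI impI)
  fix f :: "'a \<Rightarrow> real" assume "continuous_on UNIV f" "bounded (range f)"
  then have "(\<lambda>n. integral\<^sup>L (\<mu> n) f) \<longlonglongrightarrow> integral\<^sup>L L f" using assms(1) by (simp add: weakly_converges_def)
  then show "(\<lambda>n. integral\<^sup>L (\<mu>' n) f) \<longlonglongrightarrow> integral\<^sup>L L f"
    by (rule Lim_transform_eventually) (use assms(2) in eventually_elim, simp)
qed

theorem theorem1:
  fixes K D :: nat
    and \<Theta> :: "(real ^ 'd) set"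
    and p lam :: "nat \<Rightarrow> real ^ 'd \<Rightarrow> real"
    and \<gamma> :: "real ^ 'd \<Rightarrow> nat \<Rightarrow> real"
    and M :: "real ^ 'd \<Rightarrow> 'w measure"
    and G Y :: "nat \<Rightarrow> 'w \<Rightarrow> bool"
    and \<theta>0 :: "real ^ 'd"
    and est :: "nat \<Rightarrow> (bool \<times> bool) list \<Rightarrow> real ^ 'd"
    and L :: "(real ^ 'd) measure"
  assumes "K \<ge> 1"
    and "DED_process K D \<Theta> p \<gamma> M G Y"
    and "\<And>t \<theta>. \<theta> \<in> \<Theta> \<Longrightarrow> p t \<theta> = 1 - exp (- lam t \<theta>)"
    and "\<And>t \<theta>. \<theta> \<in> \<Theta> \<Longrightarrow> lam t \<theta> = lam (t mod K) \<theta>"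
    and "\<theta>0 \<in> interior \<Theta>"
    and "\<exists>lmin lmax. 0 < lmin \<and> lmin \<le> lmax \<and>
           (\<forall>r<K. \<forall>\<theta>\<in>\<Theta>. lmin \<le> lam r \<theta> \<and> lam r \<theta> \<le> lmax)"
    and "\<And>r. r < K \<Longrightarrow> extends_Ck 3 \<Theta> (lam r)"
    and "\<And>\<theta>. \<theta> \<in> \<Theta> \<Longrightarrow> (\<And>r. r < K \<Longrightarrow> \<gamma> \<theta>0 r > 0 \<Longrightarrow> lam r \<theta> = lam r \<theta>0) \<Longrightarrow> \<theta> = \<theta>0"
    and "compact \<Theta>"
    and "positive_definite (fisher_information K p lam \<theta>0 (\<gamma> \<theta>0))"
    and "regular_estimator (observation_law M G Y) est \<theta>0 L"
  shows "\<exists>\<nu> :: (real ^ 'd) measure. prob_space \<nu> \<and> sets \<nu> = sets borel \<and>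
           L = (mv_normal 0 (matrix_inv (fisher_information K p lam \<theta>0 (\<gamma> \<theta>0))) \<star> \<nu>)"
proof -
  define J where "J = fisher_information K p lam \<theta>0 (\<gamma> \<theta>0)"
  have K: "K > 0" using assms(1) by simp
  note p = assms(3) and per = assms(4)
  have \<theta>0: "\<theta>0 \<in> \<Theta>" using assms(5) interior_subset by blast
  obtain lmin where lmin: "0 < lmin" "\<And>r \<theta>. r < K \<Longrightarrow> \<theta> \<in> \<Theta> \<Longrightarrow> lmin \<le> lam r \<theta>"
    using assms(6) by blast
  \<comment> \<open>Positivity comes from the lower bound on the rates, and p < 1 from positivity of
    the exponential; together they make \<open>std_score\<close> well behaved.\<close>
  have p01: "0 < p t \<theta> \<and> p t \<theta> < 1" if "\<theta> \<in> \<Theta>" for t \<theta>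
  proof -
    have "lmin \<le> lam (t mod K) \<theta>" using lmin(2) K that by simp
    then have "lam t \<theta> > 0" using per[OF that, of t] lmin(1) by linarith
    then show ?thesis using p[OF that, of t] by simp
  qed
  have p_mod: "p t \<theta> = 1 - exp (- lam (t mod K) \<theta>)" if "\<theta> \<in> \<Theta>" for t \<theta>
    using p[OF that, of t] per[OF that, of t] by simp
  obtain \<Phi> where \<Phi>: "\<And>t. case_prod (\<Phi> t) \<in> measurable
      (count_space {xs. length xs = t} \<Otimes>\<^sub>M restrict_space borel {0..1}) (count_space UNIV)"
    and Z: "\<And>\<theta>. \<theta> \<in> \<Theta> \<Longrightarrow> \<exists>Z. observation_condition (M \<theta>) (\<lambda>t. p t \<theta>) G Y Z \<and> causality_condition (M \<theta>) \<Phi> G Y Z"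
    using assms(2) unfolding DED_process_def by blast
  have obs: "\<exists>Z. causal_observation (M \<theta>) (\<lambda>t. p t \<theta>) G Y Z \<Phi>" if "\<theta> \<in> \<Theta>" for \<theta>
  proof -
    obtain Z where "observation_condition (M \<theta>) (\<lambda>t. p t \<theta>) G Y Z" "causality_condition (M \<theta>) \<Phi> G Y Z"
      using Z \<open>\<theta> \<in> \<Theta>\<close> by blast
    moreover have "prob_space (M \<theta>)" "\<And>t. G t \<in> measurable (M \<theta>) (count_space UNIV)"
      "\<And>t. Y t \<in> measurable (M \<theta>) (count_space UNIV)" "\<And>t. p t \<theta> \<in> {0..1}"
      using assms(2) that unfolding DED_process_def by blast+
    ultimately show ?thesis
      using \<Phi> unfolding causal_observation_def causal_observation_axioms_def by blast
  qed
  define \<kappa> where "\<kappa> = gate_prob \<Phi>"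
  have law: "observation_law M G Y \<theta> n = measure_pmf (traj \<kappa> (\<lambda>t. p t \<theta>) n)" if "\<theta> \<in> \<Theta>" for \<theta> n
    using obs[OF that] causal_observation.distr_observations unfolding observation_law_def \<kappa>_def by metis
  define q where "q t = p t \<theta>0" for t
  \<comment> \<open>By the chain rule this is the gradient at \<open>\<theta>0\<close> of the event
    probability 1 - exp (- lam).\<close>
  define b where "b t = (1 - q t) *\<^sub>R gradient (lam (t mod K)) \<theta>0" for t
  have per_q: "q t = q (t mod K)" for t using p_mod[OF \<theta>0] by (simp add: q_def)
  have per_b: "b t = b (t mod K)" for t using per_q[of t] by (simp add: b_def)
  obtain Z where "causal_observation (M \<theta>0) q G Y Z \<Phi>"
    using obs[OF \<theta>0] unfolding q_def by blast
  then interpret obs0: causal_observation "M \<theta>0" q G Y Z \<Phi> .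
  have gat: "gating_frequency_condition (M \<theta>0) K G (\<gamma> \<theta>0)"
    using assms(2) \<theta>0 unfolding DED_process_def by blast
  have quad: "h \<bullet> (J *v h) = (\<Sum>r<K. \<gamma> \<theta>0 r * ((b r \<bullet> h)\<^sup>2 / (q r * (1 - q r)))) / real K" for h
    unfolding J_def using p01[OF \<theta>0] by (subst inner_fisher_information) (simp_all add: b_def q_def)
  interpret local_experiment \<kappa> q K b J
  proof
    show "\<kappa> t x \<in> {0..1}" for t x unfolding \<kappa>_def by (rule gate_prob_bounds)
    show "positive_definite J" unfolding J_def by (rule assms(10))
    show "(\<lambda>n. traj_mean \<kappa> q n (\<lambda>x. \<bar>info q (\<lambda>t. b t \<bullet> h) x / real n - h \<bullet> (J *v h)\<bar>)) \<longlonglongrightarrow> 0" for h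
      unfolding quad \<kappa>_def
      by (rule obs0.info_limit[OF K per_q _ gat]) (use per_b in metis)
  qed (use p01[OF \<theta>0] K per_q per_b in \<open>auto simp: q_def\<close>)
  define S where "S n x = sqrt (real n) *\<^sub>R (est n x - \<theta>0)" for n x
  define \<theta> where "\<theta> h n = \<theta>0 + h /\<^sub>R sqrt (real n)" for h and n :: nat
  \<comment> \<open>Written with \<open>lam (t mod K)\<close> instead of \<open>p\<close>, so that
    it is periodic in t even for those n where \<open>\<theta> h n\<close> lies outside the
    parameter set; inside the set it equals \<open>p\<close>.\<close>
  define q' where "q' h n t = 1 - exp (- lam (t mod K) (\<theta> h n))" for h n t
  obtain \<epsilon> where L: "prob_space L" "sets L = sets borel" and \<epsilon>: "\<epsilon> > 0"
    and reg: "\<And>h. norm h < \<epsilon> \<Longrightarrow> weakly_converges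
          (\<lambda>T. distr (observation_law M G Y (\<theta>0 + h /\<^sub>R sqrt (real T)) T) borel
                 (\<lambda>x. sqrt (real T) *\<^sub>R (est T x - \<theta>0 - h /\<^sub>R sqrt (real T)))) L"
    using assms(11) unfolding regular_estimator_def by blast
  have ev: "\<forall>\<^sub>F n in sequentially. \<theta> h n \<in> \<Theta>" for h
  proof -
    have "(\<lambda>n. inverse (sqrt (real n))) \<longlonglongrightarrow> 0" by real_asymp
    then have "(\<lambda>n. \<theta> h n) \<longlonglongrightarrow> \<theta>0 + 0 *\<^sub>R h"
      unfolding \<theta>_def by (intro tendsto_intros)
    then have "\<forall>\<^sub>F n in sequentially. \<theta> h n \<in> interior \<Theta>"
      by (rule topological_tendstoD) (use assms(5) in auto)
    then show ?thesis by eventually_elim (use interior_subset in blast)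
  qed
  have q': "q' h n = (\<lambda>t. p t (\<theta> h n))" if "\<theta> h n \<in> \<Theta>" for h n
    using p_mod[OF that] by (auto simp: q'_def)
  have conv: "weakly_converges (\<lambda>n. distr (measure_pmf (traj \<kappa> (q' h n) n)) borel (\<lambda>x. S n x - h)) L"
    if "norm h < \<epsilon>" for h
  proof (rule weakly_converges_cong[OF reg[OF that]])
    show "\<forall>\<^sub>F n in sequentially. distr (observation_law M G Y (\<theta>0 + h /\<^sub>R sqrt (real n)) n) borel
         (\<lambda>x. sqrt (real n) *\<^sub>R (est n x - \<theta>0 - h /\<^sub>R sqrt (real n))) =
       distr (measure_pmf (traj \<kappa> (q' h n) n)) borel (\<lambda>x. S n x - h)"
      using ev[of h] eventually_gt_at_top[of 0]
    proof eventually_elim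
      case (elim n)
      have "sqrt (real n) *\<^sub>R (est n x - \<theta>0 - h /\<^sub>R sqrt (real n)) = S n x - h" for x
        using elim(2) by (simp add: S_def scaleR_diff_right)
      then show ?case
        using law[OF elim(1), of n] q'[OF elim(1)] by (simp add: \<theta>_def)
    qed
  qed
  have prob: "prob_space (distr (measure_pmf P) borel f)" for P :: "(bool \<times> bool) list pmf" and f :: "_ \<Rightarrow> real^'d"
    by (rule measure_pmf.prob_space_distr) simp
  have "\<exists>\<nu>. prob_space \<nu> \<and> sets \<nu> = sets borel \<and> L = (mv_normal 0 (matrix_inv J) \<star> \<nu>)"
  proof (rule convolution_theorem[OF L \<epsilon>, where S=S])
    fix h :: "real^'d" assume h: "norm h < \<epsilon>"
    have "(\<lambda>n. sqrt (real n) * (q' h n t - q t)) \<longlonglongrightarrow> b t \<bullet> h" for t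
    proof -
      have "t mod K < K" using K by simp
      from assms(7)[OF this] have "extends_Ck (Suc 2) \<Theta> (lam (t mod K))" by (simp add: numeral_3_eq_3)
      from scaled_increment_limit[OF gradient_has_derivative[OF extends_Ck_differentiable[OF this assms(5)]], of h]
      show ?thesis by (simp add: q'_def \<theta>_def q_def p_mod[OF \<theta>0] b_def)
    qed
    moreover have "\<forall>\<^sub>F n in sequentially. \<forall>t. q' h n t \<in> {0..1}"
      using ev[of h] by eventually_elim (use p01 q' in \<open>auto simp: less_imp_le\<close>)
    moreover have "(\<lambda>n. traj_mean \<kappa> (q' h n) n (\<lambda>x. iexp (u \<bullet> (S n x - h)))) \<longlonglongrightarrow> vchar L u" for u
      using weakly_converges_vchar[OF conv[OF h] prob _ L, of u] by (simp add: vchar_def integral_distr)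
    moreover have "q' h n t = q' h n (t mod K)" for n t by (simp add: q'_def)
    ultimately show "local_limit S L h"
      unfolding local_limit_def by blast
  next
    fix e :: real assume e: "e > 0"
    \<comment> \<open>Regularity at h = 0 is weak convergence of S under \<open>\<theta>0\<close>
      itself, which supplies the tightness.\<close>
    have "q' 0 n = q" for n using q'[of 0 n] \<theta>0 by (auto simp: \<theta>_def q_def)
    then have "weakly_converges (\<lambda>n. distr (measure_pmf (traj \<kappa> q n)) borel (S n)) L"
      using conv[of 0] \<epsilon> by simp
    from weakly_converges_bounded_in_prob[OF L prob _ this e]
    show "\<exists>R\<ge>0. \<forall>\<^sub>F n in sequentially. measure_pmf.prob (traj \<kappa> q n) {x. norm (S n x) \<ge> R} < e"
      by (simp add: measure_distr vimage_def)
  qed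
  then show ?thesis unfolding J_def .
qed

end
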